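(* Let $(\Omega^1,d)$ be a first order differential calculus over $A$ with $\Omega^1$ a pivotal bimodule with dual $\mathfrak{X}^1$. The Hopf algebroid $H\mathfrak{X}^1$ admits an invertible antipode if and only if there exists a $\mathbb{K}$-linear map $\Upsilon:\mathfrak{X}^1\to A$ satisfying $$\Upsilon(xa)=\Upsilon(x)a+\mathrm{ev}(x\otimes da),\qquad \Upsilon(ax)=a\Upsilon(x)+\underline{\mathrm{ev}}(da\otimes x)\qquad(x\in\mathfrak{X}^1,\ a\in A).$$ In particular, if such $\Upsilon$ exists, the maps $S$ and $S^{-1}$ given on $x\in\mathfrak{X}^1$ by $$S(x)=-(\omega_i,x)\bullet x_i-\overline{\Upsilon(x)},\qquad S^{-1}(x)=-\big(y_j+\Upsilon(y_j)\big)\bullet(\rho_j,x)$$ extend the maps $S$ and $S^{-1}=S$ defined on the generators of $H(\Omega^1)$ by $S(a)=\overline{a}$, $S(\overline{a})=a$, $S((x,\omega))=(\omega,x)$, $S((\omega,x))=(x,\omega)$ to well-defined anti-algebra morphisms on $H\mathfrak{X}^1$, and are inverses. Furthermore, they satisfy the conditions of a Böhm–Szlachányi Hopf algebroid.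
   Context: Conventions. $\mathbb{K}$ is a field, $A$ a unital associative $\mathbb{K}$-algebra, $\otimes$ means $\otimes_A$. $A^{op}=\{\overline{a}: a\in A\}$ with $\overline{a}\,\overline{b}=\overline{ba}$; $A^e=A\otimes_{\mathbb{K}}A^{op}$ with elements written $a\overline{b}$. Summation over repeated dual-basis indices is implicit. $T_{A^e}(V)$, $TV$ are tensor algebras, $\star$ the free product of algebras. A first order differential calculus is an $A$-bimodule $\Omega^1$ with a $\mathbb{K}$-linear $d:A\to\Omega^1$ satisfying $d(ab)=(da)b+a\,db$. Hopf algebroids and antipodes. Let $B$ be a left $A$-bialgebroid, with algebra map $A^e\to B$ (images of $a$, $\overline{a}$ are again written $a$, $\overline{a}$) and coproduct $\Delta(b)=b_{(1)}\otimes b_{(2)}$, where $B$ is an $A$-bimodule by $r\cdot b\cdot s=r\overline{s}b$. Let $B\diamond B=B\otimes_{\mathbb{K}}B/\langle\overline{s}b\otimes b'-b\otimes sb'\rangle$ (the target of $\Delta$). $B$ is a (Schauenburg) Hopf algebroid if the maps $b\otimes b'\mapsto b_{(1)}\diamond b_{(2)}b'$ from $B\otimes_{\mathbb{K}}B/\langle b\overline{s}\otimes b'-b\otimes\overline{s}b'\rangle$ to $B\diamond B$ and $b\otimes b'\mapsto b_{(1)}b'\diamond b_{(2)}$ from $B\otimes_{\mathbb{K}}B/\langle br\otimes b'-b\otimes rb'\rangle$ to $B\diamond B$ are invertible. An invertible antipode (Böhm–Szlachányi Hopf algebroid structure) is an anti-algebra automorphism $S:B\to B$ with $S(\overline{a})=a$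 for $a\in A$ and, for all $b\in B$, $$S(b_{(1)})_{(1)}b_{(2)}\diamond S(b_{(1)})_{(2)}=1\diamond S(b),\qquad S^{-1}(b_{(2)})_{(1)}\diamond S^{-1}(b_{(2)})_{(2)}b_{(1)}=S^{-1}(b)\diamond1.$$ Pivotal bimodules. $\Omega^1$ is pivotal if it is finitely generated projective on both sides and its left dual $\mathrm{Hom}_A(\Omega^1,A)$ and right dual ${}_A\mathrm{Hom}(\Omega^1,A)$ are isomorphic as bimodules. Fixing such an isomorphism, a single bimodule $\mathfrak{X}^1$ is both left and right dual of $\Omega^1$, with bimodule maps $\mathrm{ev}:\mathfrak{X}^1\otimes\Omega^1\to A$, $\mathrm{coev}:A\to\Omega^1\otimes\mathfrak{X}^1$, $\mathrm{coev}(1)=\omega_i\otimes x_i$, $\underline{\mathrm{ev}}:\Omega^1\otimes\mathfrak{X}^1\to A$, $\underline{\mathrm{coev}}:A\to\mathfrak{X}^1\otimes\Omega^1$, $\underline{\mathrm{coev}}(1)=y_j\otimes\rho_j$, satisfying $\omega=\omega_i\,\mathrm{ev}(x_i\otimes\omega)=\underline{\mathrm{ev}}(\omega\otimes y_j)\rho_j$ and $x=\mathrm{ev}(x\otimes\omega_i)x_i=y_j\,\underline{\mathrm{ev}}(\rho_j\otimes x)$. The bialgebroid $H(\Omega^1)$. Let $\mathfrak{Z}=(\mathfrak{X}^1\otimes_{\mathbb{K}}\Omega^1)\oplus(\Omega^1\otimes_{\mathbb{K}}\mathfrak{X}^1)$; write $(x,\omega)$ for $x\otimes_{\mathbb{K}}\omega$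 in the first summand and $(\omega,x)$ for $\omega\otimes_{\mathbb{K}}x$ in the second. $\mathfrak{Z}$ is an $A^e$-bimodule via $a\overline{a'}(x,\omega)b\overline{b'}=(axb,b'\omega a')$ and $a\overline{a'}(\omega,x)b\overline{b'}=(a\omega b,b'xa')$. $H(\Omega^1)$ is the quotient of $T_{A^e}(\mathfrak{Z})$ (product $\bullet$) by the relations, for all $x\in\mathfrak{X}^1$, $\omega\in\Omega^1$, $$(\omega_i,x)\bullet(x_i,\omega)=\overline{\underline{\mathrm{ev}}(\omega\otimes x)},\quad (x,\rho_j)\bullet(\omega,y_j)=\mathrm{ev}(x\otimes\omega),$$ $$(y_j,\omega)\bullet(\rho_j,x)=\overline{\mathrm{ev}(x\otimes\omega)},\quad (\omega,x_i)\bullet(x,\omega_i)=\underline{\mathrm{ev}}(\omega\otimes x).$$ The bialgebroid $H\mathfrak{X}^1$ is the quotient of $H(\Omega^1)\star T\mathfrak{X}^1$ by the relations $a\bullet x=ax$, $x\bullet a=xa+\mathrm{ev}(x\otimes da)$, $x\bullet\overline{a}=\overline{a}\bullet x+(x,da)$ for $x\in\mathfrak{X}^1$, $a\in A$. It is a left $A$-bialgebroid, and a Hopf algebroid, with $\Delta(a\overline{b})=a\otimes\overline{b}$, $\Delta((x,\omega))=(x,\omega_i)\otimes(x_i,\omega)$, $\Delta((\omega,x))=(\omega,y_j)\otimes(\rho_j,x)$, $\Delta(x)=x\otimes1+(x,\omega_i)\otimes x_i$, $\epsilon(a\overline{b})=ab$, $\epsilon((x,\omega))=\mathrm{ev}(x\otimes\omega)$,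 $\epsilon((\omega,x))=\underline{\mathrm{ev}}(\omega\otimes x)$, $\epsilon(x)=0$, extended by $\Delta(m\bullet n)=m_{(1)}\bullet n_{(1)}\otimes m_{(2)}\bullet n_{(2)}$ and $\epsilon(m\bullet n)=\epsilon(m\bullet\epsilon(n))$.
   Formalization: "Admits an invertible antipode" is read as admitting one that extends the given antipode of H(Ω^1) on its generators; for an arbitrary antipode "only if" fails, e.g. A=Q[t], Ω^1=Aw, df=f'w, ev(x,w)=1, underlined ev(w,x)=2. *)

theory Defs
  imports "HOL-Algebra.Algebra" "HOL-Library.Poly_Mapping"
begin

section \<open>First order differential calculi with pivotal bimodule of one-forms\<close>

locale unital_algebra =
  vector_space scl
  for scl :: "'k::field \<Rightarrow> 'a::{ring,monoid_mult} \<Rightarrow> 'a" +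
  assumes scl_mult_left: "scl k (a * b) = scl k a * b"
    and scl_mult_right: "scl k (a * b) = a * scl k b"

text \<open>The last axiom says that the two actions of the ground field agree, so that a bimodule is
  a module over the enveloping algebra; the vector space structure of a bimodule is
  \<open>k \<cdot> v = l (scl k 1) v\<close>.\<close>

locale algebra_bimodule =
  fixes scl :: "'k::field \<Rightarrow> 'a::{ring,monoid_mult} \<Rightarrow> 'a"
    and l :: "'a \<Rightarrow> 'v::ab_group_add \<Rightarrow> 'v"
    and r :: "'v \<Rightarrow> 'a \<Rightarrow> 'v"
  assumes l_add_right: "l a (v + w) = l a v + l a w"
    and l_add_left: "l (a + b) v = l a v + l b v"
    and l_assoc: "l (a * b) v = l a (l b v)"
    and l_one: "l 1 v = v"
    and r_add_left: "r (v + w) a = r v a + r w a"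
    and r_add_right: "r v (a + b) = r v a + r v b"
    and r_assoc: "r v (a * b) = r (r v a) b"
    and r_one: "r v 1 = v"
    and l_r_commute: "l a (r v b) = r (l a v) b"
    and scl_central: "l (scl k 1) v = r v (scl k 1)"

text \<open>A bimodule map \<open>U \<otimes>\<^sub>A V \<rightarrow> A\<close>, given by the corresponding balanced biadditive map.\<close>

locale bimodule_pairing =
  fixes lU :: "'a::{ring,monoid_mult} \<Rightarrow> 'u::ab_group_add \<Rightarrow> 'u"
    and rU :: "'u \<Rightarrow> 'a \<Rightarrow> 'u"
    and lV :: "'a \<Rightarrow> 'v::ab_group_add \<Rightarrow> 'v"
    and rV :: "'v \<Rightarrow> 'a \<Rightarrow> 'v"
    and p :: "'u \<Rightarrow> 'v \<Rightarrow> 'a"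
  assumes add_left: "p (u + u') v = p u v + p u' v"
    and add_right: "p u (v + v') = p u v + p u v'"
    and balanced: "p (rU u a) v = p u (lV a v)"
    and map_left: "p (lU a u) v = a * p u v"
    and map_right: "p u (rV v a) = p u v * a"

text \<open>The type \<open>'w\<close> carries the one-forms and \<open>'x\<close> their dual.  The lists \<open>coev\<close> and \<open>ucoev\<close>
  hold the elements \<open>coev(1) = \<Sum>\<^sub>i \<omega>\<^sub>i \<otimes> x\<^sub>i\<close> and \<open>ucoev(1) = \<Sum>\<^sub>j y\<^sub>j \<otimes> \<rho>\<^sub>j\<close> as finite sums of pure
  tensors; \<open>uev\<close> and \<open>ucoev\<close> are the underlined evaluation and coevaluation.\<close>

record ('k, 'a, 'w, 'x) calculus =
  scl :: "'k \<Rightarrow> 'a \<Rightarrow> 'a"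
  lW :: "'a \<Rightarrow> 'w \<Rightarrow> 'w"
  rW :: "'w \<Rightarrow> 'a \<Rightarrow> 'w"
  lX :: "'a \<Rightarrow> 'x \<Rightarrow> 'x"
  rX :: "'x \<Rightarrow> 'a \<Rightarrow> 'x"
  dif :: "'a \<Rightarrow> 'w"
  ev :: "'x \<Rightarrow> 'w \<Rightarrow> 'a"
  uev :: "'w \<Rightarrow> 'x \<Rightarrow> 'a"
  coev :: "('w \<times> 'x) list"
  ucoev :: "('x \<times> 'w) list"

text \<open>The duality identities imply \<open>\<Sum>\<^sub>i a \<omega>\<^sub>i \<otimes> x\<^sub>i = \<Sum>\<^sub>i \<omega>\<^sub>i \<otimes> x\<^sub>i a\<close> (and likewise for \<open>ucoev\<close>), that
  is, they make the coevaluations bimodule maps, and they make both bimodules finitely generated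
  projective on either side.\<close>

locale pivotal_calculus =
  fixes C :: "('k::field, 'a::{ring,monoid_mult}, 'w::ab_group_add, 'x::ab_group_add) calculus"
  assumes algebra: "unital_algebra (scl C)"
    and bimodule_W: "algebra_bimodule (scl C) (lW C) (rW C)"
    and bimodule_X: "algebra_bimodule (scl C) (lX C) (rX C)"
    and dif_linear: "Vector_Spaces.linear (scl C) (\<lambda>k. lW C (scl C k 1)) (dif C)"
    and dif_mult: "dif C (a * b) = rW C (dif C a) b + lW C a (dif C b)"
    and pairing_ev: "bimodule_pairing (lX C) (rX C) (lW C) (rW C) (ev C)"
    and pairing_uev: "bimodule_pairing (lW C) (rW C) (lX C) (rX C) (uev C)"
    and dual_W: "w = (\<Sum>(wi, xi)\<leftarrow>coev C. rW C wi (ev C xi w))"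
    and udual_W: "w = (\<Sum>(yj, rj)\<leftarrow>ucoev C. lW C (uev C w yj) rj)"
    and dual_X: "x = (\<Sum>(wi, xi)\<leftarrow>coev C. lX C (ev C x wi) xi)"
    and udual_X: "x = (\<Sum>(yj, rj)\<leftarrow>ucoev C. rX C yj (uev C rj x))"


section \<open>Algebras given by generators and relations\<close>

datatype 'g word = Word "'g list"

instantiation word :: (type) monoid_add
begin

definition zero_word :: "'a word"
  where "zero_word = Word []"

fun plus_word :: "'a word \<Rightarrow> 'a word \<Rightarrow> 'a word"
  where "plus_word (Word u) (Word v) = Word (u @ v)"

instance
proof
  fix a b c :: "'a word"
  show "a + b + c = a + (b + c)"
    by (cases a; cases b; cases c) simp
  show "0 + a = a" "a + 0 = a"
    by (cases a; simp add: zero_word_def)+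
qed

end

text \<open>Concatenation of words being the addition of \<open>'g word\<close>, the convolution product of
  \<open>poly_mapping\<close> makes \<open>'g word \<Rightarrow>\<^sub>0 'k\<close> the free associative unital algebra on \<open>'g\<close>.\<close>

definition gen :: "'g \<Rightarrow> 'g word \<Rightarrow>\<^sub>0 'k::field"
  where "gen g = Poly_Mapping.single (Word [g]) 1"

definition scalar :: "'k::field \<Rightarrow> 'g word \<Rightarrow>\<^sub>0 'k"
  where "scalar k = Poly_Mapping.single 0 k"

definition free_algebra :: "('g word \<Rightarrow>\<^sub>0 'k::field) ring"
  where "free_algebra = \<lparr>carrier = UNIV, monoid.mult = (*), one = 1, ring.zero = 0, ring.add = (+)\<rparr>"

type_synonym ('g, 'k) relator = "('g word \<Rightarrow>\<^sub>0 'k) \<Rightarrow> ('g word \<Rightarrow>\<^sub>0 'k) \<Rightarrow> bool"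

definition relation_ideal :: "('g, 'k::field) relator \<Rightarrow> ('g word \<Rightarrow>\<^sub>0 'k) set"
  where "relation_ideal R = Idl\<^bsub>free_algebra\<^esub> {u - v |u v. R u v}"

definition presented_class :: "('g, 'k::field) relator \<Rightarrow> ('g word \<Rightarrow>\<^sub>0 'k) \<Rightarrow> ('g word \<Rightarrow>\<^sub>0 'k) set"
  where "presented_class R f = relation_ideal R +>\<^bsub>free_algebra\<^esub> f"

definition presented_ring :: "('g, 'k::field) relator \<Rightarrow> ('g word \<Rightarrow>\<^sub>0 'k) set ring"
  where "presented_ring R = free_algebra Quot relation_ideal R"


section \<open>Antipodes of left bialgebroids\<close>

text \<open>An \<open>ae_ring\<close> is an algebra \<open>B\<close> with an algebra map from the enveloping algebra of \<open>A\<close>, whose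
  values on \<open>a\<close> and on its opposite copy are \<open>src a\<close> and \<open>tgt a\<close>.\<close>

record ('k, 'a, 'b) ae_ring = "('k, 'b) module" +
  src :: "'a \<Rightarrow> 'b"
  tgt :: "'a \<Rightarrow> 'b"

text \<open>\<open>diamond B\<close> is the quotient of \<open>B \<otimes>\<^sub>K B\<close> by the elements \<open>tgt s b \<otimes> b' - b \<otimes> src s b'\<close>, realised
  as a quotient of the free abelian group on pairs.  As usual in HOL-Algebra, the group
  \<open>free_Abelian_group\<close> is a multiplicative structure whose \<open>mult\<close> is addition of formal sums.\<close>

inductive_set diamond_relations ::
    "('k, 'a, 'b, 'z) ae_ring_scheme \<Rightarrow> ('b \<times> 'b \<Rightarrow>\<^sub>0 int) set"
  for B :: "('k, 'a, 'b, 'z) ae_ring_scheme" (structure)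
  where
    add_left: "\<lbrakk>b \<in> carrier B; b' \<in> carrier B; c \<in> carrier B\<rbrakk> \<Longrightarrow>
      frag_of (b \<oplus> b', c) - frag_of (b, c) - frag_of (b', c) \<in> diamond_relations B"
  | add_right: "\<lbrakk>b \<in> carrier B; c \<in> carrier B; c' \<in> carrier B\<rbrakk> \<Longrightarrow>
      frag_of (b, c \<oplus> c') - frag_of (b, c) - frag_of (b, c') \<in> diamond_relations B"
  | scalar_balanced: "\<lbrakk>b \<in> carrier B; c \<in> carrier B\<rbrakk> \<Longrightarrow>
      frag_of (k \<odot> b, c) - frag_of (b, k \<odot> c) \<in> diamond_relations B"
  | balanced: "\<lbrakk>b \<in> carrier B; c \<in> carrier B\<rbrakk> \<Longrightarrow>
      frag_of (tgt B s \<otimes> b, c) - frag_of (b, src B s \<otimes> c) \<in> diamond_relations B"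

definition formal_sums :: "('k, 'a, 'b, 'z) ae_ring_scheme \<Rightarrow> ('b \<times> 'b \<Rightarrow>\<^sub>0 int) monoid"
  where "formal_sums B = free_Abelian_group (carrier B \<times> carrier B)"

definition diamond_kernel :: "('k, 'a, 'b, 'z) ae_ring_scheme \<Rightarrow> ('b \<times> 'b \<Rightarrow>\<^sub>0 int) set"
  where "diamond_kernel B = generate (formal_sums B) (diamond_relations B)"

definition diamond :: "('k, 'a, 'b, 'z) ae_ring_scheme \<Rightarrow> ('b \<times> 'b \<Rightarrow>\<^sub>0 int) set monoid"
  where "diamond B = formal_sums B Mod diamond_kernel B"

definition diamond_class ::
    "('k, 'a, 'b, 'z) ae_ring_scheme \<Rightarrow> ('b \<times> 'b \<Rightarrow>\<^sub>0 int) \<Rightarrow> ('b \<times> 'b \<Rightarrow>\<^sub>0 int) set"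
  where "diamond_class B u = diamond_kernel B #>\<^bsub>formal_sums B\<^esub> u"

text \<open>\<open>comult\<close> maps the carrier of \<open>B\<close> to the carrier of \<open>diamond B\<close>.  The counit is left out of the
  structure, because the antipode axioms do not involve it.\<close>

record ('k, 'a, 'b) bialgebroid = "('k, 'a, 'b) ae_ring" +
  comult :: "'b \<Rightarrow> ('b \<times> 'b \<Rightarrow>\<^sub>0 int) set"

text \<open>Sweedler notation \<open>b\<^sub>(\<^sub>1\<^sub>) \<otimes> b\<^sub>(\<^sub>2\<^sub>)\<close>: a formal sum of pairs that represents the coproduct.\<close>

definition sweedler :: "('k, 'a, 'b, 'z) bialgebroid_scheme \<Rightarrow> 'b \<Rightarrow> ('b \<times> 'b \<Rightarrow>\<^sub>0 int)"
  where "sweedler B b = (SOME u. u \<in> comult B b)"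

definition opposite_ring :: "('b, 'z) ring_scheme \<Rightarrow> 'b ring"
  where "opposite_ring R = \<lparr>carrier = carrier R, monoid.mult = (\<lambda>x y. y \<otimes>\<^bsub>R\<^esub> x),
    one = \<one>\<^bsub>R\<^esub>, ring.zero = \<zero>\<^bsub>R\<^esub>, ring.add = (\<oplus>\<^bsub>R\<^esub>)\<rparr>"

definition anti_algebra_hom :: "('k, 'b, 'z) module_scheme \<Rightarrow> ('b \<Rightarrow> 'b) \<Rightarrow> bool"
  where "anti_algebra_hom B S \<longleftrightarrow>
    S \<in> ring_hom B (opposite_ring B) \<and>
    (\<forall>k. \<forall>b\<in>carrier B. S (k \<odot>\<^bsub>B\<^esub> b) = k \<odot>\<^bsub>B\<^esub> S b)"

definition mutually_inverse :: "('b, 'z) partial_object_scheme \<Rightarrow> ('b \<Rightarrow> 'b) \<Rightarrow> ('b \<Rightarrow> 'b) \<Rightarrow> bool"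
  where "mutually_inverse B S T \<longleftrightarrow>
    S \<in> carrier B \<rightarrow> carrier B \<and> T \<in> carrier B \<rightarrow> carrier B \<and>
    (\<forall>b\<in>carrier B. T (S b) = b \<and> S (T b) = b)"

text \<open>\<open>S\<close> is an invertible antipode on \<open>B\<close>, with inverse \<open>T\<close>.  The last two conjuncts are
  \<open>S(b\<^sub>(\<^sub>1\<^sub>))\<^sub>(\<^sub>1\<^sub>) b\<^sub>(\<^sub>2\<^sub>) \<diamond> S(b\<^sub>(\<^sub>1\<^sub>))\<^sub>(\<^sub>2\<^sub>) = 1 \<diamond> S(b)\<close> and
  \<open>T(b\<^sub>(\<^sub>2\<^sub>))\<^sub>(\<^sub>1\<^sub>) \<diamond> T(b\<^sub>(\<^sub>2\<^sub>))\<^sub>(\<^sub>2\<^sub>) b\<^sub>(\<^sub>1\<^sub>) = T(b) \<diamond> 1\<close>.\<close>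

definition invertible_antipode ::
    "('k, 'a, 'b, 'z) bialgebroid_scheme \<Rightarrow> ('b \<Rightarrow> 'b) \<Rightarrow> ('b \<Rightarrow> 'b) \<Rightarrow> bool"
  where "invertible_antipode B S T \<longleftrightarrow>
    anti_algebra_hom B S \<and> mutually_inverse B S T \<and>
    (\<forall>a. S (tgt B a) = src B a) \<and>
    (\<forall>b\<in>carrier B.
      diamond_class B
        (frag_extend (\<lambda>(b1, b2).
          frag_extend (\<lambda>(c1, c2). frag_of (c1 \<otimes>\<^bsub>B\<^esub> b2, c2)) (sweedler B (S b1)))
          (sweedler B b))
      = diamond_class B (frag_of (\<one>\<^bsub>B\<^esub>, S b))) \<and>
    (\<forall>b\<in>carrier B.
      diamond_class B
        (frag_extend (\<lambda>(b1, b2).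
          frag_extend (\<lambda>(c1, c2). frag_of (c1, c2 \<otimes>\<^bsub>B\<^esub> b1)) (sweedler B (T b2)))
          (sweedler B b))
      = diamond_class B (frag_of (T b, \<one>\<^bsub>B\<^esub>)))"


section \<open>The bialgebroid of a pivotal calculus\<close>

text \<open>Generators: \<open>a\<close>, \<open>a\<close> in the opposite copy of \<open>A\<close>, \<open>(x, \<omega>)\<close>, \<open>(\<omega>, x)\<close> and \<open>x\<close>.\<close>

datatype ('a, 'w, 'x) generator = GA 'a | GAop 'a | GXW 'x 'w | GWX 'w 'x | GX 'x

type_synonym ('k, 'a, 'w, 'x) expr = "('a, 'w, 'x) generator word \<Rightarrow>\<^sub>0 'k"

abbreviation iA :: "'a \<Rightarrow> ('k::field, 'a, 'w, 'x) expr" where "iA a \<equiv> gen (GA a)"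
abbreviation iAop :: "'a \<Rightarrow> ('k::field, 'a, 'w, 'x) expr" where "iAop a \<equiv> gen (GAop a)"
abbreviation iXW :: "'x \<Rightarrow> 'w \<Rightarrow> ('k::field, 'a, 'w, 'x) expr" where "iXW x w \<equiv> gen (GXW x w)"
abbreviation iWX :: "'w \<Rightarrow> 'x \<Rightarrow> ('k::field, 'a, 'w, 'x) expr" where "iWX w x \<equiv> gen (GWX w x)"
abbreviation iX :: "'x \<Rightarrow> ('k::field, 'a, 'w, 'x) expr" where "iX x \<equiv> gen (GX x)"

text \<open>The enveloping algebra \<open>A \<otimes>\<^sub>K A\<^sup>o\<^sup>p\<close>: the images of \<open>A\<close> and \<open>A\<^sup>o\<^sup>p\<close> commute.\<close>

inductive enveloping_rel ::
    "('k::field, 'a::{ring,monoid_mult}, 'w::ab_group_add, 'x::ab_group_add) calculus \<Rightarrow>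
     ('k, 'a, 'w, 'x) expr \<Rightarrow> ('k, 'a, 'w, 'x) expr \<Rightarrow> bool"
  for C :: "('k, 'a, 'w, 'x) calculus"
  where
    A_add: "enveloping_rel C (iA (a + b)) (iA a + iA b)"
  | A_scl: "enveloping_rel C (iA (scl C k a)) (scalar k * iA a)"
  | A_one: "enveloping_rel C (iA 1) 1"
  | A_mult: "enveloping_rel C (iA (a * b)) (iA a * iA b)"
  | Aop_add: "enveloping_rel C (iAop (a + b)) (iAop a + iAop b)"
  | Aop_scl: "enveloping_rel C (iAop (scl C k a)) (scalar k * iAop a)"
  | Aop_one: "enveloping_rel C (iAop 1) 1"
  | Aop_mult: "enveloping_rel C (iAop (b * a)) (iAop a * iAop b)"
  | A_Aop: "enveloping_rel C (iA a * iAop b) (iAop b * iA a)"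

text \<open>The tensor algebra over the enveloping algebra of the bimodule
  \<open>(X \<otimes>\<^sub>K W) \<oplus> (W \<otimes>\<^sub>K X)\<close>, presented by the bilinearity of the two tensor products and
  the bimodule structure.\<close>

inductive tensor_algebra_rel ::
    "('k::field, 'a::{ring,monoid_mult}, 'w::ab_group_add, 'x::ab_group_add) calculus \<Rightarrow>
     ('k, 'a, 'w, 'x) expr \<Rightarrow> ('k, 'a, 'w, 'x) expr \<Rightarrow> bool"
  for C :: "('k, 'a, 'w, 'x) calculus"
  where
    enveloping: "enveloping_rel C u v \<Longrightarrow> tensor_algebra_rel C u v"
  | XW_add_left: "tensor_algebra_rel C (iXW (x + x') w) (iXW x w + iXW x' w)"
  | XW_add_right: "tensor_algebra_rel C (iXW x (w + w')) (iXW x w + iXW x w')"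
  | XW_scl_left: "tensor_algebra_rel C (iXW (lX C (scl C k 1) x) w) (scalar k * iXW x w)"
  | XW_scl_right: "tensor_algebra_rel C (iXW x (lW C (scl C k 1) w)) (scalar k * iXW x w)"
  | XW_bimodule: "tensor_algebra_rel C
      (iA a * iAop a' * iXW x w * iA b * iAop b')
      (iXW (rX C (lX C a x) b) (rW C (lW C b' w) a'))"
  | WX_add_left: "tensor_algebra_rel C (iWX (w + w') x) (iWX w x + iWX w' x)"
  | WX_add_right: "tensor_algebra_rel C (iWX w (x + x')) (iWX w x + iWX w x')"
  | WX_scl_left: "tensor_algebra_rel C (iWX (lW C (scl C k 1) w) x) (scalar k * iWX w x)"
  | WX_scl_right: "tensor_algebra_rel C (iWX w (lX C (scl C k 1) x)) (scalar k * iWX w x)"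
  | WX_bimodule: "tensor_algebra_rel C
      (iA a * iAop a' * iWX w x * iA b * iAop b')
      (iWX (rW C (lW C a w) b) (rX C (lX C b' x) a'))"

text \<open>The quotient \<open>H(\<Omega>\<^sup>1)\<close> of the tensor algebra.\<close>

inductive H_rel ::
    "('k::field, 'a::{ring,monoid_mult}, 'w::ab_group_add, 'x::ab_group_add) calculus \<Rightarrow>
     ('k, 'a, 'w, 'x) expr \<Rightarrow> ('k, 'a, 'w, 'x) expr \<Rightarrow> bool"
  for C :: "('k, 'a, 'w, 'x) calculus"
  where
    tensor_algebra: "tensor_algebra_rel C u v \<Longrightarrow> H_rel C u v"
  | WX_XW_coev: "H_rel C (\<Sum>(wi, xi)\<leftarrow>coev C. iWX wi x * iXW xi w) (iAop (uev C w x))"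
  | XW_WX_ucoev: "H_rel C (\<Sum>(yj, rj)\<leftarrow>ucoev C. iXW x rj * iWX w yj) (iA (ev C x w))"
  | XW_WX_ucoev': "H_rel C (\<Sum>(yj, rj)\<leftarrow>ucoev C. iXW yj w * iWX rj x) (iAop (ev C x w))"
  | WX_XW_coev': "H_rel C (\<Sum>(wi, xi)\<leftarrow>coev C. iWX w xi * iXW x wi) (iA (uev C w x))"

text \<open>The free product of \<open>H(\<Omega>\<^sup>1)\<close> with the tensor algebra of the vector space \<open>X\<close> (the rules
  \<open>X_add\<close> and \<open>X_scl\<close>), modulo the last three rules.\<close>

inductive HX_rel ::
    "('k::field, 'a::{ring,monoid_mult}, 'w::ab_group_add, 'x::ab_group_add) calculus \<Rightarrow>
     ('k, 'a, 'w, 'x) expr \<Rightarrow> ('k, 'a, 'w, 'x) expr \<Rightarrow> bool"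
  for C :: "('k, 'a, 'w, 'x) calculus"
  where
    H: "H_rel C u v \<Longrightarrow> HX_rel C u v"
  | X_add: "HX_rel C (iX (x + x')) (iX x + iX x')"
  | X_scl: "HX_rel C (iX (lX C (scl C k 1) x)) (scalar k * iX x)"
  | A_X: "HX_rel C (iA a * iX x) (iX (lX C a x))"
  | X_A: "HX_rel C (iX x * iA a) (iX (rX C x a) + iA (ev C x (dif C a)))"
  | X_Aop: "HX_rel C (iX x * iAop a) (iAop a * iX x + iXW x (dif C a))"

definition HX_class ::
    "('k::field, 'a::{ring,monoid_mult}, 'w::ab_group_add, 'x::ab_group_add) calculus \<Rightarrow>
     ('k, 'a, 'w, 'x) expr \<Rightarrow> ('k, 'a, 'w, 'x) expr set"
  where "HX_class C = presented_class (HX_rel C)"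

definition HX_ae_ring ::
    "('k::field, 'a::{ring,monoid_mult}, 'w::ab_group_add, 'x::ab_group_add) calculus \<Rightarrow>
     ('k, 'a, ('k, 'a, 'w, 'x) expr set) ae_ring"
  where "HX_ae_ring C = (let Q = presented_ring (HX_rel C) in
    \<lparr>carrier = carrier Q, monoid.mult = monoid.mult Q, one = one Q,
     ring.zero = ring.zero Q, ring.add = ring.add Q,
     smult = (\<lambda>k b. HX_class C (scalar k) \<otimes>\<^bsub>Q\<^esub> b),
     src = (\<lambda>a. HX_class C (iA a)), tgt = (\<lambda>a. HX_class C (iAop a))\<rparr>)"

text \<open>The coproduct is computed on the free algebra, as a list of pairs of expressions on words and
  then linearly, and descends to the quotient.\<close>

fun comult_generator ::
    "('k::field, 'a::{ring,monoid_mult}, 'w::ab_group_add, 'x::ab_group_add) calculus \<Rightarrow>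
     ('a, 'w, 'x) generator \<Rightarrow> (('k, 'a, 'w, 'x) expr \<times> ('k, 'a, 'w, 'x) expr) list"
  where
    "comult_generator C (GA a) = [(iA a, 1)]"
  | "comult_generator C (GAop a) = [(1, iAop a)]"
  | "comult_generator C (GXW x w) = map (\<lambda>(wi, xi). (iXW x wi, iXW xi w)) (coev C)"
  | "comult_generator C (GWX w x) = map (\<lambda>(yj, rj). (iWX w yj, iWX rj x)) (ucoev C)"
  | "comult_generator C (GX x) = (iX x, 1) # map (\<lambda>(wi, xi). (iXW x wi, iX xi)) (coev C)"

fun comult_word ::
    "('k::field, 'a::{ring,monoid_mult}, 'w::ab_group_add, 'x::ab_group_add) calculus \<Rightarrow>
     ('a, 'w, 'x) generator word \<Rightarrow> (('k, 'a, 'w, 'x) expr \<times> ('k, 'a, 'w, 'x) expr) list"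
  where
    "comult_word C (Word []) = [(1, 1)]"
  | "comult_word C (Word (g # gs)) =
      [(p * p', q * q'). (p, q) \<leftarrow> comult_generator C g, (p', q') \<leftarrow> comult_word C (Word gs)]"

definition comult_expr ::
    "('k::field, 'a::{ring,monoid_mult}, 'w::ab_group_add, 'x::ab_group_add) calculus \<Rightarrow>
     ('k, 'a, 'w, 'x) expr \<Rightarrow> ('k, 'a, 'w, 'x) expr set \<times> ('k, 'a, 'w, 'x) expr set \<Rightarrow>\<^sub>0 int"
  where "comult_expr C f = (\<Sum>v\<in>Poly_Mapping.keys f. \<Sum>(p, q)\<leftarrow>comult_word C v.
    frag_of (HX_class C (scalar (Poly_Mapping.lookup f v) * p), HX_class C q))"

definition HX ::
    "('k::field, 'a::{ring,monoid_mult}, 'w::ab_group_add, 'x::ab_group_add) calculus \<Rightarrow>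
     ('k, 'a, ('k, 'a, 'w, 'x) expr set) bialgebroid"
  where "HX C = (let B = HX_ae_ring C in
    \<lparr>carrier = carrier B, monoid.mult = monoid.mult B, one = one B,
     ring.zero = ring.zero B, ring.add = ring.add B,
     smult = smult B, src = src B, tgt = tgt B,
     comult = (\<lambda>b. the_elem ((\<lambda>f. diamond_class B (comult_expr C f)) ` b))\<rparr>)"

text \<open>Antipodes of a bialgebroid are not unique, so an antipode need not restrict to the canonical
  one of \<open>H(\<Omega>\<^sup>1)\<close>.  \<open>H(\<Omega>\<^sup>1)\<close> has the involutive antipode \<open>a \<mapsto> a\<^sup>o\<^sup>p\<close>, \<open>a\<^sup>o\<^sup>p \<mapsto> a\<close>, \<open>(x, \<omega>) \<mapsto> (\<omega>, x)\<close>,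
  \<open>(\<omega>, x) \<mapsto> (x, \<omega>)\<close>; this says that \<open>S\<close> extends it (hence also its inverse).\<close>

definition extends_H_antipode ::
    "('k::field, 'a::{ring,monoid_mult}, 'w::ab_group_add, 'x::ab_group_add) calculus \<Rightarrow>
     (('k, 'a, 'w, 'x) expr set \<Rightarrow> ('k, 'a, 'w, 'x) expr set) \<Rightarrow> bool"
  where "extends_H_antipode C S \<longleftrightarrow>
    (\<forall>a. S (HX_class C (iA a)) = HX_class C (iAop a)) \<and>
    (\<forall>a. S (HX_class C (iAop a)) = HX_class C (iA a)) \<and>
    (\<forall>x w. S (HX_class C (iXW x w)) = HX_class C (iWX w x)) \<and>
    (\<forall>w x. S (HX_class C (iWX w x)) = HX_class C (iXW x w))"

definition compatible_map ::
    "('k::field, 'a::{ring,monoid_mult}, 'w::ab_group_add, 'x::ab_group_add) calculus \<Rightarrow>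
     ('x \<Rightarrow> 'a) \<Rightarrow> bool"
  where "compatible_map C \<Upsilon> \<longleftrightarrow>
    Vector_Spaces.linear (\<lambda>k. lX C (scl C k 1)) (scl C) \<Upsilon> \<and>
    (\<forall>x a. \<Upsilon> (rX C x a) = \<Upsilon> x * a + ev C x (dif C a)) \<and>
    (\<forall>x a. \<Upsilon> (lX C a x) = a * \<Upsilon> x + uev C (dif C a) x)"

end

theory Submission
  imports Defs "HOL-Library.Product_Plus"
begin

text \<open>The coproduct lifts to a ring homomorphism \<open>cop\<close> from the free algebra to its tensor square.  It
  preserves the kernel of the projection onto \<open>B \<diamond> B\<close>, for \<open>B = HX C\<close>, so that \<open>B \<diamond> B\<close> is a left
  \<open>B\<close>-module; well-definedness of the coproduct is then an identity for each defining relation.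

  For an antipode \<open>S\<close> that extends the one of \<open>H(\<Omega>\<^sup>1)\<close>, applying the counit to the second factor of the
  antipode axiom at \<open>x\<close> gives \<open>S(x) = - \<Sum>\<^sub>i (\<omega>\<^sub>i, x) \<bullet> x\<^sub>i - \<Upsilon>(x)\<^sup>o\<^sup>p\<close> with \<open>\<Upsilon>(x) = - \<epsilon>(S(x))\<close>, and the two
  identities for \<open>\<Upsilon>\<close> are the images under \<open>S\<close> of the relations for \<open>x \<bullet> a\<close> and \<open>a \<bullet> x\<close>.

  Conversely, \<open>\<Upsilon>\<close> defines anti-homomorphisms \<open>S\<close> and \<open>T\<close> of the free algebra that respect the
  relations.  With \<open>\<Phi>(b \<diamond> b') = S(b)\<^sub>(\<^sub>1\<^sub>) b' \<diamond> S(b)\<^sub>(\<^sub>2\<^sub>)\<close> the first antipode axiom is \<open>\<Phi>(\<Delta>(b)) = 1 \<diamond> S(b)\<close>.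
  It follows from \<open>\<Phi>(\<Delta>(b) m) = \<Phi>(m) (1 \<otimes> S(b))\<close>, which is multiplicative in \<open>b\<close> and hence only has to
  be checked on generators; likewise for the second axiom.\<close>


section \<open>Additive endomorphisms\<close>

text \<open>\<open>tensor_kernel C\<close> is a right ideal but in general no left ideal, so the
  target of the coproduct is no ring and products of coproducts cannot be formed there; this is why
  everything is lifted to the tensor square of the free algebra. A second obstacle is that
  \<open>HX C\<close> depends on \<open>C\<close> and is a carrier set of cosets, where each
  rewriting step would need membership facts. Linear projections along the two kernels give every
  coset one representative, and \<open>HX_act\<close> turns the algebra into endomorphisms of the
  free algebra, so that congruences become equations in a type. There the unit of \<open>HX\<close>
  acts as the projection, not as the identity, which explains the separate unit \<open>e\<close> in
  \<open>HX_model\<close>. Nearly all calculations in that model follow one pattern: a relation of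
  H(\<Omega>^1) contracts the sum over one dual basis to an element of \<open>A\<close> or its
  opposite, this element crosses the diamond by \<open>t_balanced\<close> and is absorbed by a
  bimodule rule, and a duality identity removes another sum. Corrections to it come from
  \<open>dif C\<close>.\<close>

typedef (overloaded) 'm endo = "{f :: 'm::ab_group_add \<Rightarrow> 'm. additive f}"
  morphisms endo_app Endo
  by (rule exI[of _ id]) (simp add: additive_def)

lemma endo_app_add [simp]: "endo_app f (x + y) = endo_app f x + endo_app f y"
  using endo_app[of f] by (simp add: additive_def)

lemma endo_app_Endo: "additive f \<Longrightarrow> endo_app (Endo f) = f"
  by (simp add: Endo_inverse)

lemma endo_eqI: "(\<And>x. endo_app f x = endo_app g x) \<Longrightarrow> f = g"
  by (metis endo_app_inject ext)

instantiation endo :: (ab_group_add) ring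
begin

definition "0 = Endo (\<lambda>_. 0)"
definition "f + g = Endo (\<lambda>x. endo_app f x + endo_app g x)"
definition "- f = Endo (\<lambda>x. - endo_app f x)"
definition "f - g = Endo (\<lambda>x. endo_app f x - endo_app g x)"
definition "f * g = Endo (\<lambda>x. endo_app f (endo_app g x))"

lemma endo_app_simps [simp]:
  "endo_app 0 x = 0"
  "endo_app (f + g) x = endo_app f x + endo_app g x"
  "endo_app (- f) x = - endo_app f x"
  "endo_app (f - g) x = endo_app f x - endo_app g x"
  "endo_app (f * g) x = endo_app f (endo_app g x)"
  by (simp_all add: zero_endo_def plus_endo_def uminus_endo_def minus_endo_def times_endo_def
      endo_app_Endo additive_def)

instance
  by standard (auto intro!: endo_eqI)

end

instantiation endo :: (ab_group_add) monoid_mult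
begin

definition "1 = Endo (\<lambda>x. x)"

lemma endo_app_one [simp]: "endo_app 1 x = x"
  by (simp add: one_endo_def endo_app_Endo additive_def)

instance
  by standard (auto intro!: endo_eqI)

end


section \<open>Linear maps on free modules\<close>

text \<open>Scalars enter through a map \<kappa> into the target ring: one definition then serves
  \<open>const\<close> for tensors, \<open>of_int\<close> for formal sums and
  \<open>Endo (scl C k)\<close> for the action on \<open>A\<close>.\<close>

definition lin_ext :: "('k::zero \<Rightarrow> 'v::ring) \<Rightarrow> ('w \<Rightarrow> 'v) \<Rightarrow> ('w \<Rightarrow>\<^sub>0 'k) \<Rightarrow> 'v"
  where "lin_ext \<kappa> h f = (\<Sum>w\<in>Poly_Mapping.keys f. \<kappa> (Poly_Mapping.lookup f w) * h w)"

lemma lin_ext_superset: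
  assumes "additive \<kappa>" "finite A" "Poly_Mapping.keys f \<subseteq> A"
  shows "lin_ext \<kappa> h f = (\<Sum>w\<in>A. \<kappa> (Poly_Mapping.lookup f w) * h w)"
  unfolding lin_ext_def using assms
  by (intro sum.mono_neutral_left) (auto simp: in_keys_iff additive.zero)

lemma additive_lin_ext:
  fixes \<kappa> :: "'k::ab_group_add \<Rightarrow> 'v::ring" and h :: "'w \<Rightarrow> 'v"
  assumes \<kappa>: "additive \<kappa>"
  shows "additive (lin_ext \<kappa> h)"
proof
  fix f g :: "'w \<Rightarrow>\<^sub>0 'k"
  let ?A = "Poly_Mapping.keys f \<union> Poly_Mapping.keys g"
  have "Poly_Mapping.keys (f + g) \<subseteq> ?A"
    by (rule Poly_Mapping.keys_add)
  then show "lin_ext \<kappa> h (f + g) = lin_ext \<kappa> h f + lin_ext \<kappa> h g"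
    by (simp add: lin_ext_superset[OF \<kappa>, of ?A] lookup_add additive.add[OF \<kappa>] distrib_right
        sum.distrib)
qed

lemma lin_ext_single:
  assumes "additive \<kappa>"
  shows "lin_ext \<kappa> h (Poly_Mapping.single w k) = \<kappa> k * h w"
  using lin_ext_superset[OF assms, of "{w}"] by simp

lemma poly_mapping_additive_induct [case_names single add]:
  fixes f :: "'w \<Rightarrow>\<^sub>0 'k::comm_monoid_add"
  assumes single: "\<And>w k. P (Poly_Mapping.single w k)"
    and add: "\<And>f g. P f \<Longrightarrow> P g \<Longrightarrow> P (f + g)"
  shows "P f"
proof (induction f rule: update_induct)
  case const
  show ?case using single[of _ 0] by simp
next
  case (update f w k)
  then have "Poly_Mapping.update w k f = f + Poly_Mapping.single w k"
    by (intro poly_mapping_eqI) (simp add: lookup_update lookup_add lookup_single in_keys_iff when_def, auto)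
  then show ?case using update single add by simp
qed

lemma additive_ext:
  fixes \<phi> \<psi> :: "('w \<Rightarrow>\<^sub>0 'k::ab_group_add) \<Rightarrow> 'v::ab_group_add"
  assumes "additive \<phi>" "additive \<psi>"
    and "\<And>w k. \<phi> (Poly_Mapping.single w k) = \<psi> (Poly_Mapping.single w k)"
  shows "\<phi> f = \<psi> f"
  by (induction f rule: poly_mapping_additive_induct)
    (simp_all add: assms additive.add[OF assms(1)] additive.add[OF assms(2)])

lemma additive_compose: "additive f \<Longrightarrow> additive g \<Longrightarrow> additive (\<lambda>x. f (g x))"
  by (simp add: additive_def)

lemma additive_mult_left: "additive (\<lambda>x. a * x)" and additive_mult_right: "additive (\<lambda>x. x * a)"
  for a :: "'r::ring"
  by (simp_all add: additive_def distrib_left distrib_right)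

lemma biadditive_ext:
  fixes \<phi> \<psi> :: "('u \<Rightarrow>\<^sub>0 'k::ab_group_add) \<Rightarrow> ('w \<Rightarrow>\<^sub>0 'k) \<Rightarrow> 'v::ab_group_add"
  assumes "\<And>f. additive (\<phi> f)" "\<And>f. additive (\<psi> f)"
    and "\<And>g. additive (\<lambda>f. \<phi> f g)" "\<And>g. additive (\<lambda>f. \<psi> f g)"
    and "\<And>u a w b. \<phi> (Poly_Mapping.single u a) (Poly_Mapping.single w b)
      = \<psi> (Poly_Mapping.single u a) (Poly_Mapping.single w b)"
  shows "\<phi> f g = \<psi> f g"
proof -
  have "\<phi> (Poly_Mapping.single u a) g = \<psi> (Poly_Mapping.single u a) g" for u a
    by (rule additive_ext) (fact assms)+
  then show ?thesis
    by (rule additive_ext[of "\<lambda>f. \<phi> f g" "\<lambda>f. \<psi> f g", OF assms(3,4)])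
qed

text \<open>The parameter \<open>m\<close> is the multiplication of the target or its opposite.\<close>

lemma additive_imp_multiplicative:
  fixes \<phi> :: "('w::monoid_add \<Rightarrow>\<^sub>0 'k::ring) \<Rightarrow> 'v::ab_group_add"
  assumes "additive \<phi>" "\<And>y. additive (\<lambda>x. m x y)" "\<And>x. additive (m x)"
    and "\<And>u a w b. \<phi> (Poly_Mapping.single (u + w) (a * b))
      = m (\<phi> (Poly_Mapping.single u a)) (\<phi> (Poly_Mapping.single w b))"
  shows "\<phi> (f * g) = m (\<phi> f) (\<phi> g)"
proof (rule biadditive_ext[where \<phi> = "\<lambda>f g. \<phi> (f * g)" and \<psi> = "\<lambda>f g. m (\<phi> f) (\<phi> g)"])
  show "additive (\<lambda>g. \<phi> (f * g))" "additive (\<lambda>g. \<phi> (g * f))" for f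
    by (rule additive_compose[OF assms(1) additive_mult_left],
        rule additive_compose[OF assms(1) additive_mult_right])
  show "additive (\<lambda>g. m (\<phi> f) (\<phi> g))" "additive (\<lambda>g. m (\<phi> g) (\<phi> f))" for f
    by (rule additive_compose[OF assms(3,1)], rule additive_compose[OF assms(2,1)])
qed (simp add: mult_single assms(4))

abbreviation const :: "'k::zero \<Rightarrow> 'w::monoid_add \<Rightarrow>\<^sub>0 'k"
  where "const \<equiv> Poly_Mapping.single 0"

lemma additive_const: "additive (const :: 'k::ab_group_add \<Rightarrow> 'w::monoid_add \<Rightarrow>\<^sub>0 'k)"
  by (simp add: additive_def single_add)

lemma const_mult: "const (a * b) = const a * const b"
  by (simp add: mult_single)

lemma const_commute: "const k * f = f * const k" for k :: "'k::comm_ring"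
  by (rule additive_ext[of "\<lambda>f. const k * f" "\<lambda>f. f * const k"])
    (simp_all add: additive_mult_left additive_mult_right mult_single mult.commute)

lemma const_left_commute: "f * (const k * g) = const k * (f * g)" for k :: "'k::comm_ring"
  by (metis const_commute mult.assoc)

lemma const_mult_single: "const k * Poly_Mapping.single w l = Poly_Mapping.single w (k * l)"
  by (simp add: mult_single)

lemma lin_ext_const:
  fixes \<kappa> :: "'k::comm_ring \<Rightarrow> 'v::ring"
  assumes "additive \<kappa>" "\<And>a b. \<kappa> (a * b) = \<kappa> a * \<kappa> b"
  shows "lin_ext \<kappa> h (const k * f) = \<kappa> k * lin_ext \<kappa> h f"
proof (rule additive_ext[where \<phi> = "\<lambda>f. lin_ext \<kappa> h (const k * f)"])
  show "additive (\<lambda>f. lin_ext \<kappa> h (const k * f))" "additive (\<lambda>f. \<kappa> k * lin_ext \<kappa> h f)"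
    by (rule additive_compose[OF additive_lin_ext[OF assms(1)] additive_mult_left],
        rule additive_compose[OF additive_mult_left additive_lin_ext[OF assms(1)]])
qed (simp add: const_mult_single lin_ext_single assms mult.assoc)

lemma lin_ext_mult:
  fixes \<kappa> :: "'k::comm_ring \<Rightarrow> 'v::ring"
  assumes "additive \<kappa>" "\<And>a b. \<kappa> (a * b) = \<kappa> a * \<kappa> b"
    and "\<And>k w. h w * \<kappa> k = \<kappa> k * h w" and "\<And>u w. h (u + w) = h u * h w"
  shows "lin_ext \<kappa> h (f * g) = lin_ext \<kappa> h f * lin_ext \<kappa> h g"
proof (rule additive_imp_multiplicative)
  fix u w a b
  have "\<kappa> a * \<kappa> b * (h u * h w) = \<kappa> a * (\<kappa> b * h u) * h w"
    by (simp add: mult.assoc)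
  also have "\<dots> = \<kappa> a * h u * (\<kappa> b * h w)"
    by (simp only: assms(3)[of u b, symmetric] mult.assoc)
  finally show "lin_ext \<kappa> h (Poly_Mapping.single (u + w) (a * b))
    = lin_ext \<kappa> h (Poly_Mapping.single u a) * lin_ext \<kappa> h (Poly_Mapping.single w b)"
    by (simp add: lin_ext_single assms(1,2,4))
qed (auto intro: additive_lin_ext assms additive_mult_left additive_mult_right)

lemma lin_ext_anti_mult:
  fixes \<kappa> :: "'k::comm_ring \<Rightarrow> 'v::ring"
  assumes "additive \<kappa>" "\<And>a b. \<kappa> (a * b) = \<kappa> a * \<kappa> b"
    and "\<And>k w. h w * \<kappa> k = \<kappa> k * h w" and "\<And>u w. h (u + w) = h w * h u"
  shows "lin_ext \<kappa> h (f * g) = lin_ext \<kappa> h g * lin_ext \<kappa> h f"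
proof (rule additive_imp_multiplicative[where m = "\<lambda>x y. y * x"])
  fix u w a b
  have "\<kappa> (a * b) * (h w * h u) = \<kappa> b * (\<kappa> a * h w) * h u"
    by (simp add: mult.assoc mult.commute[of a b] assms(2))
  also have "\<dots> = \<kappa> b * h w * (\<kappa> a * h u)"
    by (simp only: assms(3)[of w a, symmetric] mult.assoc)
  finally show "lin_ext \<kappa> h (Poly_Mapping.single (u + w) (a * b))
    = lin_ext \<kappa> h (Poly_Mapping.single w b) * lin_ext \<kappa> h (Poly_Mapping.single u a)"
    by (simp add: lin_ext_single assms(1,4))
qed (auto intro: additive_lin_ext assms additive_mult_left additive_mult_right)


section \<open>Maps out of the free algebra\<close>

fun word_prod :: "('g \<Rightarrow> 'v::monoid_mult) \<Rightarrow> 'g word \<Rightarrow> 'v"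
  where "word_prod \<phi> (Word gs) = prod_list (map \<phi> gs)"

fun word_rev_prod :: "('g \<Rightarrow> 'v::monoid_mult) \<Rightarrow> 'g word \<Rightarrow> 'v"
  where "word_rev_prod \<phi> (Word gs) = prod_list (map \<phi> (rev gs))"

lemma word_prod_simps [simp]:
  "word_prod \<phi> 0 = 1"
  "word_prod \<phi> (u + w) = word_prod \<phi> u * word_prod \<phi> w"
  by (cases u; cases w; simp add: zero_word_def)+

lemma word_rev_prod_simps [simp]:
  "word_rev_prod \<phi> 0 = 1"
  "word_rev_prod \<phi> (u + w) = word_rev_prod \<phi> w * word_rev_prod \<phi> u"
  by (cases u; cases w; simp add: zero_word_def)+

lemma prod_list_commute:
  fixes z :: "'v::monoid_mult"
  assumes "\<And>g. \<phi> g * z = z * \<phi> g"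
  shows "prod_list (map \<phi> gs) * z = z * prod_list (map \<phi> gs)"
proof (induction gs)
  case (Cons g gs)
  then show ?case by simp (metis assms mult.assoc)
qed simp

lemma word_prod_commute:
  "(\<And>g. \<phi> g * z = z * \<phi> g) \<Longrightarrow> word_prod \<phi> w * z = z * word_prod \<phi> w"
  "(\<And>g. \<phi> g * z = z * \<phi> g) \<Longrightarrow> word_rev_prod \<phi> w * z = z * word_rev_prod \<phi> w"
  for z :: "'v::monoid_mult"
  by (cases w; simp add: prod_list_commute)+

lemma free_algebra_induct [case_names scalar gen add mult]:
  fixes f :: "'g word \<Rightarrow>\<^sub>0 'k::field"
  assumes scalar: "\<And>k. P (scalar k)" and gen: "\<And>g. P (gen g)"
    and add: "\<And>f g. P f \<Longrightarrow> P g \<Longrightarrow> P (f + g)" and mult: "\<And>f g. P f \<Longrightarrow> P g \<Longrightarrow> P (f * g)"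
  shows "P f"
proof (induction f rule: poly_mapping_additive_induct)
  case (single w k)
  obtain gs where w: "w = Word gs" by (cases w)
  have "P (Poly_Mapping.single (Word gs) k)"
  proof (induction gs)
    case Nil
    show ?case using scalar[of k] by (simp add: scalar_def zero_word_def)
  next
    case (Cons g gs)
    have "Poly_Mapping.single (Word (g # gs)) k = gen g * Poly_Mapping.single (Word gs) k"
      by (simp add: gen_def mult_single)
    then show ?case using mult[OF gen Cons] by simp
  qed
  then show ?case by (simp add: w)
qed (rule add)


section \<open>The tensor square of the free algebra\<close>

text \<open>Pairs of words form a monoid whose monoid algebra is the tensor square.\<close>

type_synonym ('g, 'k) expr2 = "('g word \<times> 'g word) \<Rightarrow>\<^sub>0 'k"

definition inl :: "('g word \<Rightarrow>\<^sub>0 'k::field) \<Rightarrow> ('g, 'k) expr2"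
  where "inl = lin_ext const (\<lambda>u. Poly_Mapping.single (u, 0) 1)"

definition inr :: "('g word \<Rightarrow>\<^sub>0 'k::field) \<Rightarrow> ('g, 'k) expr2"
  where "inr = lin_ext const (\<lambda>u. Poly_Mapping.single (0, u) 1)"

definition tens :: "('g word \<Rightarrow>\<^sub>0 'k::field) \<Rightarrow> ('g word \<Rightarrow>\<^sub>0 'k) \<Rightarrow> ('g, 'k) expr2"
  where "tens p q = inl p * inr q"

lemma additive_inl: "additive inl" and additive_inr: "additive inr"
  by (simp_all add: inl_def inr_def additive_lin_ext additive_const)

lemma inl_single: "inl (Poly_Mapping.single u a) = Poly_Mapping.single (u, 0) a"
  and inr_single: "inr (Poly_Mapping.single u a) = Poly_Mapping.single (0, u) a"
  by (simp_all add: inl_def inr_def lin_ext_single additive_const mult_single)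

lemma inl_mult: "inl (p * q) = inl p * inl q"
  unfolding inl_def
  by (rule lin_ext_mult[OF additive_const const_mult])
    (rule const_commute[symmetric], simp add: mult_single plus_prod_def)

lemma inr_mult: "inr (p * q) = inr p * inr q"
  unfolding inr_def
  by (rule lin_ext_mult[OF additive_const const_mult])
    (rule const_commute[symmetric], simp add: mult_single plus_prod_def)

lemma inl_inr_commute: "inr q * inl p = inl p * inr q"
proof (rule biadditive_ext[where \<phi> = "\<lambda>q p. inr q * inl p" and \<psi> = "\<lambda>q p. inl p * inr q"])
  show "additive (\<lambda>p. inr q * inl p)" "additive (\<lambda>p. inl p * inr q)"
    "additive (\<lambda>q. inr q * inl p)" "additive (\<lambda>q. inl p * inr q)" for p q :: "'a word \<Rightarrow>\<^sub>0 'b"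
    by (simp_all add: additive_def additive.add[OF additive_inl] additive.add[OF additive_inr]
        distrib_left distrib_right)
qed (simp add: inl_single inr_single mult_single plus_prod_def mult.commute)

lemma tens_mult: "tens p q * tens p' q' = tens (p * p') (q * q')"
proof -
  have "inl p * inr q * (inl p' * inr q') = inl p * (inr q * inl p') * inr q'"
    by (simp add: mult.assoc)
  then show ?thesis
    by (simp add: tens_def inl_mult inr_mult mult.assoc inl_inr_commute)
qed

lemma tens_single:
  "tens (Poly_Mapping.single u a) (Poly_Mapping.single w b) = Poly_Mapping.single (u, w) (a * b)"
  by (simp add: tens_def inl_single inr_single mult_single plus_prod_def)

lemma additive_tens_left: "additive (\<lambda>p. tens p q)" and additive_tens_right: "additive (tens p)"
  by (simp_all add: tens_def additive_def additive.add[OF additive_inl]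
      additive.add[OF additive_inr] distrib_left distrib_right)

lemma zero_pair: "(0, 0) = 0"
  by (simp add: zero_prod_def)

lemma tens_one [simp]: "tens 1 1 = 1"
  using tens_single[of 0 1 0 1] by (simp add: zero_pair)

lemma tens_const: "tens (const k) 1 = const k" "tens 1 (const k) = const k"
  using tens_single[of 0 k 0 1] tens_single[of 0 1 0 k] by (simp_all add: zero_pair)

lemma tens_scalar: "tens (scalar k * p) q = const k * tens p q" "tens p (scalar k * q) = const k * tens p q"
  by (metis tens_const tens_mult mult_1_left scalar_def)+

lemma expr2_induct [case_names tens add]:
  fixes m :: "('g, 'k::field) expr2"
  assumes "\<And>p q. P (tens p q)" "\<And>m n. P m \<Longrightarrow> P n \<Longrightarrow> P (m + n)"
  shows "P m"
proof (induction m rule: poly_mapping_additive_induct)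
  case (single w k)
  have "Poly_Mapping.single w k = tens (Poly_Mapping.single (fst w) k) (Poly_Mapping.single (snd w) 1)"
    by (simp add: tens_single)
  then show ?case by (simp add: assms(1))
qed (rule assms(2))

lemma additive_ext_tens:
  fixes \<phi> \<psi> :: "('g, 'k::field) expr2 \<Rightarrow> 'v::ab_group_add"
  assumes "additive \<phi>" "additive \<psi>" "\<And>p q. \<phi> (tens p q) = \<psi> (tens p q)"
  shows "\<phi> m = \<psi> m"
  by (induction m rule: expr2_induct)
    (simp_all add: assms additive.add[OF assms(1)] additive.add[OF assms(2)])

text \<open>Universal property of the tensor square: a bilinear \<beta> factors through
  \<open>tens\<close>. Both scalar rules are needed to collect the coefficients of the two words
  outside, as \<kappa> of their product.\<close>

lemma lin_ext_tens:
  fixes \<beta> :: "('g word \<Rightarrow>\<^sub>0 'k::field) \<Rightarrow> ('g word \<Rightarrow>\<^sub>0 'k) \<Rightarrow> 'v::ring"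
  assumes \<kappa>: "additive \<kappa>" and left: "\<And>q. additive (\<lambda>p. \<beta> p q)" and right: "\<And>p. additive (\<beta> p)"
    and scalar: "\<And>k p q. \<beta> (scalar k * p) q = \<kappa> k * \<beta> p q" "\<And>k p q. \<beta> p (scalar k * q) = \<kappa> k * \<beta> p q"
    and mult: "\<And>a b. \<kappa> (a * b) = \<kappa> a * \<kappa> b"
  shows "lin_ext \<kappa> (\<lambda>(u, w). \<beta> (Poly_Mapping.single u 1) (Poly_Mapping.single w 1)) (tens p q) = \<beta> p q"
proof (rule biadditive_ext)
  fix u w :: "'g word" and a b :: 'k
  show "lin_ext \<kappa> (\<lambda>(u, w). \<beta> (Poly_Mapping.single u 1) (Poly_Mapping.single w 1))
      (tens (Poly_Mapping.single u a) (Poly_Mapping.single w b))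
    = \<beta> (Poly_Mapping.single u a) (Poly_Mapping.single w b)"
    using scalar(1)[of a "Poly_Mapping.single u 1"] scalar(2)[of _ b "Poly_Mapping.single w 1"]
      mult[of a b] mult[of b a]
    by (simp add: tens_single lin_ext_single \<kappa> scalar_def const_mult_single mult.commute[of a b]
        flip: mult.assoc)
qed (intro left right additive_compose[OF additive_lin_ext[OF \<kappa>] additive_tens_left]
    additive_compose[OF additive_lin_ext[OF \<kappa>] additive_tens_right])+


section \<open>Projections along subspaces\<close>

lemma vector_space_const:
  "vector_space (\<lambda>k (f :: 'w::monoid_add \<Rightarrow>\<^sub>0 'k::field). const k * f)"
  by standard (simp_all add: distrib_left distrib_right single_add const_mult mult.assoc)

text \<open>A subspace has a linear retraction \<open>Q\<close> onto it, by extension of a basis,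
  and the identity minus \<open>Q\<close> has kernel \<open>V\<close>. Linearity is the point:
  representatives chosen coset by coset would not respect sums.\<close>

lemma projection_exists:
  fixes V :: "('w::monoid_add \<Rightarrow>\<^sub>0 'k::field) set"
  assumes "0 \<in> V" "\<And>f g. f \<in> V \<Longrightarrow> g \<in> V \<Longrightarrow> f + g \<in> V" "\<And>k f. f \<in> V \<Longrightarrow> const k * f \<in> V"
  obtains P where "additive P" "\<And>k f. P (const k * f) = const k * P f"
    "\<And>f. P f = 0 \<longleftrightarrow> f \<in> V" "\<And>f. P f - f \<in> V"
proof -
  let ?s = "\<lambda>k (f :: 'w \<Rightarrow>\<^sub>0 'k). const k * f"
  interpret vector_space ?s by (rule vector_space_const)
  interpret vector_space_pair ?s ?s by unfold_locales
  have V: "subspace V"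
    using assms by (simp add: subspace_def)
  obtain Q where Q: "range Q \<subseteq> V" "Vector_Spaces.linear ?s ?s Q" "\<And>f. f \<in> V \<Longrightarrow> Q f = f"
    using linear_exists_left_inverse_on[OF linear_ident V] by auto
  interpret Q: Vector_Spaces.linear ?s ?s Q by (rule Q(2))
  show ?thesis
  proof (rule that[of "\<lambda>f. f - Q f"])
    show "additive (\<lambda>f. f - Q f)"
      by (simp add: additive_def Q.add)
    show "const k * f - Q (const k * f) = const k * (f - Q f)" for k f
      by (simp add: Q.scale right_diff_distrib)
    show "f - Q f = 0 \<longleftrightarrow> f \<in> V" for f
      using Q(1,3) by (metis eq_iff_diff_eq_0 rangeI subsetD)
    have "const (- 1) * Q f \<in> V" for f
      using Q(1) by (intro assms(3)) auto
    then show "f - Q f - f \<in> V" for f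
      by (simp add: single_uminus)
  qed
qed

section \<open>Presented algebras\<close>

lemma ring_free_algebra: "ring (free_algebra :: ('g word \<Rightarrow>\<^sub>0 'k::field) ring)"
proof (rule ringI)
  show "abelian_group (free_algebra :: ('g word \<Rightarrow>\<^sub>0 'k) ring)"
    by (rule abelian_groupI) (auto simp: free_algebra_def add.assoc add.commute
        intro: exI[of _ "- x" for x] left_minus)
  show "Group.monoid (free_algebra :: ('g word \<Rightarrow>\<^sub>0 'k) ring)"
    by (rule monoidI) (auto simp: free_algebra_def mult.assoc)
qed (auto simp: free_algebra_def distrib_left distrib_right)

lemma ideal_relation_ideal: "ideal (relation_ideal R) free_algebra"
  unfolding relation_ideal_def
  by (rule ring.genideal_ideal[OF ring_free_algebra]) (simp add: free_algebra_def)

lemma relation_ideal_rel: "R u v \<Longrightarrow> u - v \<in> relation_ideal R"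
  unfolding relation_ideal_def
  using ring.genideal_self[OF ring_free_algebra, of "{u - v |u v. R u v}"]
  by (auto simp: free_algebra_def)

lemma a_inv_free_algebra: "\<ominus>\<^bsub>free_algebra\<^esub> f = - f"
  for f :: "'g word \<Rightarrow>\<^sub>0 'k::field"
proof -
  interpret ring "free_algebra :: ('g word \<Rightarrow>\<^sub>0 'k::field) ring"
    by (rule ring_free_algebra)
  show ?thesis
    by (rule minus_equality) (simp_all add: free_algebra_def)
qed

lemma relation_ideal_closed:
  shows relation_ideal_zero: "0 \<in> relation_ideal R"
    and relation_ideal_add: "f \<in> relation_ideal R \<Longrightarrow> g \<in> relation_ideal R \<Longrightarrow> f + g \<in> relation_ideal R"
    and relation_ideal_uminus: "f \<in> relation_ideal R \<Longrightarrow> - f \<in> relation_ideal R"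
    and relation_ideal_mult_left: "f \<in> relation_ideal R \<Longrightarrow> h * f \<in> relation_ideal R"
    and relation_ideal_mult_right: "f \<in> relation_ideal R \<Longrightarrow> f * h \<in> relation_ideal R"
proof -
  interpret ideal "relation_ideal R" free_algebra
    by (rule ideal_relation_ideal)
  show "0 \<in> relation_ideal R"
    using additive_subgroup.zero_closed[OF is_additive_subgroup] by (simp add: free_algebra_def)
  show "f + g \<in> relation_ideal R" if "f \<in> relation_ideal R" "g \<in> relation_ideal R"
    using additive_subgroup.a_closed[OF is_additive_subgroup that] by (simp add: free_algebra_def)
  show "- f \<in> relation_ideal R" if "f \<in> relation_ideal R"
    using additive_subgroup.a_inv_closed[OF is_additive_subgroup that] by (simp add: a_inv_free_algebra)
  show "h * f \<in> relation_ideal R" "f * h \<in> relation_ideal R" if "f \<in> relation_ideal R"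
    using I_l_closed[OF that, of h] I_r_closed[OF that, of h] by (simp_all add: free_algebra_def)
qed

lemma relation_ideal_diff:
  "f \<in> relation_ideal R \<Longrightarrow> g \<in> relation_ideal R \<Longrightarrow> f - g \<in> relation_ideal R"
  using relation_ideal_add[OF _ relation_ideal_uminus] by fastforce

text \<open>The form in which well-definedness is proved: \<open>V\<close> is the set of expressions
  that some map sends to zero, or into an ideal or kernel, and only the relations have to be checked
  once \<open>V\<close> is a two-sided ideal.\<close>

lemma relation_ideal_minimal:
  assumes "f \<in> relation_ideal R" and "0 \<in> V"
    and "\<And>f g. f \<in> V \<Longrightarrow> g \<in> V \<Longrightarrow> f + g \<in> V" "\<And>f. f \<in> V \<Longrightarrow> - f \<in> V"
    and "\<And>f h. f \<in> V \<Longrightarrow> h * f \<in> V" "\<And>f h. f \<in> V \<Longrightarrow> f * h \<in> V"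
    and "\<And>u v. R u v \<Longrightarrow> u - v \<in> V"
  shows "f \<in> V"
proof -
  interpret ring "free_algebra :: ('a word \<Rightarrow>\<^sub>0 'b) ring"
    by (rule ring_free_algebra)
  have "ideal V free_algebra"
  proof (rule idealI[OF ring_free_algebra])
    show "subgroup V (add_monoid free_algebra)"
    proof (rule group.subgroupI[OF a_group])
      show "inv\<^bsub>add_monoid free_algebra\<^esub> f \<in> V" if "f \<in> V" for f
        using assms(4)[OF that] a_inv_free_algebra[of f] by (simp add: a_inv_def)
    qed (use assms in \<open>auto simp: free_algebra_def\<close>)
  qed (use assms in \<open>auto simp: free_algebra_def\<close>)
  then show ?thesis
    using genideal_minimal[of V "{u - v |u v. R u v}"] assms(1,7)
    by (auto simp: relation_ideal_def)
qed

lemma presented_class_eq: "presented_class R f = (\<lambda>i. i + f) ` relation_ideal R"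
  by (auto simp: presented_class_def a_r_coset_def' free_algebra_def)

lemma in_presented_class_iff: "g \<in> presented_class R f \<longleftrightarrow> g - f \<in> relation_ideal R"
  by (auto simp: presented_class_eq intro: image_eqI[of _ _ "g - f"])

lemma presented_class_eq_iff: "presented_class R f = presented_class R g \<longleftrightarrow> f - g \<in> relation_ideal R"
proof
  assume "presented_class R f = presented_class R g"
  then show "f - g \<in> relation_ideal R"
    using in_presented_class_iff[of f R f] by (simp add: in_presented_class_iff relation_ideal_zero)
next
  assume *: "f - g \<in> relation_ideal R"
  have "h - f \<in> relation_ideal R \<longleftrightarrow> h - g \<in> relation_ideal R" for h
    using relation_ideal_add[OF _ *, of "h - f"] relation_ideal_diff[OF _ *, of "h - g"] by auto
  then show "presented_class R f = presented_class R g"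
    by (auto simp: in_presented_class_iff)
qed

lemma presented_ring_simps:
  "carrier (presented_ring R) = range (presented_class R)"
  "presented_class R f \<otimes>\<^bsub>presented_ring R\<^esub> presented_class R g = presented_class R (f * g)"
  "presented_class R f \<oplus>\<^bsub>presented_ring R\<^esub> presented_class R g = presented_class R (f + g)"
  "\<one>\<^bsub>presented_ring R\<^esub> = presented_class R 1"
  "\<zero>\<^bsub>presented_ring R\<^esub> = presented_class R 0"
proof -
  interpret ideal "relation_ideal R" free_algebra
    by (rule ideal_relation_ideal)
  show "carrier (presented_ring R) = range (presented_class R)"
    by (auto simp: presented_ring_def FactRing_def A_RCOSETS_def' presented_class_def
        free_algebra_def)
  show "presented_class R f \<otimes>\<^bsub>presented_ring R\<^esub> presented_class R g = presented_class R (f * g)"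
    using rcoset_mult_add[of f g]
    by (simp add: presented_ring_def FactRing_def presented_class_def) (simp add: free_algebra_def)
  show "presented_class R f \<oplus>\<^bsub>presented_ring R\<^esub> presented_class R g = presented_class R (f + g)"
    using a_rcos_sum[of f g]
    by (simp add: presented_ring_def FactRing_def presented_class_def) (simp add: free_algebra_def)
  show "\<one>\<^bsub>presented_ring R\<^esub> = presented_class R 1"
    by (simp add: presented_ring_def FactRing_def presented_class_def free_algebra_def)
  show "\<zero>\<^bsub>presented_ring R\<^esub> = presented_class R 0"
    by (simp add: presented_ring_def FactRing_def presented_class_eq)
qed


section \<open>Formal sums modulo the diamond relations\<close>

lemma carrier_formal_sums: "u \<in> carrier (formal_sums B) \<longleftrightarrow> Poly_Mapping.keys u \<subseteq> carrier B \<times> carrier B"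
  by (simp add: formal_sums_def)

text \<open>Closure places the diamond relations in the carrier of \<open>formal_sums B\<close>,
  where the inverse of the free abelian group is negation.\<close>

locale ae_ring_closed =
  fixes B :: "('k, 'a, 'b, 'z) ae_ring_scheme" (structure)
  assumes add_closed: "\<And>b c. b \<in> carrier B \<Longrightarrow> c \<in> carrier B \<Longrightarrow> b \<oplus> c \<in> carrier B"
    and mult_closed: "\<And>b c. b \<in> carrier B \<Longrightarrow> c \<in> carrier B \<Longrightarrow> b \<otimes> c \<in> carrier B"
    and smult_closed: "\<And>k b. b \<in> carrier B \<Longrightarrow> k \<odot> b \<in> carrier B"
    and src_closed: "\<And>a. src B a \<in> carrier B"
    and tgt_closed: "\<And>a. tgt B a \<in> carrier B"
begin

lemma carrier_formal_sums_closed: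
  "0 \<in> carrier (formal_sums B)"
  "u \<in> carrier (formal_sums B) \<Longrightarrow> v \<in> carrier (formal_sums B) \<Longrightarrow> u + v \<in> carrier (formal_sums B)"
  "u \<in> carrier (formal_sums B) \<Longrightarrow> v \<in> carrier (formal_sums B) \<Longrightarrow> u - v \<in> carrier (formal_sums B)"
  "u \<in> carrier (formal_sums B) \<Longrightarrow> - u \<in> carrier (formal_sums B)"
  "b \<in> carrier B \<Longrightarrow> c \<in> carrier B \<Longrightarrow> frag_of (b, c) \<in> carrier (formal_sums B)"
  using Poly_Mapping.keys_add[of u v] keys_diff[of u v]
  by (fastforce simp: carrier_formal_sums)+

lemma diamond_relations_closed: "u \<in> diamond_relations B \<Longrightarrow> u \<in> carrier (formal_sums B)"
  by (induction rule: diamond_relations.induct)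
    (simp_all add: carrier_formal_sums_closed add_closed mult_closed smult_closed src_closed tgt_closed)

lemma diamond_kernel_induct [consumes 1, case_names zero rel add uminus]:
  assumes "u \<in> diamond_kernel B" and "P 0" "\<And>u. u \<in> diamond_relations B \<Longrightarrow> P u"
    and "\<And>u v. u \<in> diamond_kernel B \<Longrightarrow> P u \<Longrightarrow> v \<in> diamond_kernel B \<Longrightarrow> P v \<Longrightarrow> P (u + v)"
    and "\<And>u. P u \<Longrightarrow> P (- u)"
  shows "P u"
  using assms(1) unfolding diamond_kernel_def
proof (induction rule: generate.induct)
  case (inv h)
  then have "inv\<^bsub>formal_sums B\<^esub> h = - h"
    using diamond_relations_closed[OF inv] by (simp add: formal_sums_def)
  then show ?case using assms(3,5) inv by simp
qed (use assms in \<open>auto simp: formal_sums_def diamond_kernel_def\<close>)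

lemma diamond_kernel_closed:
  shows diamond_kernel_zero: "0 \<in> diamond_kernel B"
    and diamond_kernel_rel: "u \<in> diamond_relations B \<Longrightarrow> u \<in> diamond_kernel B"
    and diamond_kernel_add: "u \<in> diamond_kernel B \<Longrightarrow> v \<in> diamond_kernel B \<Longrightarrow> u + v \<in> diamond_kernel B"
    and diamond_kernel_uminus: "u \<in> diamond_kernel B \<Longrightarrow> - u \<in> diamond_kernel B"
proof -
  show zero: "0 \<in> diamond_kernel B"
    using generate.one[of "formal_sums B"] by (simp add: diamond_kernel_def formal_sums_def)
  show rel: "u \<in> diamond_kernel B" if "u \<in> diamond_relations B" for u
    using that by (simp add: diamond_kernel_def generate.incl)
  show add: "u + v \<in> diamond_kernel B" if "u \<in> diamond_kernel B" "v \<in> diamond_kernel B" for u v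
    using that generate.eng[of u "formal_sums B"]
    by (simp add: diamond_kernel_def) (simp add: formal_sums_def)
  show "- u \<in> diamond_kernel B" if "u \<in> diamond_kernel B"
    using that unfolding diamond_kernel_def
  proof (induction rule: generate.induct)
    case one
    then show ?case using zero by (simp add: diamond_kernel_def formal_sums_def)
  next
    case (incl h)
    then have "inv\<^bsub>formal_sums B\<^esub> h = - h"
      using diamond_relations_closed by (simp add: formal_sums_def)
    then show ?case using generate.inv[OF incl, of "formal_sums B"] by simp
  next
    case (inv h)
    then have "inv\<^bsub>formal_sums B\<^esub> h = - h"
      using diamond_relations_closed by (simp add: formal_sums_def)
    then show ?case using generate.incl[OF inv, of "formal_sums B"] by simp
  next
    case (eng h1 h2)
    then show ?case using add[of "- h1" "- h2"] by (simp add: diamond_kernel_def formal_sums_def)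
  qed
qed

lemma diamond_kernel_diff:
  "u \<in> diamond_kernel B \<Longrightarrow> v \<in> diamond_kernel B \<Longrightarrow> u - v \<in> diamond_kernel B"
  using diamond_kernel_add[OF _ diamond_kernel_uminus] by fastforce

lemma diamond_kernel_sum:
  "(\<And>x. x \<in> A \<Longrightarrow> f x \<in> diamond_kernel B) \<Longrightarrow> sum f A \<in> diamond_kernel B"
  by (induction A rule: infinite_finite_induct) (auto simp: diamond_kernel_zero diamond_kernel_add)

lemma diamond_kernel_carrier: "u \<in> diamond_kernel B \<Longrightarrow> u \<in> carrier (formal_sums B)"
  by (induction rule: diamond_kernel_induct)
    (auto simp: carrier_formal_sums_closed diamond_relations_closed)

lemma in_diamond_class_iff: "v \<in> diamond_class B u \<longleftrightarrow> v - u \<in> diamond_kernel B"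
  by (auto simp: diamond_class_def r_coset_def formal_sums_def intro: bexI[of _ "v - u"])

lemma diamond_class_eq_iff: "diamond_class B u = diamond_class B v \<longleftrightarrow> u - v \<in> diamond_kernel B"
proof
  assume "diamond_class B u = diamond_class B v"
  then show "u - v \<in> diamond_kernel B"
    using in_diamond_class_iff[of u u] by (simp add: in_diamond_class_iff diamond_kernel_zero)
next
  assume *: "u - v \<in> diamond_kernel B"
  have "w - u \<in> diamond_kernel B \<longleftrightarrow> w - v \<in> diamond_kernel B" for w
    using diamond_kernel_add[OF _ *, of "w - u"] diamond_kernel_diff[OF _ *, of "w - v"] by auto
  then show "diamond_class B u = diamond_class B v"
    by (auto simp: in_diamond_class_iff)
qed

end

text \<open>\<open>HX C\<close> and \<open>HX_ae_ring C\<close> are records of different types,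
  because the field \<open>comult\<close> of the first takes values in the diamond of the second;
  this identifies their diamonds.\<close>

lemma diamond_relations_cong:
  fixes B :: "('k, 'a, 'b, 'y) ae_ring_scheme" and B' :: "('k, 'a, 'b, 'z) ae_ring_scheme"
  assumes "carrier B = carrier B'" "monoid.mult B = monoid.mult B'" "ring.add B = ring.add B'"
    "smult B = smult B'" "src B = src B'" "tgt B = tgt B'"
  shows "diamond_relations B = diamond_relations B'"
proof (intro subset_antisym subsetI)
  show "u \<in> diamond_relations B'" if "u \<in> diamond_relations B" for u
    using that by (induction rule: diamond_relations.induct)
      (auto simp: assms intro: diamond_relations.intros[where B = B'])
  show "u \<in> diamond_relations B" if "u \<in> diamond_relations B'" for u
    using that by (induction rule: diamond_relations.induct)
      (auto simp flip: assms intro: diamond_relations.intros[where B = B])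
qed

section \<open>The tensor square of the algebra \<open>HX\<close>\<close>

abbreviation HX_ideal ::
    "('k::field, 'a::{ring,monoid_mult}, 'w::ab_group_add, 'x::ab_group_add) calculus \<Rightarrow>
     ('k, 'a, 'w, 'x) expr set"
  where "HX_ideal C \<equiv> relation_ideal (HX_rel C)"

lemmas HX_ideal_closed = relation_ideal_zero relation_ideal_add relation_ideal_uminus
  relation_ideal_mult_left relation_ideal_mult_right relation_ideal_diff

lemma HX_class_eq_iff: "HX_class C f = HX_class C g \<longleftrightarrow> f - g \<in> HX_ideal C"
  by (simp add: HX_class_def presented_class_eq_iff)

lemma in_HX_class_iff: "g \<in> HX_class C f \<longleftrightarrow> g - f \<in> HX_ideal C"
  by (simp add: HX_class_def in_presented_class_iff)

lemma HX_ae_ring_simps [simp]: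
  "carrier (HX_ae_ring C) = range (HX_class C)"
  "HX_class C f \<otimes>\<^bsub>HX_ae_ring C\<^esub> HX_class C g = HX_class C (f * g)"
  "HX_class C f \<oplus>\<^bsub>HX_ae_ring C\<^esub> HX_class C g = HX_class C (f + g)"
  "\<one>\<^bsub>HX_ae_ring C\<^esub> = HX_class C 1"
  "k \<odot>\<^bsub>HX_ae_ring C\<^esub> HX_class C f = HX_class C (scalar k * f)"
  "src (HX_ae_ring C) a = HX_class C (iA a)"
  "tgt (HX_ae_ring C) a = HX_class C (iAop a)"
  by (simp_all add: HX_ae_ring_def HX_class_def presented_ring_simps Let_def)

lemma HX_fields:
  "carrier (HX C) = carrier (HX_ae_ring C)" "monoid.mult (HX C) = monoid.mult (HX_ae_ring C)"
  "ring.add (HX C) = ring.add (HX_ae_ring C)" "one (HX C) = one (HX_ae_ring C)"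
  "smult (HX C) = smult (HX_ae_ring C)" "src (HX C) = src (HX_ae_ring C)"
  "tgt (HX C) = tgt (HX_ae_ring C)"
  "comult (HX C) b = the_elem ((\<lambda>f. diamond_class (HX_ae_ring C) (comult_expr C f)) ` b)"
  by (simp_all add: HX_def Let_def)

lemma HX_simps [simp]:
  "carrier (HX C) = range (HX_class C)"
  "HX_class C f \<otimes>\<^bsub>HX C\<^esub> HX_class C g = HX_class C (f * g)"
  "HX_class C f \<oplus>\<^bsub>HX C\<^esub> HX_class C g = HX_class C (f + g)"
  "\<one>\<^bsub>HX C\<^esub> = HX_class C 1"
  "k \<odot>\<^bsub>HX C\<^esub> HX_class C f = HX_class C (scalar k * f)"
  "src (HX C) a = HX_class C (iA a)"
  "tgt (HX C) a = HX_class C (iAop a)"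
  by (simp_all add: HX_fields)

interpretation HX: ae_ring_closed "HX_ae_ring C" for C
  by unfold_locales auto

lemma diamond_class_HX: "diamond_class (HX C) = diamond_class (HX_ae_ring C)"
proof -
  have "diamond_relations (HX C) = diamond_relations (HX_ae_ring C)"
    by (rule diamond_relations_cong) (rule HX_fields)+
  moreover have "formal_sums (HX C) = formal_sums (HX_ae_ring C)"
    by (simp add: formal_sums_def)
  ultimately show ?thesis
    by (intro ext) (simp add: diamond_class_def diamond_kernel_def)
qed

definition repr :: "'f set \<Rightarrow> 'f"
  where "repr Y = (SOME f. f \<in> Y)"

lemma repr_HX_class: "repr (HX_class C f) - f \<in> HX_ideal C"
proof -
  have "f \<in> HX_class C f"
    by (simp add: in_HX_class_iff HX_ideal_closed)
  then have "repr (HX_class C f) \<in> HX_class C f"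
    unfolding repr_def by (rule someI)
  then show ?thesis by (simp add: in_HX_class_iff)
qed

lemma HX_class_repr: "b \<in> carrier (HX_ae_ring C) \<Longrightarrow> HX_class C (repr b) = b"
  unfolding HX_ae_ring_simps(1) using repr_HX_class HX_class_eq_iff by (metis rangeE)

text \<open>The quotient of the tensor square by \<open>tensor_kernel C\<close> is isomorphic to
  \<open>diamond (HX_ae_ring C)\<close>, but here the numerator is a ring, and the coproduct a ring map into it.\<close>

inductive_set tensor_kernel ::
    "('k::field, 'a::{ring,monoid_mult}, 'w::ab_group_add, 'x::ab_group_add) calculus \<Rightarrow>
     (('a, 'w, 'x) generator, 'k) expr2 set"
  for C :: "('k, 'a, 'w, 'x) calculus"
  where
    zero: "0 \<in> tensor_kernel C"
  | add: "m \<in> tensor_kernel C \<Longrightarrow> n \<in> tensor_kernel C \<Longrightarrow> m + n \<in> tensor_kernel C"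
  | uminus: "m \<in> tensor_kernel C \<Longrightarrow> - m \<in> tensor_kernel C"
  | left: "p \<in> HX_ideal C \<Longrightarrow> tens p q \<in> tensor_kernel C"
  | right: "q \<in> HX_ideal C \<Longrightarrow> tens p q \<in> tensor_kernel C"
  | balanced: "tens (iAop s * p) q - tens p (iA s * q) \<in> tensor_kernel C"

lemma tensor_kernel_diff:
  "m \<in> tensor_kernel C \<Longrightarrow> n \<in> tensor_kernel C \<Longrightarrow> m - n \<in> tensor_kernel C"
  using tensor_kernel.add[OF _ tensor_kernel.uminus] by fastforce

lemma tensor_kernel_sum:
  "(\<And>x. x \<in> A \<Longrightarrow> f x \<in> tensor_kernel C) \<Longrightarrow> sum f A \<in> tensor_kernel C"
  by (induction A rule: infinite_finite_induct) (auto intro: tensor_kernel.intros)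

text \<open>Right multiplication leaves \<open>iAop s\<close> and \<open>iA s\<close> in front of
  the two factors. Left multiplication by an arbitrary tensor would separate them from the front,
  and the balancing relation could be lost.\<close>

lemma tensor_kernel_mult_right: "m \<in> tensor_kernel C \<Longrightarrow> m * n \<in> tensor_kernel C"
proof (induction n rule: expr2_induct)
  case (tens p q)
  then show ?case
  proof (induction rule: tensor_kernel.induct)
    case (balanced s p' q')
    then show ?case
      using tensor_kernel.balanced[of s "p' * p" "q' * q"]
      by (simp add: left_diff_distrib tens_mult mult.assoc)
  qed (auto simp: distrib_right tens_mult intro: tensor_kernel.intros HX_ideal_closed)
next
  case (add m' n')
  then show ?case by (simp add: distrib_left tensor_kernel.add)
qed

lemma tensor_kernel_const: "m \<in> tensor_kernel C \<Longrightarrow> const k * m \<in> tensor_kernel C"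
  by (simp add: const_commute tensor_kernel_mult_right)

lemma tens_cong:
  assumes "p - p' \<in> HX_ideal C" "q - q' \<in> HX_ideal C"
  shows "tens p q - tens p' q' \<in> tensor_kernel C"
proof -
  have "tens p q - tens p' q' = tens (p - p') q + tens p' (q - q')"
    by (simp add: additive.diff[OF additive_tens_left] additive.diff[OF additive_tens_right])
  then show ?thesis
    using assms by (auto intro: tensor_kernel.intros)
qed

text \<open>Formal sums are free, so the map is additive without any congruence; the arbitrary
  choice in \<open>repr\<close> is visible only modulo \<open>tensor_kernel C\<close>.\<close>

definition to_tens ::
    "(('k::field, 'a, 'w, 'x) expr set \<times> ('k, 'a, 'w, 'x) expr set \<Rightarrow>\<^sub>0 int)
     \<Rightarrow> (('a, 'w, 'x) generator, 'k) expr2"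
  where "to_tens = lin_ext of_int (\<lambda>(b, c). tens (repr b) (repr c))"

lemma additive_to_tens: "additive to_tens"
  unfolding to_tens_def by (rule additive_lin_ext) (simp add: additive_def)

lemma to_tens_pair: "to_tens (frag_of (b, c)) = tens (repr b) (repr c)"
  by (simp add: to_tens_def lin_ext_single additive_def)

lemma to_tens_frag_of: "to_tens (frag_of (HX_class C f, HX_class C g)) - tens f g \<in> tensor_kernel C"
  by (simp add: to_tens_pair tens_cong repr_HX_class)

text \<open>Bilinearity and balancing of \<open>tens\<close> match the diamond relations one by one.
  Replacing the chosen representatives by given expressions costs one element of the kernel for each
  term.\<close>

lemma to_tens_diamond_kernel:
  assumes "u \<in> diamond_kernel (HX_ae_ring C)"
  shows "to_tens u \<in> tensor_kernel C"
  using assms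
proof (induction rule: HX.diamond_kernel_induct)
  case (rel u)
  then show ?case
  proof (induction rule: diamond_relations.induct)
    case (add_left b b' c)
    then obtain f f' g where *: "b = HX_class C f" "b' = HX_class C f'" "c = HX_class C g"
      by auto
    have "(to_tens (frag_of (HX_class C (f + f'), c)) - tens (f + f') g) - (to_tens (frag_of (b, c)) - tens f g)
        - (to_tens (frag_of (b', c)) - tens f' g) \<in> tensor_kernel C"
      unfolding * by (intro tensor_kernel_diff to_tens_frag_of)
    then show ?case
      by (simp add: * additive.diff[OF additive_to_tens] additive.add[OF additive_to_tens]
          additive.add[OF additive_tens_left] algebra_simps)
  next
    case (add_right b c c')
    then obtain f g g' where *: "b = HX_class C f" "c = HX_class C g" "c' = HX_class C g'"
      by auto
    have "(to_tens (frag_of (b, HX_class C (g + g'))) - tens f (g + g')) - (to_tens (frag_of (b, c)) - tens f g)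
        - (to_tens (frag_of (b, c')) - tens f g') \<in> tensor_kernel C"
      unfolding * by (intro tensor_kernel_diff to_tens_frag_of)
    then show ?case
      by (simp add: * additive.diff[OF additive_to_tens] additive.add[OF additive_to_tens]
          additive.add[OF additive_tens_right] algebra_simps)
  next
    case (scalar_balanced b c k)
    then obtain f g where *: "b = HX_class C f" "c = HX_class C g"
      by auto
    have "(to_tens (frag_of (HX_class C (scalar k * f), c)) - tens (scalar k * f) g)
        - (to_tens (frag_of (b, HX_class C (scalar k * g))) - tens f (scalar k * g)) \<in> tensor_kernel C"
      unfolding * by (intro tensor_kernel_diff to_tens_frag_of)
    then show ?case
      by (simp add: * additive.diff[OF additive_to_tens] tens_scalar)
  next
    case (balanced b c s)
    then obtain f g where *: "b = HX_class C f" "c = HX_class C g"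
      by auto
    have "(to_tens (frag_of (HX_class C (iAop s * f), c)) - tens (iAop s * f) g)
        - (to_tens (frag_of (b, HX_class C (iA s * g))) - tens f (iA s * g))
        + (tens (iAop s * f) g - tens f (iA s * g)) \<in> tensor_kernel C"
      unfolding * by (intro tensor_kernel.add tensor_kernel_diff to_tens_frag_of tensor_kernel.balanced)
    then show ?case
      by (simp add: * additive.diff[OF additive_to_tens])
  qed
qed (simp_all add: additive.zero[OF additive_to_tens] additive.add[OF additive_to_tens]
    additive.minus[OF additive_to_tens] tensor_kernel.intros)

text \<open>The map in the opposite direction.  It is additive only modulo the diamond relations.\<close>

definition of_tens ::
    "('k::field, 'a::{ring,monoid_mult}, 'w::ab_group_add, 'x::ab_group_add) calculus \<Rightarrow>
     (('a, 'w, 'x) generator, 'k) expr2 \<Rightarrow>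
     (('k, 'a, 'w, 'x) expr set \<times> ('k, 'a, 'w, 'x) expr set \<Rightarrow>\<^sub>0 int)"
  where "of_tens C m = (\<Sum>w\<in>Poly_Mapping.keys m.
    frag_of (HX_class C (Poly_Mapping.single (fst w) (Poly_Mapping.lookup m w)),
      HX_class C (Poly_Mapping.single (snd w) 1)))"

context
  fixes C :: "('k::field, 'a::{ring,monoid_mult}, 'w::ab_group_add, 'x::ab_group_add) calculus"
begin

abbreviation (input) frag2 where "frag2 f g \<equiv> frag_of (HX_class C f, HX_class C g)"

abbreviation (input) cong2 (infix \<open>\<doteq>\<close> 50) where "u \<doteq> v \<equiv> u - v \<in> diamond_kernel (HX_ae_ring C)"

lemma cong2_trans: "u \<doteq> v \<Longrightarrow> v \<doteq> w \<Longrightarrow> u \<doteq> w"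
  using HX.diamond_kernel_add[of "u - v" C "v - w"] by simp

lemma cong2_sym: "u \<doteq> v \<Longrightarrow> v \<doteq> u"
  using HX.diamond_kernel_uminus[of "u - v" C] by simp

lemma cong2_add: "u \<doteq> v \<Longrightarrow> u' \<doteq> v' \<Longrightarrow> u + u' \<doteq> v + v'"
  using HX.diamond_kernel_add[of "u - v" C "u' - v'"] by (simp add: algebra_simps)

lemma frag2_add_left: "frag2 (f + f') g \<doteq> frag2 f g + frag2 f' g"
  using HX.diamond_kernel_rel[OF diamond_relations.add_left[of "HX_class C f" "HX_ae_ring C"
      "HX_class C f'" "HX_class C g"]]
  by (simp add: algebra_simps)

lemma frag2_add_right: "frag2 f (g + g') \<doteq> frag2 f g + frag2 f g'"
  using HX.diamond_kernel_rel[OF diamond_relations.add_right[of "HX_class C f" "HX_ae_ring C"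
      "HX_class C g" "HX_class C g'"]]
  by (simp add: algebra_simps)

lemma frag2_zero_left: "frag2 0 g \<doteq> 0"
  using HX.diamond_kernel_uminus[OF frag2_add_left[of 0 0 g]] by simp

text \<open>Words outside the support contribute pairs with the class of 0 on the left. Such a pair
  is not the zero formal sum, but it lies in the kernel.\<close>

lemma of_tens_superset:
  assumes "finite A" "Poly_Mapping.keys m \<subseteq> A"
  shows "of_tens C m \<doteq> (\<Sum>w\<in>A. frag2 (Poly_Mapping.single (fst w) (Poly_Mapping.lookup m w))
    (Poly_Mapping.single (snd w) 1))" (is "_ \<doteq> sum ?h A")
proof -
  have "sum ?h A = sum ?h (A - Poly_Mapping.keys m) + of_tens C m"
    unfolding of_tens_def using assms by (intro sum.subset_diff)
  moreover have "sum ?h (A - Poly_Mapping.keys m) \<in> diamond_kernel (HX_ae_ring C)"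
  proof (rule HX.diamond_kernel_sum)
    show "?h w \<in> diamond_kernel (HX_ae_ring C)" if "w \<in> A - Poly_Mapping.keys m" for w
      using that frag2_zero_left by (simp add: in_keys_iff)
  qed
  ultimately show ?thesis
    using HX.diamond_kernel_uminus by fastforce
qed

lemma of_tens_add: "of_tens C (m + n) \<doteq> of_tens C m + of_tens C n"
proof -
  define A where "A = Poly_Mapping.keys m \<union> Poly_Mapping.keys n"
  define h where "h = (\<lambda>m w. frag2 (Poly_Mapping.single (fst w) (Poly_Mapping.lookup m w))
    (Poly_Mapping.single (snd w) (1::'k)))"
  have A: "of_tens C k \<doteq> sum (h k) A" if "Poly_Mapping.keys k \<subseteq> A" for k
    unfolding h_def using that by (intro of_tens_superset) (simp add: A_def)
  have "(\<Sum>w\<in>A. h (m + n) w - (h m w + h n w)) \<in> diamond_kernel (HX_ae_ring C)"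
    unfolding h_def using frag2_add_left
    by (intro HX.diamond_kernel_sum) (simp add: lookup_add single_add)
  then have "sum (h (m + n)) A \<doteq> sum (h m) A + sum (h n) A"
    by (simp add: sum.distrib sum_subtractf)
  moreover have "of_tens C (m + n) \<doteq> sum (h (m + n)) A"
    using Poly_Mapping.keys_add[of m n] by (intro A) (simp add: A_def)
  moreover have "sum (h m) A + sum (h n) A \<doteq> of_tens C m + of_tens C n"
    by (intro cong2_add cong2_sym[OF A]) (simp_all add: A_def)
  ultimately show ?thesis
    using cong2_trans by blast
qed

lemma of_tens_uminus: "of_tens C (- m) \<doteq> - of_tens C m"
proof -
  have "of_tens C 0 = 0" by (simp add: of_tens_def)
  then show ?thesis
    using HX.diamond_kernel_uminus[OF of_tens_add[of m "- m"]] by (simp add: algebra_simps)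
qed

lemma of_tens_tens: "of_tens C (tens p q) \<doteq> frag2 p q"
proof (induction p rule: poly_mapping_additive_induct)
  case left: (single u a)
  show ?case
  proof (induction q rule: poly_mapping_additive_induct)
    case (single w b)
    have "of_tens C (tens (Poly_Mapping.single u a) (Poly_Mapping.single w b))
      \<doteq> frag2 (Poly_Mapping.single u (a * b)) (Poly_Mapping.single w 1)"
      using of_tens_superset[of "{(u, w)}" "Poly_Mapping.single (u, w) (a * b)"]
      by (simp add: tens_single)
    \<comment> \<open>\<open>of_tens\<close> keeps the whole coefficient in the left factor;
      balancedness over the ground field moves \<open>b\<close> back to the right.\<close>
    moreover have "frag2 (Poly_Mapping.single u (a * b)) (Poly_Mapping.single w 1)
      \<doteq> frag2 (Poly_Mapping.single u a) (Poly_Mapping.single w b)"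
      using HX.diamond_kernel_rel[OF diamond_relations.scalar_balanced[of
          "HX_class C (Poly_Mapping.single u a)" "HX_ae_ring C" "HX_class C (Poly_Mapping.single w 1)" b]]
      by (simp add: scalar_def mult_single mult.commute)
    ultimately show ?case by (rule cong2_trans)
  next
    case (add q q')
    have "of_tens C (tens (Poly_Mapping.single u a) (q + q'))
      \<doteq> of_tens C (tens (Poly_Mapping.single u a) q) + of_tens C (tens (Poly_Mapping.single u a) q')"
      unfolding additive.add[OF additive_tens_right] by (rule of_tens_add)
    from cong2_trans[OF cong2_trans[OF this cong2_add[OF add]] cong2_sym[OF frag2_add_right]]
    show ?case .
  qed
next
  case (add p p')
  have "of_tens C (tens (p + p') q) \<doteq> of_tens C (tens p q) + of_tens C (tens p' q)"
    unfolding additive.add[OF additive_tens_left] by (rule of_tens_add)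
  from cong2_trans[OF cong2_trans[OF this cong2_add[OF add]] cong2_sym[OF frag2_add_left]]
  show ?case .
qed

lemma of_tens_tensor_kernel: "m \<in> tensor_kernel C \<Longrightarrow> of_tens C m \<doteq> 0"
proof (induction rule: tensor_kernel.induct)
  case zero
  then show ?case by (simp add: of_tens_def HX.diamond_kernel_zero)
next
  case (add m n)
  then show ?case using cong2_trans[OF of_tens_add cong2_add] by fastforce
next
  case (uminus m)
  then show ?case
    using cong2_trans[OF of_tens_uminus, of m 0] HX.diamond_kernel_uminus[of "of_tens C m"] by simp
next
  case (left p q)
  then have "HX_class C p = HX_class C 0" by (simp add: HX_class_eq_iff)
  then show ?case
    using cong2_trans[OF of_tens_tens, of p q 0] frag2_zero_left by simp
next
  case (right q p)
  then have "HX_class C q = HX_class C 0" by (simp add: HX_class_eq_iff)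
  moreover have "frag2 p 0 \<doteq> 0"
    using HX.diamond_kernel_uminus[OF frag2_add_right[of p 0 0]] by simp
  ultimately show ?case
    using cong2_trans[OF of_tens_tens, of p q 0] by simp
next
  case (balanced s p q)
  have "frag2 (iAop s * p) q \<doteq> frag2 p (iA s * q)"
    using HX.diamond_kernel_rel[OF diamond_relations.balanced[of "HX_class C p" "HX_ae_ring C"
        "HX_class C q" s]] by simp
  with of_tens_tens have "of_tens C (tens (iAop s * p) q) \<doteq> of_tens C (tens p (iA s * q))"
    using cong2_trans cong2_sym by meson
  moreover have "of_tens C (tens (iAop s * p) q - tens p (iA s * q))
    \<doteq> of_tens C (tens (iAop s * p) q) + - of_tens C (tens p (iA s * q))"
    using cong2_trans[OF of_tens_add cong2_add[OF _ of_tens_uminus]]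
    by (metis HX.diamond_kernel_zero add_uminus_conv_diff diff_self)
  ultimately show ?case
    using cong2_trans[of _ _ 0] by simp
qed

lemma of_tens_to_tens:
  assumes "u \<in> carrier (formal_sums (HX_ae_ring C))"
  shows "of_tens C (to_tens u) \<doteq> u"
proof -
  have "Poly_Mapping.keys u \<subseteq> range (HX_class C) \<times> range (HX_class C)"
    using assms by (simp add: carrier_formal_sums)
  then show ?thesis
  proof (induction rule: frag_induction)
    case zero
    then show ?case by (simp add: additive.zero[OF additive_to_tens] of_tens_def HX.diamond_kernel_zero)
  next
    case (one x)
    then obtain f g where x: "x = (HX_class C f, HX_class C g)" by auto
    have "of_tens C (to_tens (frag_of x)) \<doteq> frag2 (repr (HX_class C f)) (repr (HX_class C g))"
      using of_tens_tens by (simp add: to_tens_pair x)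
    then show ?case by (simp add: HX_class_repr x)
  next
    case (diff u v)
    have "of_tens C (to_tens (u - v)) \<doteq> of_tens C (to_tens u) + of_tens C (- to_tens v)"
      using of_tens_add[of "to_tens u" "- to_tens v"] by (simp add: additive.diff[OF additive_to_tens])
    moreover have "of_tens C (- to_tens v) \<doteq> - v"
      using cong2_trans[OF of_tens_uminus, of "to_tens v" "- v"]
        HX.diamond_kernel_uminus[OF diff(2)] by simp
    ultimately show ?case
      using cong2_trans[OF _ cong2_add[OF diff(1)], of _ "of_tens C (- to_tens v)" "- v"] by simp
  qed
qed

end

text \<open>The tensor square identifies no more than the diamond does, since
  \<open>of_tens C\<close> undoes \<open>to_tens\<close> modulo the diamond relations.\<close>

lemma to_tens_in_tensor_kernel_iff:
  assumes "u \<in> carrier (formal_sums (HX_ae_ring C))"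
  shows "to_tens u \<in> tensor_kernel C \<longleftrightarrow> u \<in> diamond_kernel (HX_ae_ring C)"
proof
  assume "to_tens u \<in> tensor_kernel C"
  from HX.diamond_kernel_diff[OF of_tens_tensor_kernel[OF this] of_tens_to_tens[OF assms]]
  show "u \<in> diamond_kernel (HX_ae_ring C)" by simp
qed (rule to_tens_diamond_kernel)

lemma diamond_class_HX_eq_iff:
  assumes "u \<in> carrier (formal_sums (HX_ae_ring C))" "v \<in> carrier (formal_sums (HX_ae_ring C))"
  shows "diamond_class (HX_ae_ring C) u = diamond_class (HX_ae_ring C) v
    \<longleftrightarrow> to_tens u - to_tens v \<in> tensor_kernel C"
  using to_tens_in_tensor_kernel_iff[OF HX.carrier_formal_sums_closed(3)[OF assms]]
  by (simp add: HX.diamond_class_eq_iff additive.diff[OF additive_to_tens])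


section \<open>The coproduct\<close>

definition cop_gen ::
    "('k::field, 'a::{ring,monoid_mult}, 'w::ab_group_add, 'x::ab_group_add) calculus \<Rightarrow>
     ('a, 'w, 'x) generator \<Rightarrow> (('a, 'w, 'x) generator, 'k) expr2"
  where "cop_gen C g = (\<Sum>(p, q)\<leftarrow>comult_generator C g. tens p q)"

definition cop ::
    "('k::field, 'a::{ring,monoid_mult}, 'w::ab_group_add, 'x::ab_group_add) calculus \<Rightarrow>
     ('k, 'a, 'w, 'x) expr \<Rightarrow> (('a, 'w, 'x) generator, 'k) expr2"
  where "cop C = lin_ext const (word_prod (cop_gen C))"

lemma additive_cop: "additive (cop C)"
  by (simp add: cop_def additive_lin_ext additive_const)

lemma cop_mult: "cop C (f * g) = cop C f * cop C g"
  unfolding cop_def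
  by (rule lin_ext_mult[OF additive_const const_mult]) (rule const_commute[symmetric], simp)

lemma cop_scalar: "cop C (scalar k) = const k"
  by (simp add: cop_def scalar_def lin_ext_single additive_const)

lemma cop_one [simp]: "cop C 1 = 1"
  using cop_scalar[of C 1] by (simp add: scalar_def)

lemma cop_gen: "cop C (gen g) = cop_gen C g"
  by (simp add: cop_def gen_def lin_ext_single additive_const)

lemma word_prod_cop_gen:
  fixes C :: "('k::field, 'a::{ring,monoid_mult}, 'w::ab_group_add, 'x::ab_group_add) calculus"
  shows "word_prod (cop_gen C) v = (\<Sum>(p, q)\<leftarrow>comult_word C v. tens p q)"
proof (cases v)
  case (Word gs)
  have "prod_list (map (cop_gen C) gs) = (\<Sum>(p, q)\<leftarrow>comult_word C (Word gs). tens p q)"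
  proof (induction gs)
    case (Cons g gs)
    have *: "(\<Sum>(p, q)\<leftarrow>xs. tens p q) * (\<Sum>(p, q)\<leftarrow>ys. tens p q)
      = (\<Sum>(p, q)\<leftarrow>[(p * p', q * q'). (p, q) \<leftarrow> xs, (p', q') \<leftarrow> ys]. tens p q)"
      for xs ys :: "(('k, 'a, 'w, 'x) expr \<times> ('k, 'a, 'w, 'x) expr) list"
    proof (induction xs)
      case (Cons x xs)
      have "tens (fst x) (snd x) * (\<Sum>(p, q)\<leftarrow>ys. tens p q)
        = (\<Sum>(p, q)\<leftarrow>[(fst x * p', snd x * q'). (p', q') \<leftarrow> ys]. tens p q)"
        by (induction ys) (auto simp: distrib_left tens_mult)
      with Cons show ?case
        by (cases x) (simp add: distrib_right)
    qed simp
    show ?case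
      unfolding list.map prod_list.Cons Cons.IH cop_gen_def[of C g] * by simp
  qed simp
  then show ?thesis by (simp add: Word)
qed

text \<open>Links the formal sum in the definition of \<open>HX\<close>, whose coefficients sit in
  the left factors, to the ring homomorphism \<open>cop C\<close>. Equality is only modulo the
  kernel, because \<open>to_tens\<close> chooses representatives of classes.\<close>

lemma to_tens_comult_expr: "to_tens (comult_expr C f) - cop C f \<in> tensor_kernel C"
proof -
  have list: "to_tens (\<Sum>(p, q)\<leftarrow>xs. frag_of (HX_class C (scalar k * p), HX_class C q))
      - const k * (\<Sum>(p, q)\<leftarrow>xs. tens p q) \<in> tensor_kernel C" for k xs
  proof (induction xs)
    case Nil
    then show ?case by (simp add: additive.zero[OF additive_to_tens] tensor_kernel.zero)
  next
    case (Cons x xs)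
    have "to_tens (frag_of (HX_class C (scalar k * fst x), HX_class C (snd x)))
      - const k * tens (fst x) (snd x) \<in> tensor_kernel C"
      using to_tens_frag_of[of C "scalar k * fst x" "snd x"] by (simp add: tens_scalar)
    from tensor_kernel.add[OF this Cons] show ?case
      by (simp add: additive.add[OF additive_to_tens] split_beta algebra_simps)
  qed
  have "to_tens (comult_expr C f) - cop C f = (\<Sum>v\<in>Poly_Mapping.keys f.
    to_tens (\<Sum>(p, q)\<leftarrow>comult_word C v.
      frag_of (HX_class C (scalar (Poly_Mapping.lookup f v) * p), HX_class C q))
    - const (Poly_Mapping.lookup f v) * (\<Sum>(p, q)\<leftarrow>comult_word C v. tens p q))"
    by (simp add: comult_expr_def cop_def lin_ext_def word_prod_cop_gen additive.sum[OF additive_to_tens]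
        sum_subtractf)
  also have "\<dots> \<in> tensor_kernel C"
    by (intro tensor_kernel_sum list)
  finally show ?thesis .
qed

lemma comult_expr_carrier: "comult_expr C f \<in> carrier (formal_sums (HX_ae_ring C))"
proof -
  have list: "(\<Sum>(p, q)\<leftarrow>xs. frag_of (HX_class C (h p), HX_class C q))
    \<in> carrier (formal_sums (HX_ae_ring C))" for h xs
    by (induction xs) (auto intro!: HX.carrier_formal_sums_closed)
  have sum: "(\<And>v. v \<in> A \<Longrightarrow> g v \<in> carrier (formal_sums (HX_ae_ring C))) \<Longrightarrow>
    sum g A \<in> carrier (formal_sums (HX_ae_ring C))" for g :: "'z \<Rightarrow> _" and A
    by (induction A rule: infinite_finite_induct) (auto intro!: HX.carrier_formal_sums_closed)
  show ?thesis
    unfolding comult_expr_def by (intro sum list)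
qed

section \<open>Sums over dual bases\<close>

text \<open>The summand is curried: without \<open>case_prod\<close>, sums can be interchanged,
  moved through additive maps and contracted by plain rewriting.\<close>

definition psum :: "('u \<times> 'v) list \<Rightarrow> ('u \<Rightarrow> 'v \<Rightarrow> 'd::ab_group_add) \<Rightarrow> 'd"
  where "psum xs f = (\<Sum>(u, v)\<leftarrow>xs. f u v)"

lemma additive_psum: "additive g \<Longrightarrow> g (psum xs f) = psum xs (\<lambda>u v. g (f u v))"
  by (induction xs) (auto simp: psum_def additive.zero additive.add)

lemma psum_cong: "(\<And>u v. f u v = g u v) \<Longrightarrow> psum xs f = psum xs g"
  by (simp add: psum_def)

lemma psum_add: "psum xs (\<lambda>u v. f u v + g u v) = psum xs f + psum xs g"
  by (induction xs) (auto simp: psum_def algebra_simps)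

lemma psum_minus: "psum xs (\<lambda>u v. - f u v) = - psum xs f"
  by (induction xs) (auto simp: psum_def algebra_simps)

lemma psum_diff: "psum xs (\<lambda>u v. f u v - g u v) = psum xs f - psum xs g"
  by (induction xs) (auto simp: psum_def algebra_simps)

lemma psum_zero: "psum xs (\<lambda>u v. 0) = 0"
  by (induction xs) (auto simp: psum_def)

lemma psum_swap:
  fixes f :: "'a \<Rightarrow> 'b \<Rightarrow> 'c \<Rightarrow> 'e \<Rightarrow> 'd::ab_group_add"
  shows "psum xs (\<lambda>a b. psum ys (\<lambda>c d. f a b c d)) = psum ys (\<lambda>c d. psum xs (\<lambda>a b. f a b c d))"
proof (induction xs)
  case Nil
  then show ?case using psum_zero[of ys] by (simp add: psum_def)
next
  case (Cons x xs)
  have "psum (x # xs) g = g (fst x) (snd x) + psum xs g" for g :: "'a \<Rightarrow> 'b \<Rightarrow> 'd"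
    by (simp add: psum_def split_beta)
  then show ?case by (simp add: Cons.IH psum_add)
qed

lemma psum_mult_left: "c * psum xs f = psum xs (\<lambda>u v. c * f u v)" for c :: "'r::ring"
  by (rule additive_psum) (rule additive_mult_left)

lemma psum_mult_right: "psum xs f * c = psum xs (\<lambda>u v. f u v * c)" for c :: "'r::ring"
  by (rule additive_psum) (rule additive_mult_right)

context pivotal_calculus
begin

sublocale W: algebra_bimodule "scl C" "lW C" "rW C" by (rule bimodule_W)
sublocale X: algebra_bimodule "scl C" "lX C" "rX C" by (rule bimodule_X)
sublocale ev: bimodule_pairing "lX C" "rX C" "lW C" "rW C" "ev C" by (rule pairing_ev)
sublocale uev: bimodule_pairing "lW C" "rW C" "lX C" "rX C" "uev C" by (rule pairing_uev)

lemma dual_bases: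
  shows dualW: "psum (coev C) (\<lambda>w x. rW C w (ev C x v)) = v"
    and udualW: "psum (ucoev C) (\<lambda>y r. lW C (uev C v y) r) = v"
    and dualX: "psum (coev C) (\<lambda>w x. lX C (ev C z w) x) = z"
    and udualX: "psum (ucoev C) (\<lambda>y r. rX C y (uev C r z)) = z"
  unfolding psum_def by (rule dual_W[symmetric] udual_W[symmetric] dual_X[symmetric] udual_X[symmetric])+

text \<open>Expand \<open>lW C a w\<close> in the dual basis, carry the coefficient
  \<open>ev C x' (lW C a w)\<close> through the balanced \<beta> to the other factor, and resum
  there with the second duality identity. In words of bimodules: coev(1) is central.\<close>

lemma coev_central:
  fixes \<beta> :: "'w \<Rightarrow> 'x \<Rightarrow> 'd::ab_group_add"
  assumes l: "\<And>x. additive (\<lambda>w. \<beta> w x)" and r: "\<And>w. additive (\<beta> w)"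
    and bal: "\<And>w a x. \<beta> (rW C w a) x = \<beta> w (lX C a x)"
  shows "psum (coev C) (\<lambda>w x. \<beta> (lW C a w) x) = psum (coev C) (\<lambda>w x. \<beta> w (rX C x a))"
proof -
  have "psum (coev C) (\<lambda>w x. \<beta> (lW C a w) x)
    = psum (coev C) (\<lambda>w x. \<beta> (psum (coev C) (\<lambda>w' x'. rW C w' (ev C x' (lW C a w)))) x)"
    by (simp only: dualW)
  also have "\<dots> = psum (coev C) (\<lambda>w x. psum (coev C) (\<lambda>w' x'. \<beta> w' (lX C (ev C (rX C x' a) w) x)))"
    by (simp only: additive_psum[OF l] bal ev.balanced)
  also have "\<dots> = psum (coev C) (\<lambda>w' x'. psum (coev C) (\<lambda>w x. \<beta> w' (lX C (ev C (rX C x' a) w) x)))"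
    by (rule psum_swap)
  also have "\<dots> = psum (coev C) (\<lambda>w x. \<beta> w (rX C x a))"
    by (simp only: additive_psum[OF r, symmetric] dualX)
  finally show ?thesis .
qed

lemma ucoev_central:
  fixes \<beta> :: "'x \<Rightarrow> 'w \<Rightarrow> 'd::ab_group_add"
  assumes l: "\<And>r. additive (\<lambda>y. \<beta> y r)" and r: "\<And>y. additive (\<beta> y)"
    and bal: "\<And>y a r. \<beta> (rX C y a) r = \<beta> y (lW C a r)"
  shows "psum (ucoev C) (\<lambda>y r. \<beta> (lX C a y) r) = psum (ucoev C) (\<lambda>y r. \<beta> y (rW C r a))"
proof -
  have "psum (ucoev C) (\<lambda>y r. \<beta> (lX C a y) r)
    = psum (ucoev C) (\<lambda>y r. \<beta> (psum (ucoev C) (\<lambda>y' r'. rX C y' (uev C r' (lX C a y)))) r)"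
    by (simp only: udualX)
  also have "\<dots> = psum (ucoev C) (\<lambda>y r. psum (ucoev C) (\<lambda>y' r'. \<beta> y' (lW C (uev C (rW C r' a) y) r)))"
    by (simp only: additive_psum[OF l] bal uev.balanced)
  also have "\<dots> = psum (ucoev C) (\<lambda>y' r'. psum (ucoev C) (\<lambda>y r. \<beta> y' (lW C (uev C (rW C r' a) y) r)))"
    by (rule psum_swap)
  also have "\<dots> = psum (ucoev C) (\<lambda>y r. \<beta> y (rW C r a))"
    by (simp only: additive_psum[OF r, symmetric] udualW)
  finally show ?thesis .
qed

end


section \<open>Computations in a model of the relations\<close>

text \<open>The map \<open>t\<close> stands for the class of a pure tensor in \<open>B \<diamond> B\<close>.  The unit \<open>e\<close> of the image of
  \<open>HX\<close> need not be a unit of the ring \<open>'b\<close>.\<close>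

locale HX_model = pivotal_calculus C
  for C :: "('k::field, 'a::{ring,monoid_mult}, 'w::ab_group_add, 'x::ab_group_add) calculus" +
  fixes e :: "'b::ring" and A Aop :: "'a \<Rightarrow> 'b" and XW :: "'x \<Rightarrow> 'w \<Rightarrow> 'b"
    and WX :: "'w \<Rightarrow> 'x \<Rightarrow> 'b" and Xg :: "'x \<Rightarrow> 'b" and t :: "'b \<Rightarrow> 'b \<Rightarrow> 'd::ab_group_add"
  assumes additive_A: "additive A" and additive_Aop: "additive Aop" and additive_X: "additive Xg"
    and additive_XW_left: "additive (\<lambda>x. XW x w)" and additive_XW_right: "additive (XW x)"
    and additive_WX_left: "additive (\<lambda>w. WX w x)" and additive_WX_right: "additive (WX w)"
    and e_left: "e * A a = A a" "e * Aop a = Aop a" "e * XW x w = XW x w" "e * WX w x = WX w x"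
      "e * Xg x = Xg x"
    and e_right: "A a * e = A a" "Aop a * e = Aop a" "XW x w * e = XW x w" "WX w x * e = WX w x"
      "Xg x * e = Xg x"
    and A_mult: "A a * A b = A (a * b)" and Aop_mult: "Aop a * Aop b = Aop (b * a)"
    and A_Aop: "A a * Aop b = Aop b * A a"
    and A_XW: "A a * XW x w = XW (lX C a x) w" and XW_A: "XW x w * A a = XW (rX C x a) w"
    and Aop_XW: "Aop a * XW x w = XW x (rW C w a)" and XW_Aop: "XW x w * Aop a = XW x (lW C a w)"
    and A_WX: "A a * WX w x = WX (lW C a w) x" and WX_A: "WX w x * A a = WX (rW C w a) x"
    and Aop_WX: "Aop a * WX w x = WX w (rX C x a)" and WX_Aop: "WX w x * Aop a = WX w (lX C a x)"
    and WX_XW_coev: "psum (coev C) (\<lambda>wi xi. WX wi x * XW xi w) = Aop (uev C w x)"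
    and XW_WX_ucoev: "psum (ucoev C) (\<lambda>yj rj. XW x rj * WX w yj) = A (ev C x w)"
    and XW_WX_ucoev': "psum (ucoev C) (\<lambda>yj rj. XW yj w * WX rj x) = Aop (ev C x w)"
    and WX_XW_coev': "psum (coev C) (\<lambda>wi xi. WX w xi * XW x wi) = A (uev C w x)"
    and A_X: "A a * Xg x = Xg (lX C a x)"
    and X_A: "Xg x * A a = Xg (rX C x a) + A (ev C x (dif C a))"
    and X_Aop: "Xg x * Aop a = Aop a * Xg x + XW x (dif C a)"
    and additive_t_left: "additive (\<lambda>p. t p q)" and additive_t_right: "additive (t p)"
    and t_balanced: "t (Aop s * p) q = t p (A s * q)"
begin

text \<open>Products are kept nested to the right, where a rule for \<open>a * b\<close> does not
  match inside a longer product; this produces the version that does.\<close>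

lemma assoc_ext: "a * b = c \<Longrightarrow> a * (b * z) = c * z" for a b c z :: 'b
  by (simp flip: mult.assoc)

lemmas additives = additive_A additive_Aop additive_X additive_XW_left additive_XW_right
  additive_WX_left additive_WX_right additive_t_left additive_t_right
lemmas adds = additives[THEN additive.add]
lemmas psums = additives[THEN additive_psum] psum_mult_left psum_mult_right

lemmas bimodule_rules = A_mult Aop_mult A_XW XW_A Aop_XW XW_Aop A_WX WX_A Aop_WX WX_Aop A_X
lemmas bimodule_simps = bimodule_rules bimodule_rules[THEN assoc_ext]
  e_left e_left[THEN assoc_ext] e_right e_right[THEN assoc_ext] mult.assoc

lemma t_Aop: "t (Aop s) q = t e (A s * q)"
  by (metis t_balanced e_right(2))

lemma t_A: "t p (A s) = t (Aop s * p) e"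
  by (simp add: t_balanced e_right)

section \<open>The Takeuchi condition for the coproducts of the generators\<close>

lemma takeuchi_A: "t (A a * (Aop s * p)) q = t (A a * p) (A s * q)"
  by (simp add: A_Aop[THEN assoc_ext] mult.assoc t_balanced)

lemma takeuchi_Aop: "t (Aop s * p) (Aop a * q) = t p (Aop a * (A s * q))"
  by (simp add: t_balanced A_Aop[THEN assoc_ext] mult.assoc)

text \<open>The part common to (x, \<omega>) and x, with \<open>f\<close> the second factor. The
  summand is balanced because a right factor of the form \<open>w\<close> leaves
  \<open>XW x w\<close> as \<open>Aop\<close> on the left, crosses the diamond, and is absorbed by
  \<open>f\<close>; so \<open>coev_central\<close> applies.\<close>

lemma takeuchi_coev:
  assumes f: "additive f" and f_lX: "\<And>a x. A a * f x = f (lX C a x)"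
  shows "psum (coev C) (\<lambda>w x'. t (XW x w * (Aop s * p)) (f x' * q))
    = psum (coev C) (\<lambda>w x'. t (XW x w * p) (f (rX C x' s) * q))"
proof -
  have "psum (coev C) (\<lambda>w x'. t (XW x (lW C s w) * p) (f x' * q))
    = psum (coev C) (\<lambda>w x'. t (XW x w * p) (f (rX C x' s) * q))"
    by (rule coev_central)
      (simp_all add: additive_def adds additive.add[OF f] distrib_right f_lX[symmetric] mult.assoc
        flip: Aop_XW t_balanced)
  then show ?thesis
    by (simp add: XW_Aop[THEN assoc_ext])
qed

lemma takeuchi_XW:
  "psum (coev C) (\<lambda>w x'. t (XW x w * (Aop s * p)) (XW x' v * q))
    = psum (coev C) (\<lambda>w x'. t (XW x w * p) (XW x' v * (A s * q)))"
  using takeuchi_coev[OF additive_XW_left A_XW, of x s p v q] by (simp add: XW_A[THEN assoc_ext])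

lemma takeuchi_WX:
  "psum (ucoev C) (\<lambda>y r. t (WX v y * (Aop s * p)) (WX r x * q))
    = psum (ucoev C) (\<lambda>y r. t (WX v y * p) (WX r x * (A s * q)))"
proof -
  have "psum (ucoev C) (\<lambda>y r. t (WX v (lX C s y) * p) (WX r x * q))
    = psum (ucoev C) (\<lambda>y r. t (WX v y * p) (WX (rW C r s) x * q))"
    by (rule ucoev_central)
      (simp_all add: additive_def adds distrib_right mult.assoc A_WX[THEN assoc_ext, symmetric]
        flip: Aop_WX t_balanced A_WX)
  then show ?thesis
    by (simp add: bimodule_simps)
qed

text \<open>Neither summand satisfies the condition alone. Moving \<open>Xg x\<close> past
  \<open>Aop s\<close> leaves \<open>XW x (dif C s)\<close> in the first; moving
  \<open>Xg x'\<close> past \<open>A s\<close> leaves \<open>ev C x' (dif C s)\<close> in the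
  second, and summed over the dual basis these give the same term.\<close>

lemma takeuchi_X:
  "t (Xg x * (Aop s * p)) q + psum (coev C) (\<lambda>w x'. t (XW x w * (Aop s * p)) (Xg x' * q))
    = t (Xg x * p) (A s * q) + psum (coev C) (\<lambda>w x'. t (XW x w * p) (Xg x' * (A s * q)))"
proof -
  have "psum (coev C) (\<lambda>w x'. t (XW x w * p) (A (ev C x' (dif C s)) * q))
    = psum (coev C) (\<lambda>w x'. t (XW x (rW C w (ev C x' (dif C s))) * p) q)"
    by (simp only: t_balanced[symmetric] bimodule_simps)
  also have "\<dots> = t (XW x (dif C s) * p) q"
    by (simp only: psums[symmetric] dualW)
  finally show ?thesis
    using takeuchi_coev[OF additive_X A_X, of x s p q]
    by (simp add: X_A[THEN assoc_ext] X_Aop[THEN assoc_ext] distrib_right distrib_left adds psum_add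
        t_balanced mult.assoc)
qed

text \<open>With the sum over \<open>wi\<close>, \<open>xi\<close> innermost, the relation yields
  the bar of \<open>uev C wk yj\<close>, which crosses the diamond and turns the sum of the
  \<open>rj\<close> into \<open>wk\<close>. The free \<open>f\<close> allows two uses: with (x,
  \<omega>) for the coproduct of this relation, with x for the first antipode axiom.\<close>

lemma cop_WX_XW:
  "psum (coev C) (\<lambda>wi xi. psum (ucoev C) (\<lambda>yj rj. psum (coev C) (\<lambda>wk xk.
      t (WX wi yj * XW xi wk) (WX rj x * f xk))))
    = psum (coev C) (\<lambda>wk xk. t e (WX wk x * f xk))" (is "?l = _")
proof -
  have "?l = psum (coev C) (\<lambda>wi xi. psum (coev C) (\<lambda>wk xk. psum (ucoev C) (\<lambda>yj rj.
      t (WX wi yj * XW xi wk) (WX rj x * f xk))))"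
    by (intro psum_cong psum_swap)
  also have "\<dots> = psum (coev C) (\<lambda>wk xk. psum (coev C) (\<lambda>wi xi. psum (ucoev C) (\<lambda>yj rj.
      t (WX wi yj * XW xi wk) (WX rj x * f xk))))"
    by (rule psum_swap)
  also have "\<dots> = psum (coev C) (\<lambda>wk xk. psum (ucoev C) (\<lambda>yj rj. psum (coev C) (\<lambda>wi xi.
      t (WX wi yj * XW xi wk) (WX rj x * f xk))))"
    by (intro psum_cong psum_swap)
  also have "\<dots> = psum (coev C) (\<lambda>wk xk. psum (ucoev C) (\<lambda>yj rj.
      t e (WX (lW C (uev C wk yj) rj) x * f xk)))"
    by (simp only: psums(8)[symmetric] WX_XW_coev t_Aop bimodule_simps)
  also have "\<dots> = psum (coev C) (\<lambda>wk xk. t e (WX wk x * f xk))"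
    by (simp only: psums[symmetric] udualW)
  finally show ?thesis .
qed

text \<open>Here the contraction happens in the second factor, so the resulting element of
  \<open>A\<close> crosses to the left as \<open>Aop\<close>; the same relation then contracts the
  remaining sum.\<close>

lemma cop_XW_WX:
  "psum (ucoev C) (\<lambda>yj rj. psum (coev C) (\<lambda>wi xi. psum (ucoev C) (\<lambda>yk rk.
      t (XW x wi * WX w yk) (XW xi rj * WX rk yj))))
    = t (A (ev C x w)) e" (is "?l = _")
proof -
  have "?l = psum (ucoev C) (\<lambda>yj rj. psum (ucoev C) (\<lambda>yk rk. psum (coev C) (\<lambda>wi xi.
      t (XW x wi * WX w yk) (XW xi rj * WX rk yj))))"
    by (intro psum_cong psum_swap)
  also have "\<dots> = psum (ucoev C) (\<lambda>yk rk. psum (ucoev C) (\<lambda>yj rj. psum (coev C) (\<lambda>wi xi.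
      t (XW x wi * WX w yk) (XW xi rj * WX rk yj))))"
    by (rule psum_swap)
  also have "\<dots> = psum (ucoev C) (\<lambda>yk rk. psum (coev C) (\<lambda>wi xi. psum (ucoev C) (\<lambda>yj rj.
      t (XW x wi * WX w yk) (XW xi rj * WX rk yj))))"
    by (intro psum_cong psum_swap)
  also have "\<dots> = psum (ucoev C) (\<lambda>yk rk. psum (coev C) (\<lambda>wi xi.
      t (XW x (rW C wi (ev C xi rk)) * WX w yk) e))"
    by (simp only: psums(9)[symmetric] XW_WX_ucoev t_A bimodule_simps)
  also have "\<dots> = t (A (ev C x w)) e"
    by (simp only: psums[symmetric] dualW XW_WX_ucoev)
  finally show ?thesis .
qed

lemma cop_XW_WX':
  "psum (ucoev C) (\<lambda>yj rj. psum (coev C) (\<lambda>wi xi. psum (ucoev C) (\<lambda>yk rk.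
      t (XW yj wi * WX rj yk) (XW xi w * WX rk x))))
    = t e (Aop (ev C x w))" (is "?l = _")
proof -
  have "?l = psum (ucoev C) (\<lambda>yj rj. psum (ucoev C) (\<lambda>yk rk. psum (coev C) (\<lambda>wi xi.
      t (XW yj wi * WX rj yk) (XW xi w * WX rk x))))"
    by (intro psum_cong psum_swap)
  also have "\<dots> = psum (ucoev C) (\<lambda>yk rk. psum (ucoev C) (\<lambda>yj rj. psum (coev C) (\<lambda>wi xi.
      t (XW yj wi * WX rj yk) (XW xi w * WX rk x))))"
    by (rule psum_swap)
  also have "\<dots> = psum (ucoev C) (\<lambda>yk rk. psum (coev C) (\<lambda>wi xi. psum (ucoev C) (\<lambda>yj rj.
      t (XW yj wi * WX rj yk) (XW xi w * WX rk x))))"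
    by (intro psum_cong psum_swap)
  also have "\<dots> = psum (ucoev C) (\<lambda>yk rk. psum (coev C) (\<lambda>wi xi.
      t e (XW (lX C (ev C yk wi) xi) w * WX rk x)))"
    by (simp only: psums(8)[symmetric] XW_WX_ucoev' t_Aop bimodule_simps)
  also have "\<dots> = t e (Aop (ev C x w))"
    by (simp only: psums[symmetric] dualX XW_WX_ucoev')
  finally show ?thesis .
qed

lemma cop_WX_XW':
  "psum (coev C) (\<lambda>wi xi. psum (ucoev C) (\<lambda>yj rj. psum (coev C) (\<lambda>wk xk.
      t (WX w yj * XW x wk) (WX rj xi * XW xk wi))))
    = t (A (uev C w x)) e" (is "?l = _")
proof -
  have "?l = psum (coev C) (\<lambda>wi xi. psum (coev C) (\<lambda>wk xk. psum (ucoev C) (\<lambda>yj rj.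
      t (WX w yj * XW x wk) (WX rj xi * XW xk wi))))"
    by (intro psum_cong psum_swap)
  also have "\<dots> = psum (coev C) (\<lambda>wk xk. psum (coev C) (\<lambda>wi xi. psum (ucoev C) (\<lambda>yj rj.
      t (WX w yj * XW x wk) (WX rj xi * XW xk wi))))"
    by (rule psum_swap)
  also have "\<dots> = psum (coev C) (\<lambda>wk xk. psum (ucoev C) (\<lambda>yj rj. psum (coev C) (\<lambda>wi xi.
      t (WX w yj * XW x wk) (WX rj xi * XW xk wi))))"
    by (intro psum_cong psum_swap)
  also have "\<dots> = psum (coev C) (\<lambda>wk xk. psum (ucoev C) (\<lambda>yj rj.
      t (WX w (rX C yj (uev C rj xk)) * XW x wk) e))"
    by (simp only: psums(9)[symmetric] WX_XW_coev' t_A bimodule_simps)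
  also have "\<dots> = t (A (uev C w x)) e"
    by (simp only: psums[symmetric] udualX WX_XW_coev')
  finally show ?thesis .
qed

section \<open>The two antipode axioms on the generators of H(\<Omega>^1)\<close>

lemma left_antipode_XW:
  "psum (coev C) (\<lambda>wi xi. psum (ucoev C) (\<lambda>yj rj. t (WX wi yj * XW xi w) (WX rj x)))
    = t e (WX w x)" (is "?l = _")
proof -
  have "?l = psum (ucoev C) (\<lambda>yj rj. psum (coev C) (\<lambda>wi xi. t (WX wi yj * XW xi w) (WX rj x)))"
    by (rule psum_swap)
  also have "\<dots> = t e (WX w x)"
    by (simp only: psums(8)[symmetric] WX_XW_coev t_Aop bimodule_simps)
      (simp only: psums[symmetric] udualW)
  finally show ?thesis .
qed

lemma left_antipode_WX:
  "psum (ucoev C) (\<lambda>yj rj. psum (coev C) (\<lambda>wi xi. t (XW yj wi * WX rj x) (XW xi w)))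
    = t e (XW x w)" (is "?l = _")
proof -
  have "?l = psum (coev C) (\<lambda>wi xi. psum (ucoev C) (\<lambda>yj rj. t (XW yj wi * WX rj x) (XW xi w)))"
    by (rule psum_swap)
  also have "\<dots> = t e (XW x w)"
    by (simp only: psums(8)[symmetric] XW_WX_ucoev' t_Aop bimodule_simps)
      (simp only: psums[symmetric] dualX)
  finally show ?thesis .
qed

lemma right_antipode_XW:
  "psum (coev C) (\<lambda>wi xi. psum (ucoev C) (\<lambda>yj rj. t (WX w yj) (WX rj xi * XW x wi)))
    = t (WX w x) e" (is "?l = _")
proof -
  have "?l = psum (ucoev C) (\<lambda>yj rj. psum (coev C) (\<lambda>wi xi. t (WX w yj) (WX rj xi * XW x wi)))"
    by (rule psum_swap)
  also have "\<dots> = t (WX w x) e"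
    by (simp only: psums(9)[symmetric] WX_XW_coev' t_A bimodule_simps)
      (simp only: psums[symmetric] udualX)
  finally show ?thesis .
qed

lemma right_antipode_WX:
  "psum (ucoev C) (\<lambda>yj rj. psum (coev C) (\<lambda>wi xi. t (XW x wi) (XW xi rj * WX w yj)))
    = t (XW x w) e" (is "?l = _")
proof -
  have "?l = psum (coev C) (\<lambda>wi xi. psum (ucoev C) (\<lambda>yj rj. t (XW x wi) (XW xi rj * WX w yj)))"
    by (rule psum_swap)
  also have "\<dots> = t (XW x w) e"
    by (simp only: psums(9)[symmetric] XW_WX_ucoev t_A bimodule_simps)
      (simp only: psums[symmetric] dualW)
  finally show ?thesis .
qed

text \<open>This and the next two lemmas say, for a generator b, that the bar of
  \<epsilon>(\<open>b\<^sub>(\<^sub>2\<^sub>)\<close> c) times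
  \<open>b\<^sub>(\<^sub>1\<^sub>)\<close> is b times the bar of c: the coefficients are absorbed
  into the first factor and resummed by duality.\<close>

lemma counit_XW: "psum (coev C) (\<lambda>wi xi. Aop (ev C (rX C xi c) w) * XW x wi) = XW x w * Aop c"
  by (simp only: bimodule_rules ev.balanced) (simp only: psums[symmetric] dualW)

lemma counit_WX: "psum (ucoev C) (\<lambda>yj rj. Aop (uev C (rW C rj c) x) * WX w yj) = WX w x * Aop c"
  by (simp only: bimodule_rules uev.balanced) (simp only: psums[symmetric] udualX)

lemma counit_X: "Aop c * Xg x + psum (coev C) (\<lambda>wi xi. Aop (ev C xi (dif C c)) * XW x wi) = Xg x * Aop c"
  by (simp only: bimodule_rules X_Aop) (simp only: psums[symmetric] dualW)

section \<open>Candidates for S(x) and its inverse image, built from a compatible map\<close>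

context
  fixes \<Upsilon> :: "'x \<Rightarrow> 'a"
  assumes compatible: "compatible_map C \<Upsilon>"
begin

lemma Ups_rX: "\<Upsilon> (rX C x a) = \<Upsilon> x * a + ev C x (dif C a)"
  and Ups_lX: "\<Upsilon> (lX C a x) = a * \<Upsilon> x + uev C (dif C a) x"
  and additive_Ups: "additive \<Upsilon>"
proof -
  show "\<Upsilon> (rX C x a) = \<Upsilon> x * a + ev C x (dif C a)" "\<Upsilon> (lX C a x) = a * \<Upsilon> x + uev C (dif C a) x"
    using compatible by (simp_all add: compatible_map_def)
  interpret Vector_Spaces.linear "\<lambda>k. lX C (scl C k 1)" "scl C" \<Upsilon>
    using compatible by (simp add: compatible_map_def)
  show "additive \<Upsilon>" by (simp add: additive_def add)
qed

definition SX :: "'x \<Rightarrow> 'b"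
  where "SX x = - psum (coev C) (\<lambda>wi xi. WX wi x * Xg xi) - Aop (\<Upsilon> x)"

definition TX :: "'x \<Rightarrow> 'b"
  where "TX x = - psum (ucoev C) (\<lambda>yj rj. (Xg yj + A (\<Upsilon> yj)) * WX rj x)"

lemma additive_SX: "additive SX"
  by (simp add: additive_def SX_def adds additive.add[OF additive_Ups] psum_add distrib_right)

lemma additive_TX: "additive TX"
  by (simp add: additive_def TX_def adds psum_add distrib_left)

text \<open>Moving each \<open>Xg xi\<close> past \<open>Aop a\<close> creates
  \<open>XW xi (dif C a)\<close>, and these terms contract to the bar of
  \<open>uev C (dif C a) x\<close>. This defect is what the left rule for \<Upsilon>
  compensates.\<close>

lemma SX_lX: "SX x * Aop a = SX (lX C a x)"
proof -
  have "SX x * Aop a = - psum (coev C) (\<lambda>wi xi. WX wi (lX C a x) * Xg xi + WX wi x * XW xi (dif C a))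
      - Aop (a * \<Upsilon> x)"
    by (simp add: SX_def left_diff_distrib psum_mult_right bimodule_simps X_Aop distrib_left)
  then show ?thesis
    by (simp add: SX_def psum_add WX_XW_coev Ups_lX adds)
qed

text \<open>\<open>Aop a\<close> is absorbed by the factors \<open>WX wi x\<close> without a defect,
  so the evaluation term comes from the right rule for \<Upsilon> alone.\<close>

lemma SX_rX: "Aop a * SX x = SX (rX C x a) + Aop (ev C x (dif C a))"
  by (simp add: SX_def right_diff_distrib psum_mult_left bimodule_simps Ups_rX adds)

text \<open>The \<Upsilon> part commutes with \<open>A a\<close>. In the sum, \<open>a\<close>
  passes from \<open>wi\<close> to \<open>xi\<close> by centrality, and the corrections
  \<open>ev C xi (dif C a)\<close> resum to \<open>dif C a\<close>.\<close>

lemma SX_Aop: "A a * SX x = SX x * A a + WX (dif C a) x"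
proof -
  have "psum (coev C) (\<lambda>wi xi. WX (lW C a wi) x * Xg xi) = psum (coev C) (\<lambda>wi xi. WX wi x * Xg (rX C xi a))"
    by (rule coev_central)
      (simp_all add: additive_def adds distrib_left distrib_right mult.assoc flip: A_X WX_A)
  moreover have "SX x * A a = - psum (coev C) (\<lambda>wi xi. WX wi x * Xg (rX C xi a)
      + WX (rW C wi (ev C xi (dif C a))) x) - Aop (\<Upsilon> x) * A a"
    by (simp add: SX_def left_diff_distrib psum_mult_right bimodule_simps X_A distrib_left)
  moreover have "psum (coev C) (\<lambda>wi xi. WX (rW C wi (ev C xi (dif C a))) x) = WX (dif C a) x"
    by (simp only: psums[symmetric] dualW)
  ultimately show ?thesis
    by (simp add: SX_def right_diff_distrib psum_mult_left bimodule_simps psum_add A_Aop)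
qed

lemma TX_lX: "TX x * Aop a = TX (lX C a x)"
  by (simp add: TX_def psum_mult_right bimodule_simps)

text \<open>The evaluation term arises from moving \<open>Aop a\<close> past \<open>Xg yj\<close>:
  the corrections \<open>XW yj (dif C a) * WX rj x\<close> contract by a relation of
  H(\<Omega>^1).\<close>

lemma TX_rX: "Aop a * TX x = TX (rX C x a) + Aop (ev C x (dif C a))"
proof -
  have comm: "Aop a * Xg y = Xg y * Aop a - XW y (dif C a)" for y
    by (simp add: X_Aop)
  have "Aop a * ((Xg y + A (\<Upsilon> y)) * WX r x)
    = (Xg y + A (\<Upsilon> y)) * WX r (rX C x a) - XW y (dif C a) * WX r x" for y r
  proof -
    have "Aop a * ((Xg y + A (\<Upsilon> y)) * WX r x) = (Aop a * Xg y + Aop a * A (\<Upsilon> y)) * WX r x"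
      by (simp only: distrib_left mult.assoc[symmetric])
    also have "\<dots> = (Xg y * Aop a - XW y (dif C a) + A (\<Upsilon> y) * Aop a) * WX r x"
      by (simp only: comm A_Aop)
    also have "\<dots> = (Xg y + A (\<Upsilon> y)) * (Aop a * WX r x) - XW y (dif C a) * WX r x"
      by (simp add: algebra_simps)
    finally show ?thesis by (simp only: Aop_WX)
  qed
  then show ?thesis
    by (simp add: TX_def psum_mult_left psum_diff XW_WX_ucoev')
qed

text \<open>The derivation term of x a and that of \<Upsilon>(x a) agree, so x + \<Upsilon>(x) is
  right linear over \<open>A\<close>. This is the reason for the shift by \<Upsilon> in the formula
  for the inverse.\<close>

lemma X_Ups_A: "(Xg y + A (\<Upsilon> y)) * A a = Xg (rX C y a) + A (\<Upsilon> (rX C y a))"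
  by (simp add: distrib_right X_A Ups_rX adds A_mult)

text \<open>\<open>X_Ups_A\<close> is the balancedness that \<open>ucoev_central\<close> asks for.
  On the left, y + \<Upsilon>(y) fails to be linear by \<open>uev C (dif C a) y\<close>, and summed
  over the dual basis this failure is the last term.\<close>

lemma TX_Aop: "A a * TX x = TX x * A a + WX (dif C a) x"
proof -
  have "psum (ucoev C) (\<lambda>y r. (Xg (lX C a y) + A (\<Upsilon> (lX C a y))) * WX r x)
    = psum (ucoev C) (\<lambda>y r. (Xg y + A (\<Upsilon> y)) * WX (rW C r a) x)"
    by (rule ucoev_central)
      (simp_all add: additive_def adds additive.add[OF additive_Ups] distrib_left distrib_right
        X_Ups_A[symmetric] mult.assoc flip: A_WX)
  moreover have "(Xg (lX C a y) + A (\<Upsilon> (lX C a y))) * WX r x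
      = A a * ((Xg y + A (\<Upsilon> y)) * WX r x) + WX (lW C (uev C (dif C a) y) r) x" for y r
    by (simp add: Ups_lX adds distrib_left distrib_right flip: A_X A_mult A_WX mult.assoc)
  moreover have "psum (ucoev C) (\<lambda>y r. WX (lW C (uev C (dif C a) y) r) x) = WX (dif C a) x"
    by (simp only: psums[symmetric] udualW)
  ultimately have "psum (ucoev C) (\<lambda>y r. A a * ((Xg y + A (\<Upsilon> y)) * WX r x))
    = psum (ucoev C) (\<lambda>y r. (Xg y + A (\<Upsilon> y)) * WX (rW C r a) x) - WX (dif C a) x"
    by (simp only: psum_add eq_diff_eq)
  then show ?thesis
    by (simp add: TX_def psum_mult_left psum_mult_right mult.assoc WX_A)
qed

lemma WX_XW_collapse:
  "psum (coev C) (\<lambda>wi xi. psum (ucoev C) (\<lambda>yj rj. f yj rj * (WX rj xi * XW x wi)))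
    = psum (ucoev C) (\<lambda>yj rj. f yj rj * A (uev C rj x))"
proof -
  have "psum (coev C) (\<lambda>wi xi. psum (ucoev C) (\<lambda>yj rj. f yj rj * (WX rj xi * XW x wi)))
    = psum (ucoev C) (\<lambda>yj rj. psum (coev C) (\<lambda>wi xi. f yj rj * (WX rj xi * XW x wi)))"
    by (rule psum_swap)
  then show ?thesis
    by (simp only: psums(10)[symmetric] WX_XW_coev')
qed

text \<open>The left side is what an anti-homomorphism with values \<open>TX\<close> makes of the
  formula for S(x). Contraction leaves the sum of (\<open>yj\<close> +
  \<Upsilon>(\<open>yj\<close>)) \<open>uev C rj x\<close>, which is x + \<Upsilon>(x) by right
  linearity.\<close>

lemma TX_SX: "- psum (coev C) (\<lambda>wi xi. TX xi * XW x wi) - A (\<Upsilon> x) = Xg x"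
proof -
  have "psum (coev C) (\<lambda>wi xi. TX xi * XW x wi)
    = - psum (ucoev C) (\<lambda>yj rj. (Xg yj + A (\<Upsilon> yj)) * A (uev C rj x))"
    unfolding WX_XW_collapse[symmetric]
    by (simp add: TX_def psum_mult_right psum_minus mult.assoc)
  also have "\<dots> = - (Xg x + A (\<Upsilon> x))"
    unfolding X_Ups_A psum_add
    by (simp only: psums[symmetric] additive_psum[OF additive_Ups, symmetric] udualX)
  finally show ?thesis by simp
qed

text \<open>The opposite composite. Adding the bar of \<Upsilon> removes it from
  \<open>SX yj\<close>; the remaining double sum contracts to \<open>A (ev C x wi) * Xg xi\<close>,
  which \<open>dualX\<close> resums to x.\<close>

lemma SX_TX: "- psum (ucoev C) (\<lambda>yj rj. XW x rj * (SX yj + Aop (\<Upsilon> yj))) = Xg x"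
proof -
  have "- psum (ucoev C) (\<lambda>yj rj. XW x rj * (SX yj + Aop (\<Upsilon> yj)))
    = psum (ucoev C) (\<lambda>yj rj. psum (coev C) (\<lambda>wi xi. (XW x rj * WX wi yj) * Xg xi))"
    by (simp add: SX_def psum_minus psum_mult_left mult.assoc)
  also have "\<dots> = psum (coev C) (\<lambda>wi xi. psum (ucoev C) (\<lambda>yj rj. (XW x rj * WX wi yj) * Xg xi))"
    by (rule psum_swap)
  also have "\<dots> = Xg x"
    by (simp only: psums(11)[symmetric] XW_WX_ucoev A_X) (simp only: psums[symmetric] dualX)
  finally show ?thesis .
qed

lemma t_SX: "t e (SX x) = - psum (coev C) (\<lambda>wi xi. t e (WX wi x * Xg xi)) - t e (Aop (\<Upsilon> x))"
  by (simp add: SX_def additive.diff[OF additive_t_right] additive.minus[OF additive_t_right] psums)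

lemma right_antipode_collapse:
  "psum (coev C) (\<lambda>wi xi. psum (ucoev C) (\<lambda>yj rj. psum (ucoev C) (\<lambda>yk rk.
      t (f yj rj yk) (g * (WX rk xi * XW x wi)))))
    = psum (ucoev C) (\<lambda>yj rj. psum (ucoev C) (\<lambda>yk rk. t (f yj rj yk) (g * A (uev C rk x))))"
  (is "?l = _")
proof -
  have "?l = psum (ucoev C) (\<lambda>yj rj. psum (coev C) (\<lambda>wi xi. psum (ucoev C) (\<lambda>yk rk.
      t (f yj rj yk) (g * (WX rk xi * XW x wi)))))"
    by (rule psum_swap)
  also have "\<dots> = psum (ucoev C) (\<lambda>yj rj. psum (ucoev C) (\<lambda>yk rk. psum (coev C) (\<lambda>wi xi.
      t (f yj rj yk) (g * (WX rk xi * XW x wi)))))"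
    by (intro psum_cong psum_swap)
  finally show ?thesis
    by (simp only: psums(9,10)[symmetric] WX_XW_coev')
qed

text \<open>The summands are the three terms in the coproduct of x + \<Upsilon>(x), at x =
  \<open>yj\<close>, multiplied by that of \<open>WX rj xi\<close>. The first and the third give -
  T(x) in the left factor, the second gives x in the right factor.\<close>

lemma right_antipode_X:
  "psum (coev C) (\<lambda>wi xi. psum (ucoev C) (\<lambda>yj rj. psum (ucoev C) (\<lambda>yk rk.
      t (Xg yj * WX rj yk) (WX rk xi * XW x wi)
      + psum (coev C) (\<lambda>wl xl. t (XW yj wl * WX rj yk) (Xg xl * (WX rk xi * XW x wi)))
      + t (A (\<Upsilon> yj) * WX rj yk) (WX rk xi * XW x wi))))
    = t e (Xg x) - t (TX x) e" (is "?l = _")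
proof -
  \<comment> \<open>The defect of commuting with \<open>Xg\<close>: it occurs with a minus sign in
    the first sum and a plus sign in the second.\<close>
  define c where "c = psum (ucoev C) (\<lambda>yk rk. t (Aop (ev C yk (dif C (uev C rk x)))) e)"
  \<comment> \<open>Inserts the prefix \<open>g = e\<close> that
    \<open>right_antipode_collapse\<close> expects.\<close>
  have e_mult: "t p (WX r y * q) = t p (e * (WX r y * q))" for p r y q
    by (simp add: bimodule_simps)
  have comm: "Aop a * (Xg y * z) = Xg y * (Aop a * z) - XW y (dif C a) * z" for a y z
    by (simp add: X_Aop[THEN assoc_ext] distrib_right mult.assoc)
  have 1: "psum (coev C) (\<lambda>wi xi. psum (ucoev C) (\<lambda>yj rj. psum (ucoev C) (\<lambda>yk rk.
      t (Xg yj * WX rj yk) (WX rk xi * XW x wi))))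
    = psum (ucoev C) (\<lambda>yj rj. t (Xg yj * WX rj x) e) - c"
  proof -
    have "psum (coev C) (\<lambda>wi xi. psum (ucoev C) (\<lambda>yj rj. psum (ucoev C) (\<lambda>yk rk.
        t (Xg yj * WX rj yk) (WX rk xi * XW x wi))))
      = psum (ucoev C) (\<lambda>yj rj. psum (ucoev C) (\<lambda>yk rk.
          t (Xg yj * WX rj (rX C yk (uev C rk x))) e - t (XW yj (dif C (uev C rk x)) * WX rj yk) e))"
      by (subst e_mult, subst right_antipode_collapse)
        (simp only: e_left t_A comm Aop_WX additive.diff[OF additive_t_left])
    also have "\<dots> = psum (ucoev C) (\<lambda>yj rj. t (Xg yj * WX rj x) e)
      - psum (ucoev C) (\<lambda>yj rj. psum (ucoev C) (\<lambda>yk rk. t (XW yj (dif C (uev C rk x)) * WX rj yk) e))"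
      unfolding psum_diff by (simp only: psums[symmetric] udualX)
    also have "psum (ucoev C) (\<lambda>yj rj. psum (ucoev C) (\<lambda>yk rk. t (XW yj (dif C (uev C rk x)) * WX rj yk) e))
      = psum (ucoev C) (\<lambda>yk rk. psum (ucoev C) (\<lambda>yj rj. t (XW yj (dif C (uev C rk x)) * WX rj yk) e))"
      by (rule psum_swap)
    finally show ?thesis
      by (simp only: psums(8)[symmetric] XW_WX_ucoev' c_def)
  qed
  have 2: "psum (coev C) (\<lambda>wi xi. psum (ucoev C) (\<lambda>yj rj. psum (ucoev C) (\<lambda>yk rk.
      psum (coev C) (\<lambda>wl xl. t (XW yj wl * WX rj yk) (Xg xl * (WX rk xi * XW x wi))))))
    = t e (Xg x) + c" (is "?l2 = _")
  proof -
    have "?l2 = psum (coev C) (\<lambda>wi xi. psum (ucoev C) (\<lambda>yj rj. psum (coev C) (\<lambda>wl xl.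
        psum (ucoev C) (\<lambda>yk rk. t (XW yj wl * WX rj yk) (Xg xl * (WX rk xi * XW x wi))))))"
      by (intro psum_cong psum_swap)
    also have "\<dots> = psum (coev C) (\<lambda>wi xi. psum (coev C) (\<lambda>wl xl. psum (ucoev C) (\<lambda>yj rj.
        psum (ucoev C) (\<lambda>yk rk. t (XW yj wl * WX rj yk) (Xg xl * (WX rk xi * XW x wi))))))"
      by (intro psum_cong psum_swap)
    also have "\<dots> = psum (coev C) (\<lambda>wl xl. psum (coev C) (\<lambda>wi xi. psum (ucoev C) (\<lambda>yj rj.
        psum (ucoev C) (\<lambda>yk rk. t (XW yj wl * WX rj yk) (Xg xl * (WX rk xi * XW x wi))))))"
      by (rule psum_swap)
    also have "\<dots> = psum (coev C) (\<lambda>wl xl. psum (ucoev C) (\<lambda>yj rj. psum (ucoev C) (\<lambda>yk rk.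
        t (XW yj wl * WX rj yk) (Xg xl * A (uev C rk x)))))"
      by (intro psum_cong right_antipode_collapse)
    also have "\<dots> = psum (coev C) (\<lambda>wl xl. psum (ucoev C) (\<lambda>yk rk. psum (ucoev C) (\<lambda>yj rj.
        t (XW yj wl * WX rj yk) (Xg xl * A (uev C rk x)))))"
      by (intro psum_cong psum_swap)
    also have "\<dots> = psum (ucoev C) (\<lambda>yk rk. psum (coev C) (\<lambda>wl xl. psum (ucoev C) (\<lambda>yj rj.
        t (XW yj wl * WX rj yk) (Xg xl * A (uev C rk x)))))"
      by (rule psum_swap)
    also have "\<dots> = psum (ucoev C) (\<lambda>yk rk. psum (coev C) (\<lambda>wl xl.
        t e (Xg (lX C (ev C yk wl) xl) * A (uev C rk x))))"
      by (simp only: psums(8)[symmetric] XW_WX_ucoev' t_Aop bimodule_simps)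
    also have "\<dots> = psum (ucoev C) (\<lambda>yk rk. t e (Xg yk * A (uev C rk x)))"
      by (simp only: psums[symmetric] dualX)
    also have "\<dots> = psum (ucoev C) (\<lambda>yk rk. t e (Xg (rX C yk (uev C rk x)))) + c"
      by (simp only: X_A adds psum_add c_def t_A bimodule_simps)
    also have "\<dots> = t e (Xg x) + c"
      by (simp only: psums[symmetric] udualX)
    finally show ?thesis .
  qed
  \<comment> \<open>No defect here, since \<open>A\<close> and \<open>Aop\<close> commute.\<close>
  have 3: "psum (coev C) (\<lambda>wi xi. psum (ucoev C) (\<lambda>yj rj. psum (ucoev C) (\<lambda>yk rk.
      t (A (\<Upsilon> yj) * WX rj yk) (WX rk xi * XW x wi))))
    = psum (ucoev C) (\<lambda>yj rj. t (A (\<Upsilon> yj) * WX rj x) e)"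
    by (subst e_mult, subst right_antipode_collapse)
      (simp only: e_left t_A A_Aop[THEN assoc_ext, symmetric] mult.assoc[symmetric] A_Aop[symmetric],
       simp only: mult.assoc Aop_WX psums[symmetric] udualX)
  have "t (TX x) e = - psum (ucoev C) (\<lambda>yj rj. t (Xg yj * WX rj x) e)
      - psum (ucoev C) (\<lambda>yj rj. t (A (\<Upsilon> yj) * WX rj x) e)"
    by (simp add: TX_def additive.minus[OF additive_t_left] additive.diff[OF additive_t_left]
        psums distrib_right adds psum_add)
  then show ?thesis
    by (simp add: psum_add 1 2 3)
qed

end

end

section \<open>Normal forms\<close>

text \<open>One fixed linear choice of coset representatives for a subspace \<open>V\<close>: two
  elements are congruent modulo \<open>V\<close> exactly when their projections are equal.\<close>

definition proj_along :: "('w::monoid_add \<Rightarrow>\<^sub>0 'k::field) set \<Rightarrow> ('w \<Rightarrow>\<^sub>0 'k) \<Rightarrow> ('w \<Rightarrow>\<^sub>0 'k)"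
  where "proj_along V = (SOME P. additive P \<and> (\<forall>k f. P (const k * f) = const k * P f) \<and>
    (\<forall>f. P f = 0 \<longleftrightarrow> f \<in> V) \<and> (\<forall>f. P f - f \<in> V))"

lemma proj_along:
  fixes V :: "('w::monoid_add \<Rightarrow>\<^sub>0 'k::field) set"
  assumes "0 \<in> V" "\<And>f g. f \<in> V \<Longrightarrow> g \<in> V \<Longrightarrow> f + g \<in> V" "\<And>k f. f \<in> V \<Longrightarrow> const k * f \<in> V"
  shows "additive (proj_along V)" "proj_along V (const k * f) = const k * proj_along V f"
    "proj_along V f = 0 \<longleftrightarrow> f \<in> V" "proj_along V f - f \<in> V"
proof -
  have "\<exists>P. additive P \<and> (\<forall>k f. P (const k * f) = const k * P f) \<and>
    (\<forall>f. P f = 0 \<longleftrightarrow> f \<in> V) \<and> (\<forall>f. P f - f \<in> V)"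
    using projection_exists[of V, OF assms] by metis
  from someI_ex[OF this]
  show "additive (proj_along V)" "proj_along V (const k * f) = const k * proj_along V f"
    "proj_along V f = 0 \<longleftrightarrow> f \<in> V" "proj_along V f - f \<in> V"
    unfolding proj_along_def by auto
qed

abbreviation HX_nf ::
    "('k::field, 'a::{ring,monoid_mult}, 'w::ab_group_add, 'x::ab_group_add) calculus \<Rightarrow>
     ('k, 'a, 'w, 'x) expr \<Rightarrow> ('k, 'a, 'w, 'x) expr"
  where "HX_nf C \<equiv> proj_along (HX_ideal C)"

abbreviation tens_nf ::
    "('k::field, 'a::{ring,monoid_mult}, 'w::ab_group_add, 'x::ab_group_add) calculus \<Rightarrow>
     (('a, 'w, 'x) generator, 'k) expr2 \<Rightarrow> (('a, 'w, 'x) generator, 'k) expr2"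
  where "tens_nf C \<equiv> proj_along (tensor_kernel C)"

lemmas HX_nf = proj_along[of "HX_ideal C" for C, OF relation_ideal_zero relation_ideal_add
    relation_ideal_mult_left]

lemmas tens_nf = proj_along[of "tensor_kernel C" for C, OF tensor_kernel.zero tensor_kernel.add
    tensor_kernel_const]

lemma HX_nf_eq_iff: "HX_nf C f = HX_nf C g \<longleftrightarrow> f - g \<in> HX_ideal C"
  using HX_nf(3)[of C "f - g"] by (simp add: additive.diff[OF HX_nf(1)])

lemma tens_nf_eq_iff: "tens_nf C m = tens_nf C n \<longleftrightarrow> m - n \<in> tensor_kernel C"
  using tens_nf(3)[of C "m - n"] by (simp add: additive.diff[OF tens_nf(1)])

lemma HX_nf_mult_nf: "HX_nf C (f * HX_nf C g) = HX_nf C (f * g)"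
  unfolding HX_nf_eq_iff right_diff_distrib[symmetric]
  by (intro relation_ideal_mult_left HX_nf(4))

text \<open>The action of \<open>HX\<close> on itself, transported to the free algebra, so that identities in the
  quotient \<open>HX\<close> become equations between elements of a type.\<close>

definition HX_act ::
    "('k::field, 'a::{ring,monoid_mult}, 'w::ab_group_add, 'x::ab_group_add) calculus \<Rightarrow>
     ('k, 'a, 'w, 'x) expr \<Rightarrow> ('k, 'a, 'w, 'x) expr endo"
  where "HX_act C f = Endo (\<lambda>v. HX_nf C (f * v))"

text \<open>\<open>HX_act C f\<close> has the value \<open>HX_nf C f\<close> at 1, so evaluation
  recovers f modulo the ideal. The map is thereby defined and biadditive on all endomorphisms, as
  the model requires, and not only on those that come from \<open>HX\<close>.\<close>

definition tens_act ::
    "('k::field, 'a::{ring,monoid_mult}, 'w::ab_group_add, 'x::ab_group_add) calculus \<Rightarrow>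
     ('k, 'a, 'w, 'x) expr endo \<Rightarrow> ('k, 'a, 'w, 'x) expr endo \<Rightarrow> (('a, 'w, 'x) generator, 'k) expr2"
  where "tens_act C p q = tens_nf C (tens (endo_app p 1) (endo_app q 1))"

lemma endo_app_HX_act [simp]: "endo_app (HX_act C f) v = HX_nf C (f * v)"
  by (simp add: HX_act_def endo_app_Endo additive_def distrib_left additive.add[OF HX_nf(1)])

lemma HX_act_eq_iff: "HX_act C f = HX_act C g \<longleftrightarrow> f - g \<in> HX_ideal C"
proof
  assume "HX_act C f = HX_act C g"
  then have "endo_app (HX_act C f) 1 = endo_app (HX_act C g) 1" by simp
  then show "f - g \<in> HX_ideal C" by (simp add: HX_nf_eq_iff)
qed (auto intro!: endo_eqI simp: HX_nf_eq_iff relation_ideal_mult_right simp flip: left_diff_distrib)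

lemma HX_class_eq_act: "HX_class C f = HX_class C g \<longleftrightarrow> HX_act C f = HX_act C g"
  by (simp add: HX_class_eq_iff HX_act_eq_iff)

lemma additive_HX_act: "additive (HX_act C)"
  by (rule additive.intro, rule endo_eqI) (simp add: distrib_right additive.add[OF HX_nf(1)])

lemma HX_act_mult: "HX_act C (f * g) = HX_act C f * HX_act C g"
  by (rule endo_eqI) (simp add: HX_nf_mult_nf mult.assoc)

lemma HX_act_rel: "HX_rel C u v \<Longrightarrow> HX_act C u = HX_act C v"
  by (simp add: HX_act_eq_iff relation_ideal_rel)

lemmas HX_act_simps = HX_act_mult additive.add[OF additive_HX_act] additive.diff[OF additive_HX_act]
  additive.minus[OF additive_HX_act] additive_psum[OF additive_HX_act]

text \<open>\<open>HX_act C 1\<close> is the projection \<open>HX_nf C\<close>; it is neutral for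
  the image of \<open>HX_act\<close> but differs from 1 as soon as the ideal is nonzero.\<close>

lemma HX_act_one: "HX_act C 1 * HX_act C f = HX_act C f" "HX_act C f * HX_act C 1 = HX_act C f"
  "HX_act C 1 * (HX_act C f * z) = HX_act C f * z"
  by (simp_all flip: HX_act_mult mult.assoc)

lemma HX_act_scalar_commute: "HX_act C f * HX_act C (scalar k) = HX_act C (scalar k) * HX_act C f"
  by (simp add: scalar_def const_commute flip: HX_act_mult)

lemma tens_nf_tens: "tens_nf C (tens f g) = tens_act C (HX_act C f) (HX_act C g)"
proof -
  have "f - HX_nf C f \<in> HX_ideal C" for f
    using relation_ideal_uminus[OF HX_nf(4)[of C f]] by simp
  then show ?thesis
    by (simp add: tens_act_def tens_nf_eq_iff tens_cong)
qed

lemma tens_act_scalar: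
  "tens_act C (HX_act C (scalar k) * HX_act C f) (HX_act C g) = const k * tens_act C (HX_act C f) (HX_act C g)"
  "tens_act C (HX_act C f) (HX_act C (scalar k) * HX_act C g) = const k * tens_act C (HX_act C f) (HX_act C g)"
  by (simp_all add: tens_scalar tens_nf(2) flip: HX_act_mult tens_nf_tens)

lemmas tens_nf_simps = additive.add[OF tens_nf(1)] additive.diff[OF tens_nf(1)]
  additive.minus[OF tens_nf(1)] additive_psum[OF tens_nf(1)] tens_nf_tens tens_nf(2)

lemma HX_rel_intros:
  "enveloping_rel C u v \<Longrightarrow> HX_rel C u v"
  "tensor_algebra_rel C u v \<Longrightarrow> HX_rel C u v"
  by (auto intro: HX_rel.H H_rel.tensor_algebra tensor_algebra_rel.enveloping)

context pivotal_calculus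
begin

abbreviation (input) act where "act \<equiv> HX_act C"

lemmas enveloping_act = enveloping_rel.intros[of C, THEN HX_rel_intros(1), THEN HX_act_rel]
lemmas tensor_act = tensor_algebra_rel.intros(2-)[of C, THEN HX_rel_intros(2), THEN HX_act_rel]
lemmas H_act = H_rel.intros(2-)[of C, THEN HX_rel.H, THEN HX_act_rel, folded psum_def]
lemmas X_act = HX_rel.intros(2-)[of C, THEN HX_act_rel]

lemma unit_act: "act (iA 1) = act 1" "act (iAop 1) = act 1"
  by (rule enveloping_act)+

text \<open>The relation with four scalars is specialised by setting three of them to 1, which act
  as units.\<close>

lemma XW_bimodule_act:
  "act (iA a) * act (iXW x w) = act (iXW (lX C a x) w)"
  "act (iXW x w) * act (iA a) = act (iXW (rX C x a) w)"
  "act (iAop a) * act (iXW x w) = act (iXW x (rW C w a))"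
  "act (iXW x w) * act (iAop a) = act (iXW x (lW C a w))"
  using tensor_act(5)[of a 1 x w 1 1] tensor_act(5)[of 1 1 x w a 1]
    tensor_act(5)[of 1 a x w 1 1] tensor_act(5)[of 1 1 x w 1 a]
  by (simp_all add: HX_act_simps unit_act HX_act_one X.l_one X.r_one W.l_one W.r_one mult.assoc)

lemma WX_bimodule_act:
  "act (iA a) * act (iWX w x) = act (iWX (lW C a w) x)"
  "act (iWX w x) * act (iA a) = act (iWX (rW C w a) x)"
  "act (iAop a) * act (iWX w x) = act (iWX w (rX C x a))"
  "act (iWX w x) * act (iAop a) = act (iWX w (lX C a x))"
  using tensor_act(10)[of a 1 w x 1 1] tensor_act(10)[of 1 1 w x a 1]
    tensor_act(10)[of 1 a w x 1 1] tensor_act(10)[of 1 1 w x 1 a]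
  by (simp_all add: HX_act_simps unit_act HX_act_one X.l_one X.r_one W.l_one W.r_one mult.assoc)

lemma tens_act_balanced: "tens_act C (act (iAop s) * p) q = tens_act C p (act (iA s) * q)"
proof -
  let ?p = "endo_app p 1" and ?q = "endo_app q 1"
  have "tens (HX_nf C (iAop s * ?p)) ?q - tens (iAop s * ?p) ?q \<in> tensor_kernel C"
    "tens ?p (iA s * ?q) - tens ?p (HX_nf C (iA s * ?q)) \<in> tensor_kernel C"
    using relation_ideal_uminus[OF HX_nf(4)[of C "iA s * ?q"]]
    by (auto intro!: tens_cong HX_nf(4) simp: relation_ideal_zero)
  from tensor_kernel.add[OF tensor_kernel.add[OF this(1) tensor_kernel.balanced[of s ?p ?q]] this(2)]
  show ?thesis
    by (simp add: tens_act_def tens_nf_eq_iff)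
qed

end

text \<open>From here on every calculation of the model is a statement about classes in
  \<open>HX\<close> and in its diamond.\<close>

sublocale pivotal_calculus \<subseteq> M: HX_model C "HX_act C 1" "\<lambda>a. HX_act C (iA a)" "\<lambda>a. HX_act C (iAop a)"
  "\<lambda>x w. HX_act C (iXW x w)" "\<lambda>w x. HX_act C (iWX w x)" "\<lambda>x. HX_act C (iX x)" "tens_act C"
proof (intro HX_model.intro HX_model_axioms.intro pivotal_calculus_axioms)
  show "additive (\<lambda>a. act (iA a))" "additive (\<lambda>a. act (iAop a))" "additive (\<lambda>x. act (iX x))"
    "additive (\<lambda>x. act (iXW x w))" "additive (\<lambda>w. act (iXW x w))"
    "additive (\<lambda>w. act (iWX w x))" "additive (\<lambda>x. act (iWX w x))" for w x
    by (rule additive.intro, simp only: enveloping_act(1,5) tensor_act(1,2,6,7) X_act(1) HX_act_simps)+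
  show "act (iA a) * act (iA b) = act (iA (a * b))" "act (iAop a) * act (iAop b) = act (iAop (b * a))"
    "act (iA a) * act (iAop b) = act (iAop b) * act (iA a)" for a b
    by (simp_all only: enveloping_act(4,8,9) flip: HX_act_mult)
  show "psum (coev C) (\<lambda>wi xi. act (iWX wi x) * act (iXW xi w)) = act (iAop (uev C w x))"
    "psum (ucoev C) (\<lambda>yj rj. act (iXW x rj) * act (iWX w yj)) = act (iA (ev C x w))"
    "psum (ucoev C) (\<lambda>yj rj. act (iXW yj w) * act (iWX rj x)) = act (iAop (ev C x w))"
    "psum (coev C) (\<lambda>wi xi. act (iWX w xi) * act (iXW x wi)) = act (iA (uev C w x))" for w x
    by (rule H_act[unfolded HX_act_simps])+
  show "act (iA a) * act (iX x) = act (iX (lX C a x))"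
    "act (iX x) * act (iA a) = act (iX (rX C x a)) + act (iA (ev C x (dif C a)))"
    "act (iX x) * act (iAop a) = act (iAop a) * act (iX x) + act (iXW x (dif C a))" for a x
    by (rule X_act(3-5)[unfolded HX_act_simps])+
  show "additive (\<lambda>p. tens_act C p q)" "additive (tens_act C p)" for p q
    by (simp_all add: additive_def tens_act_def additive.add[OF additive_tens_left]
        additive.add[OF additive_tens_right] additive.add[OF tens_nf(1)])
qed (rule HX_act_one XW_bimodule_act WX_bimodule_act tens_act_balanced)+


section \<open>The coproduct descends to the quotient\<close>

context pivotal_calculus
begin

lemma cop_generators:
  "cop C (iA a) = tens (iA a) 1"
  "cop C (iAop a) = tens 1 (iAop a)"
  "cop C (iXW x w) = psum (coev C) (\<lambda>wi xi. tens (iXW x wi) (iXW xi w))"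
  "cop C (iWX w x) = psum (ucoev C) (\<lambda>yj rj. tens (iWX w yj) (iWX rj x))"
  "cop C (iX x) = tens (iX x) 1 + psum (coev C) (\<lambda>wi xi. tens (iXW x wi) (iX xi))"
  by (simp_all add: cop_gen cop_gen_def psum_def comp_def case_prod_unfold)

lemmas cop_simps = cop_generators cop_mult additive.add[OF additive_cop] additive.diff[OF additive_cop]
  additive.minus[OF additive_cop] additive_psum[OF additive_cop] cop_scalar

lemmas expand_simps = cop_simps psum_mult_right psum_mult_left distrib_left distrib_right tens_mult
  tens_nf_simps psum_add HX_act_simps mult.assoc

lemma tensor_kernel_mult_pure:
  assumes "i \<in> HX_ideal C"
  shows "n * tens i q \<in> tensor_kernel C" "n * tens q i \<in> tensor_kernel C"
proof -
  show "n * tens i q \<in> tensor_kernel C"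
    by (induction n rule: expr2_induct)
      (simp_all add: tens_mult distrib_right tensor_kernel.add tensor_kernel.left relation_ideal_mult_left assms)
  show "n * tens q i \<in> tensor_kernel C"
    by (induction n rule: expr2_induct)
      (simp_all add: tens_mult distrib_right tensor_kernel.add tensor_kernel.right relation_ideal_mult_left assms)
qed

lemma cop_gen_balanced:
  "cop C (gen g) * (tens (iAop s * p) q - tens p (iA s * q)) \<in> tensor_kernel C"
proof -
  have "tens_nf C (cop C (gen g) * tens (iAop s * p) q) = tens_nf C (cop C (gen g) * tens p (iA s * q))"
  proof (cases g)
    case (GA a)
    then show ?thesis by (simp add: expand_simps M.takeuchi_A)
  next
    case (GAop a)
    then show ?thesis by (simp add: expand_simps M.takeuchi_Aop)
  next
    case (GXW x w)
    then show ?thesis by (simp add: expand_simps M.takeuchi_XW)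
  next
    case (GWX w x)
    then show ?thesis by (simp add: expand_simps M.takeuchi_WX)
  next
    case (GX x)
    then show ?thesis using M.takeuchi_X[of x s "act p" "act q"] by (simp add: expand_simps)
  qed
  then show ?thesis
    by (simp add: tens_nf_eq_iff right_diff_distrib)
qed

text \<open>The values of \<open>cop C\<close> satisfy the Takeuchi condition. It is stable under
  products, because one factor after the other can act on \<open>m\<close>; hence the generators
  suffice.\<close>

lemma cop_tensor_kernel: "m \<in> tensor_kernel C \<Longrightarrow> cop C f * m \<in> tensor_kernel C"
proof (induction f arbitrary: m rule: free_algebra_induct)
  case (scalar k)
  then show ?case by (simp add: cop_scalar tensor_kernel_const)
next
  case (gen g)
  then show ?case
    by (induction rule: tensor_kernel.induct)
      (simp_all add: distrib_left tensor_kernel.intros tensor_kernel_mult_pure cop_gen_balanced)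
next
  case (add f g)
  then show ?case by (simp add: cop_simps distrib_right tensor_kernel.add)
next
  case (mult f g)
  then show ?case by (simp add: cop_mult mult.assoc)
qed

lemma cop_enveloping_rel: "enveloping_rel C u v \<Longrightarrow> tens_nf C (cop C u) = tens_nf C (cop C v)"
  by (induction rule: enveloping_rel.induct)
    (simp_all add: expand_simps M.adds enveloping_act(1-8)[unfolded HX_act_simps] tens_act_scalar unit_act
      flip: tens_one)

lemma cop_tensor_algebra_rel: "tensor_algebra_rel C u v \<Longrightarrow> tens_nf C (cop C u) = tens_nf C (cop C v)"
proof (induction rule: tensor_algebra_rel.induct)
  case (enveloping u v)
  then show ?case by (rule cop_enveloping_rel)
qed (simp_all add: expand_simps M.adds tensor_act[unfolded HX_act_simps] tens_act_scalar
    M.bimodule_simps X.l_r_commute W.l_r_commute)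

lemma cop_H_rel: "H_rel C u v \<Longrightarrow> tens_nf C (cop C u) = tens_nf C (cop C v)"
proof (induction rule: H_rel.induct)
  case (tensor_algebra u v)
  then show ?case by (rule cop_tensor_algebra_rel)
next
  case (WX_XW_coev x w)
  \<comment> \<open>The lemma \<open>M.cop_WX_XW\<close> leaves one sum in the second factor, to
    which the same relation applies.\<close>
  have "psum (coev C) (\<lambda>wk xk. tens_act C (act 1) (act (iWX wk x) * act (iXW xk w)))
    = tens_act C (act 1) (act (iAop (uev C w x)))"
    by (simp only: M.psums(9)[symmetric] M.WX_XW_coev)
  \<comment> \<open>Distributing the left coproduct before the right one fixes the nesting of the
    three sums as in the lemma of the model.\<close>
  with M.cop_WX_XW[of x "\<lambda>x. act (iXW x w)"] show ?case
    unfolding psum_def[symmetric]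
    by (simp only: cop_simps psum_mult_right) (simp only: psum_mult_left, simp add: expand_simps)
next
  case (XW_WX_ucoev x w)
  from M.cop_XW_WX[of x w] show ?case
    unfolding psum_def[symmetric]
    by (simp only: cop_simps psum_mult_right) (simp only: psum_mult_left, simp add: expand_simps)
next
  case (XW_WX_ucoev' w x)
  from M.cop_XW_WX'[of w x] show ?case
    unfolding psum_def[symmetric]
    by (simp only: cop_simps psum_mult_right) (simp only: psum_mult_left, simp add: expand_simps)
next
  case (WX_XW_coev' w x)
  from M.cop_WX_XW'[of w x] show ?case
    unfolding psum_def[symmetric]
    by (simp only: cop_simps psum_mult_right) (simp only: psum_mult_left, simp add: expand_simps)
qed

lemma cop_HX_rel: "HX_rel C u v \<Longrightarrow> tens_nf C (cop C u) = tens_nf C (cop C v)"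
proof (induction rule: HX_rel.induct)
  case (H u v)
  then show ?case by (rule cop_H_rel)
qed (simp_all add: expand_simps M.adds X_act[unfolded HX_act_simps] tens_act_scalar M.bimodule_simps
    M.X_A M.X_Aop tensor_act[unfolded HX_act_simps])

text \<open>The preimage of the kernel is a two-sided ideal although the kernel is only a right
  ideal: for \<open>h * f\<close> the left factor is a coproduct.\<close>

lemma cop_HX_ideal:
  assumes "f \<in> HX_ideal C"
  shows "cop C f \<in> tensor_kernel C"
proof -
  have "f \<in> {f. cop C f \<in> tensor_kernel C}"
    using assms
    by (rule relation_ideal_minimal)
      (auto simp: cop_simps additive.zero[OF additive_cop] cop_HX_rel cop_tensor_kernel
        tensor_kernel_mult_right tens_nf_eq_iff[symmetric] intro: tensor_kernel.intros)
  then show ?thesis by simp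
qed

lemma comult_HX:
  "comult (HX C) (HX_class C f) = diamond_class (HX_ae_ring C) (comult_expr C f)"
proof -
  have "diamond_class (HX_ae_ring C) (comult_expr C f') = diamond_class (HX_ae_ring C) (comult_expr C f)"
    if "f' \<in> HX_class C f" for f'
  proof -
    have "f' - f \<in> HX_ideal C"
      using that by (simp add: in_HX_class_iff)
    then have "cop C f' - cop C f \<in> tensor_kernel C"
      unfolding additive.diff[OF additive_cop, symmetric] by (rule cop_HX_ideal)
    from tensor_kernel_diff[OF tensor_kernel.add[OF to_tens_comult_expr[of C f'] this] to_tens_comult_expr[of C f]]
    have "to_tens (comult_expr C f') - to_tens (comult_expr C f) \<in> tensor_kernel C"
      by (simp only: diff_add_cancel diff_diff_eq2 add_diff_eq)
    then show ?thesis
      by (subst diamond_class_HX_eq_iff) (rule comult_expr_carrier)+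
  qed
  moreover have "f \<in> HX_class C f"
    by (simp add: in_HX_class_iff relation_ideal_zero)
  ultimately show ?thesis
    unfolding HX_fields by (intro the_elem_image_unique) blast+
qed

text \<open>Whatever representative \<open>sweedler\<close> picks, it differs from
  \<open>comult_expr\<close> by a diamond relation, so it may be replaced by
  \<open>cop C f\<close>.\<close>

lemma sweedler_HX:
  "sweedler (HX C) (HX_class C f) \<in> carrier (formal_sums (HX_ae_ring C))"
  "to_tens (sweedler (HX C) (HX_class C f)) - cop C f \<in> tensor_kernel C"
proof -
  let ?s = "sweedler (HX C) (HX_class C f)"
  have "comult_expr C f \<in> diamond_class (HX_ae_ring C) (comult_expr C f)"
    by (simp add: HX.in_diamond_class_iff HX.diamond_kernel_zero)
  then have "?s \<in> diamond_class (HX_ae_ring C) (comult_expr C f)"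
    unfolding sweedler_def comult_HX by (rule someI)
  then have *: "?s - comult_expr C f \<in> diamond_kernel (HX_ae_ring C)"
    by (simp add: HX.in_diamond_class_iff)
  from HX.carrier_formal_sums_closed(2)[OF HX.diamond_kernel_carrier[OF *] comult_expr_carrier[of C f]]
  show "?s \<in> carrier (formal_sums (HX_ae_ring C))" by simp
  from tensor_kernel.add[OF to_tens_diamond_kernel[OF *] to_tens_comult_expr[of C f]]
  show "to_tens ?s - cop C f \<in> tensor_kernel C"
    by (simp add: additive.diff[OF additive_to_tens])
qed

end

section \<open>The counit\<close>

text \<open>The counit is obtained from the action \<open>b \<cdot> c = \<epsilon>(b c)\<close> of \<open>HX\<close> on \<open>A\<close>.\<close>

fun counit_gen ::
    "('k::field, 'a::{ring,monoid_mult}, 'w::ab_group_add, 'x::ab_group_add) calculus \<Rightarrow>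
     ('a, 'w, 'x) generator \<Rightarrow> 'a endo"
  where
    "counit_gen C (GA a) = Endo (\<lambda>c. a * c)"
  | "counit_gen C (GAop a) = Endo (\<lambda>c. c * a)"
  | "counit_gen C (GXW x w) = Endo (\<lambda>c. ev C (rX C x c) w)"
  | "counit_gen C (GWX w x) = Endo (\<lambda>c. uev C (rW C w c) x)"
  | "counit_gen C (GX x) = Endo (\<lambda>c. ev C x (dif C c))"

definition counit_act ::
    "('k::field, 'a::{ring,monoid_mult}, 'w::ab_group_add, 'x::ab_group_add) calculus \<Rightarrow>
     ('k, 'a, 'w, 'x) expr \<Rightarrow> 'a endo"
  where "counit_act C = lin_ext (\<lambda>k. Endo (scl C k)) (word_prod (counit_gen C))"

definition counit ::
    "('k::field, 'a::{ring,monoid_mult}, 'w::ab_group_add, 'x::ab_group_add) calculus \<Rightarrow>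
     ('k, 'a, 'w, 'x) expr \<Rightarrow> 'a"
  where "counit C f = endo_app (counit_act C f) 1"

context pivotal_calculus
begin

sublocale alg: unital_algebra "scl C" by (rule algebra)

lemma scl_eq_mult: "scl C k a = scl C k 1 * a"
  using alg.scl_mult_left[of k 1 a] by simp

lemmas scl_out = alg.scl_mult_left[symmetric] alg.scl_mult_right[symmetric]

lemma additive_scl: "additive (scl C k)"
  by (simp add: additive_def alg.scale_right_distrib)

lemma additive_dif: "additive (dif C)"
proof -
  interpret Vector_Spaces.linear "scl C" "\<lambda>k. lW C (scl C k 1)" "dif C"
    by (rule dif_linear)
  show ?thesis by (simp add: additive_def add)
qed

lemma dif_scl: "dif C (scl C k a) = lW C (scl C k 1) (dif C a)"
proof -
  interpret Vector_Spaces.linear "scl C" "\<lambda>k. lW C (scl C k 1)" "dif C"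
    by (rule dif_linear)
  show ?thesis by (rule scale)
qed

lemma counit_gen_app:
  "endo_app (counit_gen C (GA a)) c = a * c"
  "endo_app (counit_gen C (GAop a)) c = c * a"
  "endo_app (counit_gen C (GXW x w)) c = ev C (rX C x c) w"
  "endo_app (counit_gen C (GWX w x)) c = uev C (rW C w c) x"
  "endo_app (counit_gen C (GX x)) c = ev C x (dif C c)"
  by (simp_all add: endo_app_Endo additive_def distrib_left distrib_right X.r_add_right W.r_add_right
      ev.add_left uev.add_left ev.add_right additive.add[OF additive_dif])

lemma endo_app_scl: "endo_app (Endo (scl C k)) c = scl C k c"
  by (simp add: endo_app_Endo additive_scl)

lemma ev_scl_left: "ev C (rX C (lX C (scl C k 1) x) c) w = scl C k (ev C (rX C x c) w)"
  and ev_scl_right: "ev C x (lW C (scl C k 1) w) = scl C k (ev C x w)"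
  and uev_scl_left: "uev C (rW C (lW C (scl C k 1) w) c) x = scl C k (uev C (rW C w c) x)"
  and uev_scl_right: "uev C w (lX C (scl C k 1) x) = scl C k (uev C w x)"
  and ev_scl: "ev C (lX C (scl C k 1) x) w = scl C k (ev C x w)"
  and uev_scl: "uev C (lW C (scl C k 1) w) x = scl C k (uev C w x)"
proof -
  show "ev C (rX C (lX C (scl C k 1) x) c) w = scl C k (ev C (rX C x c) w)"
    "uev C (rW C (lW C (scl C k 1) w) c) x = scl C k (uev C (rW C w c) x)"
    "ev C (lX C (scl C k 1) x) w = scl C k (ev C x w)"
    "uev C (lW C (scl C k 1) w) x = scl C k (uev C w x)"
    unfolding scl_eq_mult[of k "ev C _ _"] scl_eq_mult[of k "uev C _ _"]
    by (simp_all add: ev.map_left uev.map_left flip: X.l_r_commute W.l_r_commute)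
  show "ev C x (lW C (scl C k 1) w) = scl C k (ev C x w)"
    "uev C w (lX C (scl C k 1) x) = scl C k (uev C w x)"
    unfolding scl_eq_mult[of k "ev C _ _"] scl_eq_mult[of k "uev C _ _"]
    by (simp_all only: ev.balanced[symmetric] uev.balanced[symmetric] X.scl_central[symmetric]
        W.scl_central[symmetric] ev.map_left uev.map_left)
qed

lemma rX_scl: "rX C x (scl C k c) = lX C (scl C k 1) (rX C x c)"
  and rW_scl: "rW C w (scl C k c) = lW C (scl C k 1) (rW C w c)"
  by (simp_all only: scl_eq_mult[of k c] X.r_assoc X.l_r_commute X.scl_central
      W.r_assoc W.l_r_commute W.scl_central)

lemma counit_gen_scl: "counit_gen C g * Endo (scl C k) = Endo (scl C k) * counit_gen C g"
  by (rule endo_eqI, cases g)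
    (simp_all add: counit_gen_app endo_app_scl scl_out rX_scl rW_scl
      ev_scl uev_scl ev_scl_right dif_scl del: counit_gen.simps)

lemma additive_counit_act: "additive (counit_act C)"
  and counit_act_mult: "counit_act C (f * g) = counit_act C f * counit_act C g"
  and counit_act_gen: "counit_act C (gen h) = counit_gen C h"
  and counit_act_scalar: "counit_act C (scalar k) = Endo (scl C k)"
  and counit_act_one: "counit_act C 1 = 1"
proof -
  have additive: "additive (\<lambda>k. Endo (scl C k))"
    by (rule additive.intro, rule endo_eqI) (simp add: endo_app_scl alg.scale_left_distrib)
  have mult: "Endo (scl C (j * k)) = Endo (scl C j) * Endo (scl C k)" for j k
    by (rule endo_eqI) (simp add: endo_app_scl)
  show "additive (counit_act C)"
    unfolding counit_act_def by (rule additive_lin_ext[OF additive])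
  show "counit_act C (f * g) = counit_act C f * counit_act C g"
    unfolding counit_act_def
    by (rule lin_ext_mult[OF additive mult]) (rule word_prod_commute counit_gen_scl word_prod_simps)+
  have one: "Endo (scl C 1) = 1"
    by (rule endo_eqI) (simp add: endo_app_scl)
  show "counit_act C (gen h) = counit_gen C h"
    by (simp add: counit_act_def gen_def lin_ext_single[OF additive] one)
  show scalar: "counit_act C (scalar k) = Endo (scl C k)" for k
    by (simp add: counit_act_def scalar_def lin_ext_single[OF additive])
  show "counit_act C 1 = 1"
    using scalar[of 1] one by (simp add: scalar_def)
qed

lemma endo_app_psum: "endo_app (psum xs f) c = psum xs (\<lambda>u v. endo_app (f u v) c)"
  by (rule additive_psum[of "\<lambda>f. endo_app f c"]) (simp add: additive_def)

lemmas counit_simps = additive.add[OF additive_counit_act] additive_psum[OF additive_counit_act]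
  counit_act_mult counit_act_gen counit_act_scalar counit_act_one counit_gen_app endo_app_psum
  endo_app_scl

lemma additive_pairings:
  "additive (\<lambda>x. ev C x w)" "additive (ev C x)" "additive (\<lambda>w. uev C w x)" "additive (uev C w)"
  by (simp_all add: additive_def ev.add_left ev.add_right uev.add_left uev.add_right)

section \<open>The action on \<open>A\<close> respects the defining relations\<close>

lemma counit_enveloping_rel: "enveloping_rel C u v \<Longrightarrow> counit_act C u = counit_act C v"
proof (rule endo_eqI)
  fix c
  assume "enveloping_rel C u v"
  then show "endo_app (counit_act C u) c = endo_app (counit_act C v) c"
    by (induction rule: enveloping_rel.induct)
      (simp_all add: counit_simps algebra_simps scl_out
        del: counit_gen.simps)
qed

lemma counit_tensor_algebra_rel: "tensor_algebra_rel C u v \<Longrightarrow> counit_act C u = counit_act C v"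
proof (induction rule: tensor_algebra_rel.induct)
  case (enveloping u v)
  then show ?case by (rule counit_enveloping_rel)
next
  case (XW_bimodule a a' x w b b')
  show ?case
    by (rule endo_eqI) (simp add: counit_simps ev.map_left ev.map_right ev.balanced X.r_assoc
        W.l_r_commute mult.assoc del: counit_gen.simps flip: X.l_r_commute)
next
  case (WX_bimodule a a' w x b b')
  show ?case
    by (rule endo_eqI) (simp add: counit_simps uev.map_left uev.map_right uev.balanced W.r_assoc
        X.l_r_commute mult.assoc del: counit_gen.simps flip: W.l_r_commute)
qed (rule endo_eqI, simp add: counit_simps X.r_add_left W.r_add_left ev.add_left ev.add_right
    uev.add_left uev.add_right ev_scl_left ev_scl_right uev_scl_left uev_scl_right
    del: counit_gen.simps)+

lemma counit_H_rel: "H_rel C u v \<Longrightarrow> counit_act C u = counit_act C v"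
proof (induction rule: H_rel.induct)
  case (tensor_algebra u v)
  then show ?case by (rule counit_tensor_algebra_rel)
next
  case (WX_XW_coev x w)
  show ?case
    unfolding psum_def[symmetric]
    by (rule endo_eqI, simp add: counit_simps ev.balanced del: counit_gen.simps)
      (simp add: dualW uev.map_left flip: additive_psum[OF additive_pairings(3)])
next
  case (XW_WX_ucoev x w)
  show ?case
    unfolding psum_def[symmetric]
    by (rule endo_eqI, simp add: counit_simps ev.balanced del: counit_gen.simps)
      (simp add: udualW ev.map_right flip: additive_psum[OF additive_pairings(2)])
next
  case (XW_WX_ucoev' w x)
  show ?case
    unfolding psum_def[symmetric]
    by (rule endo_eqI, simp add: counit_simps uev.balanced del: counit_gen.simps)
      (simp add: udualX ev.map_left flip: additive_psum[OF additive_pairings(1)])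
next
  case (WX_XW_coev' w x)
  show ?case
    unfolding psum_def[symmetric]
    by (rule endo_eqI, simp add: counit_simps uev.balanced del: counit_gen.simps)
      (simp add: dualX flip: uev.map_right additive_psum[OF additive_pairings(4)])
qed

text \<open>The generator x acts by c \<mapsto> ev(x, dc), so \<open>X_A\<close> and
  \<open>X_Aop\<close> become the two ways of reading the Leibniz rule, for a c and for c a.\<close>

lemma counit_HX_rel: "HX_rel C u v \<Longrightarrow> counit_act C u = counit_act C v"
proof (induction rule: HX_rel.induct)
  case (H u v)
  then show ?case by (rule counit_H_rel)
next
  case (A_X a x)
  show ?case
    by (rule endo_eqI) (simp add: counit_simps ev.map_left del: counit_gen.simps)
qed (rule endo_eqI, simp add: counit_simps ev.add_left ev.add_right ev_scl ev.map_right
    ev.balanced dif_mult del: counit_gen.simps)+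

lemma counit_HX_ideal:
  assumes "f \<in> HX_ideal C"
  shows "counit_act C f = 0"
proof -
  have "f \<in> {f. counit_act C f = 0}"
    using assms
    by (rule relation_ideal_minimal)
      (simp_all add: counit_act_mult additive.zero[OF additive_counit_act]
        additive.add[OF additive_counit_act] additive.minus[OF additive_counit_act]
        additive.diff[OF additive_counit_act] counit_HX_rel)
  then show ?thesis by simp
qed

lemma counit_mult: "counit C (f * g) = endo_app (counit_act C f) (counit C g)"
  by (simp add: counit_def counit_act_mult)

lemma additive_counit: "additive (counit C)"
  by (simp add: additive_def counit_def additive.add[OF additive_counit_act])

lemma counit_scalar: "counit C (scalar k * f) = scl C k (counit C f)"
  by (simp add: counit_mult counit_act_scalar endo_app_scl)

text \<open>Shows that the opposite copy of \<open>A\<close> embeds into \<open>HX\<close>, which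
  later allows \<Upsilon> to be compared through \<open>iAop\<close>.\<close>

lemma counit_iAop: "counit C (iAop a) = a"
  by (simp add: counit_def counit_act_gen counit_gen_app del: counit_gen.simps)

lemma counit_cong: "f - g \<in> HX_ideal C \<Longrightarrow> counit C f = counit C g"
  using counit_HX_ideal[of "f - g"] by (simp add: counit_def additive.diff[OF additive_counit_act])

text \<open>The map \<open>b \<diamond> b' \<mapsto> \<epsilon>(b')\<^sup>o\<^sup>p b\<close>.\<close>

definition right_counit :: "(('a, 'w, 'x) generator, 'k) expr2 \<Rightarrow> ('k, 'a, 'w, 'x) expr"
  where "right_counit = lin_ext const (\<lambda>(u, w).
    HX_nf C (iAop (counit C (Poly_Mapping.single w 1)) * Poly_Mapping.single u 1))"

lemma additive_right_counit: "additive right_counit"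
  unfolding right_counit_def by (rule additive_lin_ext[OF additive_const])

lemma HX_nf_eq_act: "HX_nf C f = endo_app (HX_act C f) 1"
  by simp

lemma right_counit_tens: "right_counit (tens p q) = HX_nf C (iAop (counit C q) * p)"
  unfolding right_counit_def
proof (rule lin_ext_tens[OF additive_const _ _ _ _ const_mult])
  show "additive (\<lambda>p. HX_nf C (iAop (counit C q) * p))" for q
    by (rule additive_compose[OF HX_nf(1) additive_mult_left])
  show "additive (\<lambda>q. HX_nf C (iAop (counit C q) * p))" for p
    unfolding HX_nf_eq_act HX_act_mult
    by (rule additive.intro) (simp add: additive.add[OF additive_counit] M.adds distrib_right
        del: endo_app_HX_act)
  show "HX_nf C (iAop (counit C q) * (scalar k * p)) = const k * HX_nf C (iAop (counit C q) * p)" for k p q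
    by (simp only: scalar_def const_left_commute HX_nf(2))
  show "HX_nf C (iAop (counit C (scalar k * q)) * p) = const k * HX_nf C (iAop (counit C q) * p)" for k p q
  proof -
    have "HX_act C (iAop (counit C (scalar k * q)) * p) = HX_act C (scalar k * (iAop (counit C q) * p))"
      by (simp only: counit_scalar HX_act_mult enveloping_act(6) mult.assoc)
    then show ?thesis
      by (simp only: HX_nf_eq_iff HX_act_eq_iff scalar_def flip: HX_nf(2))
  qed
qed

lemma right_counit_tensor_kernel: "m \<in> tensor_kernel C \<Longrightarrow> right_counit m = 0"
proof (induction rule: tensor_kernel.induct)
  case (left p q)
  then show ?case by (simp add: right_counit_tens HX_nf(3) relation_ideal_mult_left)
next
  case (right q p)
  then have "counit C q = 0"
    using counit_cong[of q 0] by (simp add: additive.zero[OF additive_counit])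
  then show ?case
    unfolding right_counit_tens HX_nf_eq_act HX_act_mult
    by (simp add: additive.zero[OF M.additive_Aop] del: endo_app_HX_act)
next
  case (balanced s p q)
  have "HX_act C (iAop (counit C q) * (iAop s * p)) = HX_act C (iAop (s * counit C q) * p)"
    by (simp add: HX_act_mult M.bimodule_simps)
  then show ?case
    by (simp add: additive.diff[OF additive_right_counit] right_counit_tens counit_mult counit_act_gen
        counit_gen_app HX_nf_eq_act del: counit_gen.simps endo_app_HX_act)
qed (simp_all add: additive.zero[OF additive_right_counit] additive.add[OF additive_right_counit]
    additive.minus[OF additive_right_counit])

lemma right_counit_cop_gen: "right_counit (cop C (gen g) * tens p q) = HX_nf C (gen g * (iAop (counit C q) * p))"
proof -
  let ?c = "counit C q"
  have "HX_act C (gen g) * HX_act C (iAop ?c) = (case g of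
      GA a \<Rightarrow> HX_act C (iAop ?c) * HX_act C (iA a)
    | GAop a \<Rightarrow> HX_act C (iAop (?c * a))
    | GXW x w \<Rightarrow> psum (coev C) (\<lambda>wi xi. HX_act C (iAop (ev C (rX C xi ?c) w)) * HX_act C (iXW x wi))
    | GWX w x \<Rightarrow> psum (ucoev C) (\<lambda>yj rj. HX_act C (iAop (uev C (rW C rj ?c) x)) * HX_act C (iWX w yj))
    | GX x \<Rightarrow> HX_act C (iAop ?c) * HX_act C (iX x)
        + psum (coev C) (\<lambda>wi xi. HX_act C (iAop (ev C xi (dif C ?c))) * HX_act C (iXW x wi)))"
    by (cases g) (simp_all add: M.counit_XW M.counit_WX M.counit_X M.A_Aop M.Aop_mult)
  then have "HX_nf C (gen g * (iAop ?c * p)) = endo_app ((case g of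
      GA a \<Rightarrow> HX_act C (iAop ?c) * HX_act C (iA a)
    | GAop a \<Rightarrow> HX_act C (iAop (?c * a))
    | GXW x w \<Rightarrow> psum (coev C) (\<lambda>wi xi. HX_act C (iAop (ev C (rX C xi ?c) w)) * HX_act C (iXW x wi))
    | GWX w x \<Rightarrow> psum (ucoev C) (\<lambda>yj rj. HX_act C (iAop (uev C (rW C rj ?c) x)) * HX_act C (iWX w yj))
    | GX x \<Rightarrow> HX_act C (iAop ?c) * HX_act C (iX x)
        + psum (coev C) (\<lambda>wi xi. HX_act C (iAop (ev C xi (dif C ?c))) * HX_act C (iXW x wi)))
      * HX_act C p) 1"
    by (simp only: HX_nf_eq_act HX_act_mult flip: mult.assoc)
  then show ?thesis
    by (cases g) (simp_all add: cop_simps psum_mult_right tens_mult distrib_right right_counit_tens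
        additive.add[OF additive_right_counit] additive_psum[OF additive_right_counit]
        counit_mult counit_act_gen counit_gen_app HX_nf_eq_act endo_app_psum HX_act_mult mult.assoc
        del: counit_gen.simps endo_app_HX_act)
qed

text \<open>\<open>right_counit\<close> is a map of left modules, with f acting on tensors through
  its coproduct. At the unit this is the counit law; the general form evaluates products such as
  \<open>cop C (s p) * tens q 1\<close>.\<close>

lemma right_counit_cop_mult: "right_counit (cop C f * m) = HX_nf C (f * right_counit m)"
proof -
  have additives: "additive (\<lambda>m. right_counit (cop C f * m))" "additive (\<lambda>m. HX_nf C (f * right_counit m))"
    for f
    by (simp_all add: additive_def distrib_left additive.add[OF additive_right_counit] additive.add[OF HX_nf(1)])
  show ?thesis
  proof (induction f arbitrary: m rule: free_algebra_induct)
    case (scalar k)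
    have *: "right_counit (cop C (scalar k) * tens p q) = HX_nf C (scalar k * right_counit (tens p q))" for p q
      unfolding cop_scalar
      by (simp only: tens_scalar(1)[symmetric] right_counit_tens scalar_def const_left_commute HX_nf_mult_nf)
    show ?case
      by (rule additive_ext_tens[of "\<lambda>m. right_counit (cop C (scalar k) * m)"
            "\<lambda>m. HX_nf C (scalar k * right_counit m)", OF additives]) (rule *)
  next
    case (gen g)
    show ?case
      by (rule additive_ext_tens[of "\<lambda>m. right_counit (cop C (gen g) * m)"
            "\<lambda>m. HX_nf C (gen g * right_counit m)", OF additives])
        (simp only: right_counit_cop_gen right_counit_tens HX_nf_mult_nf)
  next
    case (add f g)
    then show ?case
      by (simp add: cop_simps distrib_right additive.add[OF additive_right_counit] additive.add[OF HX_nf(1)])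
  next
    case (mult f g)
    then show ?case
      by (simp add: cop_mult mult.assoc HX_nf_mult_nf)
  qed
qed

lemma right_counit_tens_one: "right_counit (tens p 1) = HX_nf C p"
proof -
  have "counit C 1 = 1"
    by (simp add: counit_def counit_act_one)
  moreover have "HX_act C (iAop 1 * p) = HX_act C p"
    by (simp only: HX_act_mult unit_act HX_act_one)
  ultimately show ?thesis
    by (simp only: right_counit_tens HX_nf_eq_iff HX_act_eq_iff)
qed

lemma right_counit_cop: "right_counit (cop C f) = HX_nf C f"
  using right_counit_cop_mult[of f "tens 1 1"] by (simp only: right_counit_tens_one HX_nf_mult_nf) simp

end

section \<open>The antipode axioms on the level of the free algebra\<close>

text \<open>Replaces a sum over a Sweedler representative by an additive map \<Phi> of the tensor
  square. \<Phi> must preserve the kernel, because \<open>to_tens\<close> of a pair of classes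
  agrees with the pure tensor only up to the kernel.\<close>

lemma to_tens_frag_extend:
  assumes H: "\<And>f g. H (HX_class C f, HX_class C g) \<in> carrier (formal_sums (HX_ae_ring C))"
    and to_tens_H: "\<And>f g. to_tens (H (HX_class C f, HX_class C g)) - \<Phi> (tens f g) \<in> tensor_kernel C"
    and additive: "additive \<Phi>" and kernel: "\<And>m. m \<in> tensor_kernel C \<Longrightarrow> \<Phi> m \<in> tensor_kernel C"
    and U: "U \<in> carrier (formal_sums (HX_ae_ring C))"
  shows "frag_extend H U \<in> carrier (formal_sums (HX_ae_ring C)) \<and>
    to_tens (frag_extend H U) - \<Phi> (to_tens U) \<in> tensor_kernel C"
proof -
  have "Poly_Mapping.keys U \<subseteq> range (HX_class C) \<times> range (HX_class C)"
    using U by (simp add: carrier_formal_sums)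
  then show ?thesis
  proof (induction rule: frag_induction)
    case zero
    then show ?case
      by (simp add: HX.carrier_formal_sums_closed additive.zero[OF additive_to_tens]
          additive.zero[OF additive] tensor_kernel.zero)
  next
    case (one x)
    then obtain f g where x: "x = (HX_class C f, HX_class C g)" by auto
    have "\<Phi> (to_tens (frag_of x)) - \<Phi> (tens f g) \<in> tensor_kernel C"
      using kernel[OF to_tens_frag_of[of C f g]] by (simp add: x additive.diff[OF additive])
    from tensor_kernel_diff[OF to_tens_H[of f g] this] show ?case
      by (simp add: x H)
  next
    case (diff u v)
    then show ?case
      using tensor_kernel_diff[of "to_tens (frag_extend H u) - \<Phi> (to_tens u)" C "to_tens (frag_extend H v) - \<Phi> (to_tens v)"]
      by (simp add: HX.carrier_formal_sums_closed frag_extend_diff additive.diff[OF additive_to_tens]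
          additive.diff[OF additive] algebra_simps)
  qed
qed

lemma to_tens_frag_extend_mult:
  assumes H: "\<And>c d. H (HX_class C c, HX_class C d) = frag_of (HX_class C (c * f), HX_class C (d * g))"
    and V: "V \<in> carrier (formal_sums (HX_ae_ring C))"
    and n: "to_tens V - n \<in> tensor_kernel C"
  shows "frag_extend H V \<in> carrier (formal_sums (HX_ae_ring C))"
    and "to_tens (frag_extend H V) - n * tens f g \<in> tensor_kernel C"
proof -
  have *: "frag_extend H V \<in> carrier (formal_sums (HX_ae_ring C)) \<and>
    to_tens (frag_extend H V) - to_tens V * tens f g \<in> tensor_kernel C"
  proof (rule to_tens_frag_extend[where \<Phi> = "\<lambda>m. m * tens f g", OF _ _ additive_mult_right _ V])
    show "to_tens (H (HX_class C c, HX_class C d)) - tens c d * tens f g \<in> tensor_kernel C" for c d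
      unfolding H tens_mult by (rule to_tens_frag_of)
  qed (auto simp: H intro: HX.carrier_formal_sums_closed tensor_kernel_mult_right)
  then show "frag_extend H V \<in> carrier (formal_sums (HX_ae_ring C))" ..
  from tensor_kernel.add[OF conjunct2[OF *] tensor_kernel_mult_right[OF n, of "tens f g"]]
  show "to_tens (frag_extend H V) - n * tens f g \<in> tensor_kernel C"
    by (simp add: left_diff_distrib)
qed

text \<open>Serves both directions of the equivalence. For a given antipode, \<open>s\<close> is a
  chosen lift: normal forms make it linear, but it reverses products only modulo the ideal, hence
  \<open>HX_act\<close> in \<open>s_mult\<close>.\<close>

locale anti_lift = pivotal_calculus C
  for C :: "('k::field, 'a::{ring,monoid_mult}, 'w::ab_group_add, 'x::ab_group_add) calculus" +
  fixes S :: "('k, 'a, 'w, 'x) expr set \<Rightarrow> ('k, 'a, 'w, 'x) expr set"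
    and s :: "('k, 'a, 'w, 'x) expr \<Rightarrow> ('k, 'a, 'w, 'x) expr"
  assumes lift: "S (HX_class C f) = HX_class C (s f)"
    and additive_s: "additive s"
    and s_scalar: "s (scalar k * f) = scalar k * s f"
    and s_ideal: "f \<in> HX_ideal C \<Longrightarrow> s f \<in> HX_ideal C"
    and s_mult: "HX_act C (s (f * g)) = HX_act C (s g) * HX_act C (s f)"
begin

lemma s_cong: "f - g \<in> HX_ideal C \<Longrightarrow> s f - s g \<in> HX_ideal C"
  using s_ideal[of "f - g"] by (simp add: additive.diff[OF additive_s])

definition left_map :: "(('a, 'w, 'x) generator, 'k) expr2 \<Rightarrow> (('a, 'w, 'x) generator, 'k) expr2"
  where "left_map = lin_ext const (\<lambda>(u, w).
    cop C (s (Poly_Mapping.single u 1)) * tens (Poly_Mapping.single w 1) 1)"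

text \<open>The mirror image of \<open>left_map\<close>: b \<diamondop> b' is sent to the coproduct
  of \<open>s b'\<close> with b multiplied onto its second factor from the right.\<close>

definition right_map :: "(('a, 'w, 'x) generator, 'k) expr2 \<Rightarrow> (('a, 'w, 'x) generator, 'k) expr2"
  where "right_map = lin_ext const (\<lambda>(u, w).
    cop C (s (Poly_Mapping.single w 1)) * tens 1 (Poly_Mapping.single u 1))"

lemma additive_left_map: "additive left_map" and additive_right_map: "additive right_map"
  unfolding left_map_def right_map_def by (rule additive_lin_ext[OF additive_const])+

lemma left_map_const: "left_map (const k * m) = const k * left_map m"
  and right_map_const: "right_map (const k * m) = const k * right_map m"
  unfolding left_map_def right_map_def by (rule lin_ext_const[OF additive_const const_mult])+

lemma cop_s_scalar: "cop C (s (scalar k * f)) = const k * cop C (s f)"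
  by (simp add: s_scalar cop_mult cop_scalar)

lemma left_map_tens: "left_map (tens p q) = cop C (s p) * tens q 1"
  unfolding left_map_def
  by (rule lin_ext_tens[OF additive_const _ _ _ _ const_mult])
    (simp_all add: additive_def distrib_left distrib_right additive.add[OF additive_s]
      additive.add[OF additive_cop] additive.add[OF additive_tens_left] cop_s_scalar
      tens_scalar const_left_commute mult.assoc)

lemma right_map_tens: "right_map (tens p q) = cop C (s q) * tens 1 p"
  unfolding right_map_def
  by (rule lin_ext_tens[OF additive_const _ _ _ _ const_mult])
    (simp_all add: additive_def distrib_left distrib_right additive.add[OF additive_s]
      additive.add[OF additive_cop] additive.add[OF additive_tens_right] cop_s_scalar
      tens_scalar const_left_commute mult.assoc)

lemma cop_s_cong:
  assumes "HX_act C f = HX_act C g"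
  shows "cop C f * m - cop C g * m \<in> tensor_kernel C"
  using tensor_kernel_mult_right[OF cop_HX_ideal[of "f - g"], of m] assms
  by (simp add: HX_act_eq_iff additive.diff[OF additive_cop] left_diff_distrib)

text \<open>Balancing survives because \<open>s (iAop a * p)\<close> is \<open>s p * iA a\<close>
  modulo the ideal and the coproduct of \<open>iA a\<close> sits in the first factor, just where
  \<open>q\<close> is multiplied. This is the role of S(\<open>tgt\<close> a) = \<open>src\<close>
  a.\<close>

lemma left_map_kernel:
  assumes s_iAop: "\<And>a. HX_act C (s (iAop a)) = HX_act C (iA a)"
  shows "m \<in> tensor_kernel C \<Longrightarrow> left_map m \<in> tensor_kernel C"
proof (induction rule: tensor_kernel.induct)
  case (left p q)
  then show ?case by (simp add: left_map_tens tensor_kernel_mult_right cop_HX_ideal s_ideal)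
next
  case (right q p)
  then show ?case by (simp add: left_map_tens tensor_kernel_mult_pure)
next
  case (balanced a p q)
  have "HX_act C (s (iAop a * p)) = HX_act C (s p * iA a)"
    by (simp only: s_mult s_iAop HX_act_mult)
  from cop_s_cong[OF this, of "tens q 1"] show ?case
    by (simp add: additive.diff[OF additive_left_map] left_map_tens cop_mult cop_generators tens_mult mult.assoc)
qed (auto simp: additive.zero[OF additive_left_map] additive.add[OF additive_left_map]
    additive.minus[OF additive_left_map] intro: tensor_kernel.intros)

lemma right_map_kernel:
  assumes s_iA: "\<And>a. HX_act C (s (iA a)) = HX_act C (iAop a)"
  shows "m \<in> tensor_kernel C \<Longrightarrow> right_map m \<in> tensor_kernel C"
proof (induction rule: tensor_kernel.induct)
  case (left p q)
  then show ?case by (simp add: right_map_tens tensor_kernel_mult_pure)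
next
  case (right q p)
  then show ?case by (simp add: right_map_tens tensor_kernel_mult_right cop_HX_ideal s_ideal)
next
  case (balanced a p q)
  have "HX_act C (s (iA a * q)) = HX_act C (s q * iAop a)"
    by (simp only: s_mult s_iA HX_act_mult)
  from tensor_kernel.uminus[OF cop_s_cong[OF this, of "tens 1 p"]] show ?case
    by (simp add: additive.diff[OF additive_right_map] right_map_tens cop_mult cop_generators tens_mult mult.assoc)
qed (auto simp: additive.zero[OF additive_right_map] additive.add[OF additive_right_map]
    additive.minus[OF additive_right_map] intro: tensor_kernel.intros)

text \<open>Trades an antipode axiom in terms of arbitrary Sweedler representatives for a membership
  in \<open>tensor_kernel C\<close>; both axioms are instances.\<close>

lemma axiom_iff:
  assumes \<Phi>: "additive \<Phi>" "\<And>m. m \<in> tensor_kernel C \<Longrightarrow> \<Phi> m \<in> tensor_kernel C"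
    and H: "\<And>f g. H (HX_class C f, HX_class C g) \<in> carrier (formal_sums (HX_ae_ring C)) \<and>
      to_tens (H (HX_class C f, HX_class C g)) - \<Phi> (tens f g) \<in> tensor_kernel C"
  shows "diamond_class (HX C) (frag_extend H (sweedler (HX C) (HX_class C f)))
      = diamond_class (HX C) (frag_of (HX_class C g, HX_class C h))
    \<longleftrightarrow> \<Phi> (cop C f) - tens g h \<in> tensor_kernel C"
proof -
  let ?U = "frag_extend H (sweedler (HX C) (HX_class C f))"
  let ?V = "frag_of (HX_class C g, HX_class C h)"
  have U: "?U \<in> carrier (formal_sums (HX_ae_ring C))"
    "to_tens ?U - \<Phi> (to_tens (sweedler (HX C) (HX_class C f))) \<in> tensor_kernel C"
    using to_tens_frag_extend[of H C \<Phi>, OF conjunct1[OF H] conjunct2[OF H] \<Phi> sweedler_HX(1)] by auto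
  have "\<Phi> (to_tens (sweedler (HX C) (HX_class C f))) - \<Phi> (cop C f) \<in> tensor_kernel C"
    using \<Phi>(2)[OF sweedler_HX(2)] by (simp add: additive.diff[OF \<Phi>(1)])
  from tensor_kernel.add[OF U(2) this]
  have 1: "to_tens ?U - \<Phi> (cop C f) \<in> tensor_kernel C" by simp
  have V: "?V \<in> carrier (formal_sums (HX_ae_ring C))" "to_tens ?V - tens g h \<in> tensor_kernel C"
    by (rule HX.carrier_formal_sums_closed; simp) (rule to_tens_frag_of)
  have "to_tens ?U - to_tens ?V \<in> tensor_kernel C \<longleftrightarrow> \<Phi> (cop C f) - tens g h \<in> tensor_kernel C"
    using 1 V(2) by (simp only: tens_nf_eq_iff[symmetric])
  then show ?thesis
    by (simp only: diamond_class_HX diamond_class_HX_eq_iff[OF U(1) V(1)])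
qed

lemma left_axiom_iff:
  assumes "\<And>a. HX_act C (s (iAop a)) = HX_act C (iA a)"
  shows "diamond_class (HX C)
      (frag_extend (\<lambda>(b1, b2).
        frag_extend (\<lambda>(c1, c2). frag_of (c1 \<otimes>\<^bsub>HX C\<^esub> b2, c2)) (sweedler (HX C) (S b1)))
        (sweedler (HX C) (HX_class C f)))
    = diamond_class (HX C) (frag_of (\<one>\<^bsub>HX C\<^esub>, S (HX_class C f)))
    \<longleftrightarrow> left_map (cop C f) - tens 1 (s f) \<in> tensor_kernel C"
  unfolding HX_simps lift
proof (rule axiom_iff[OF additive_left_map left_map_kernel[OF assms]])
  fix p q
  let ?H = "\<lambda>(c1, c2). frag_of (c1 \<otimes>\<^bsub>HX C\<^esub> HX_class C q, c2)"
  have "frag_extend ?H (sweedler (HX C) (HX_class C (s p))) \<in> carrier (formal_sums (HX_ae_ring C))"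
    "to_tens (frag_extend ?H (sweedler (HX C) (HX_class C (s p)))) - cop C (s p) * tens q 1 \<in> tensor_kernel C"
    by (rule to_tens_frag_extend_mult[where f = q and g = 1, OF _ sweedler_HX], simp)+
  then show "(case (HX_class C p, HX_class C q) of (b1, b2) \<Rightarrow>
      frag_extend (\<lambda>(c1, c2). frag_of (c1 \<otimes>\<^bsub>HX C\<^esub> b2, c2)) (sweedler (HX C) (S b1)))
      \<in> carrier (formal_sums (HX_ae_ring C)) \<and>
    to_tens (case (HX_class C p, HX_class C q) of (b1, b2) \<Rightarrow>
      frag_extend (\<lambda>(c1, c2). frag_of (c1 \<otimes>\<^bsub>HX C\<^esub> b2, c2)) (sweedler (HX C) (S b1)))
      - left_map (tens p q) \<in> tensor_kernel C"
    by (simp add: lift left_map_tens)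
qed

lemma right_axiom_iff:
  assumes "\<And>a. HX_act C (s (iA a)) = HX_act C (iAop a)"
  shows "diamond_class (HX C)
      (frag_extend (\<lambda>(b1, b2).
        frag_extend (\<lambda>(c1, c2). frag_of (c1, c2 \<otimes>\<^bsub>HX C\<^esub> b1)) (sweedler (HX C) (S b2)))
        (sweedler (HX C) (HX_class C f)))
    = diamond_class (HX C) (frag_of (S (HX_class C f), \<one>\<^bsub>HX C\<^esub>))
    \<longleftrightarrow> right_map (cop C f) - tens (s f) 1 \<in> tensor_kernel C"
  unfolding HX_simps lift
proof (rule axiom_iff[OF additive_right_map right_map_kernel[OF assms]])
  fix p q
  let ?H = "\<lambda>(c1, c2). frag_of (c1, c2 \<otimes>\<^bsub>HX C\<^esub> HX_class C p)"
  have "frag_extend ?H (sweedler (HX C) (HX_class C (s q))) \<in> carrier (formal_sums (HX_ae_ring C))"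
    "to_tens (frag_extend ?H (sweedler (HX C) (HX_class C (s q)))) - cop C (s q) * tens 1 p \<in> tensor_kernel C"
    by (rule to_tens_frag_extend_mult[where f = 1 and g = p, OF _ sweedler_HX], simp)+
  then show "(case (HX_class C p, HX_class C q) of (b1, b2) \<Rightarrow>
      frag_extend (\<lambda>(c1, c2). frag_of (c1, c2 \<otimes>\<^bsub>HX C\<^esub> b1)) (sweedler (HX C) (S b2)))
      \<in> carrier (formal_sums (HX_ae_ring C)) \<and>
    to_tens (case (HX_class C p, HX_class C q) of (b1, b2) \<Rightarrow>
      frag_extend (\<lambda>(c1, c2). frag_of (c1, c2 \<otimes>\<^bsub>HX C\<^esub> b1)) (sweedler (HX C) (S b2)))
      - right_map (tens p q) \<in> tensor_kernel C"
    by (simp add: lift right_map_tens)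
qed

lemma left_map_cop:
  assumes s_mult': "\<And>f g. s (f * g) = s g * s f" and s_const: "\<And>k. s (scalar k) = scalar k"
    and generators: "\<And>g. left_map (cop C (gen g)) - tens 1 (s (gen g)) \<in> tensor_kernel C"
  shows "left_map (cop C f) - tens 1 (s f) \<in> tensor_kernel C"
proof -
  \<comment> \<open>Reversal of products moves \<open>s p\<close> to the far left, while
    \<open>q\<close> stays on the right of the first factor.\<close>
  have pure: "left_map (n * tens p q) = cop C (s p) * (left_map n * tens q 1)" for n p q
    by (rule additive_ext_tens[of "\<lambda>n. left_map (n * tens p q)" "\<lambda>n. cop C (s p) * (left_map n * tens q 1)"])
      (simp_all add: additive_def distrib_left distrib_right additive.add[OF additive_left_map]
        tens_mult left_map_tens s_mult' cop_mult mult.assoc)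
  \<comment> \<open>An arbitrary \<open>m\<close> is what lets the product step use the hypothesis
    for one factor at \<open>cop C g * m\<close>; the claim is the case
    \<open>m = 1\<close>.\<close>
  have "left_map (cop C f * m) - left_map m * tens 1 (s f) \<in> tensor_kernel C" for m
  proof (induction f arbitrary: m rule: free_algebra_induct)
    case (scalar k)
    show ?case
      by (simp only: cop_scalar left_map_const s_const)
        (simp only: scalar_def tens_const const_commute[of k m] const_commute[of k "left_map m"]
          diff_self tensor_kernel.zero)
  next
    case (gen g)
    show ?case
    proof (induction m rule: expr2_induct)
      case (tens p q)
      \<comment> \<open>\<open>tens q 1\<close> and \<open>tens 1 (s (gen g))\<close> commute, and
        multiplication by \<open>cop C (s p)\<close> from the left keeps the kernel.\<close>
      have "cop C (s p) * ((left_map (cop C (gen g)) - tens 1 (s (gen g))) * tens q 1) \<in> tensor_kernel C"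
        by (intro cop_tensor_kernel tensor_kernel_mult_right generators)
      then show ?case
        by (simp add: pure left_map_tens left_diff_distrib right_diff_distrib tens_mult mult.assoc)
    next
      case (add m n)
      from tensor_kernel.add[OF this] show ?case
        by (simp add: distrib_left distrib_right additive.add[OF additive_left_map] algebra_simps)
    qed
  next
    case (add f g)
    from tensor_kernel.add[OF add(1)[of m] add(2)[of m]] show ?case
      by (simp add: distrib_left distrib_right additive.add[OF additive_left_map] cop_simps
          additive.add[OF additive_s] additive.add[OF additive_tens_right] algebra_simps)
  next
    case (mult f g)
    from tensor_kernel.add[OF mult(1)[of "cop C g * m"] tensor_kernel_mult_right[OF mult(2)[of m], of "tens 1 (s f)"]]
    show ?case
      by (simp add: cop_mult mult.assoc left_diff_distrib s_mult' tens_mult)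
  qed
  from this[of 1] show ?thesis
    using left_map_tens[of 1 1] s_const[of 1] by (simp add: scalar_def)
qed

lemma right_map_cop:
  assumes s_mult': "\<And>f g. s (f * g) = s g * s f" and s_const: "\<And>k. s (scalar k) = scalar k"
    and generators: "\<And>g. right_map (cop C (gen g)) - tens (s (gen g)) 1 \<in> tensor_kernel C"
  shows "right_map (cop C f) - tens (s f) 1 \<in> tensor_kernel C"
proof -
  have pure: "right_map (n * tens p q) = cop C (s q) * (right_map n * tens 1 p)" for n p q
    by (rule additive_ext_tens[of "\<lambda>n. right_map (n * tens p q)" "\<lambda>n. cop C (s q) * (right_map n * tens 1 p)"])
      (simp_all add: additive_def distrib_left distrib_right additive.add[OF additive_right_map]
        tens_mult right_map_tens s_mult' cop_mult mult.assoc)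
  have "right_map (cop C f * m) - right_map m * tens (s f) 1 \<in> tensor_kernel C" for m
  proof (induction f arbitrary: m rule: free_algebra_induct)
    case (scalar k)
    show ?case
      by (simp only: cop_scalar right_map_const s_const)
        (simp only: scalar_def tens_const const_commute[of k m] const_commute[of k "right_map m"]
          diff_self tensor_kernel.zero)
  next
    case (gen g)
    show ?case
    proof (induction m rule: expr2_induct)
      case (tens p q)
      have "cop C (s q) * ((right_map (cop C (gen g)) - tens (s (gen g)) 1) * tens 1 p) \<in> tensor_kernel C"
        by (intro cop_tensor_kernel tensor_kernel_mult_right generators)
      then show ?case
        by (simp add: pure right_map_tens left_diff_distrib right_diff_distrib tens_mult mult.assoc)
    next
      case (add m n)
      from tensor_kernel.add[OF this] show ?case
        by (simp add: distrib_left distrib_right additive.add[OF additive_right_map] algebra_simps)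
    qed
  next
    case (add f g)
    from tensor_kernel.add[OF add(1)[of m] add(2)[of m]] show ?case
      by (simp add: distrib_left distrib_right additive.add[OF additive_right_map] cop_simps
          additive.add[OF additive_s] additive.add[OF additive_tens_left] algebra_simps)
  next
    case (mult f g)
    from tensor_kernel.add[OF mult(1)[of "cop C g * m"] tensor_kernel_mult_right[OF mult(2)[of m], of "tens (s f) 1"]]
    show ?case
      by (simp add: cop_mult mult.assoc left_diff_distrib s_mult' tens_mult)
  qed
  from this[of 1] show ?thesis
    using right_map_tens[of 1 1] s_const[of 1] by (simp add: scalar_def)
qed

end

section \<open>Extensions of the antipode of \<open>H(\<Omega>\<^sup>1)\<close>\<close>

text \<open>S and its inverse agree on the generators of H(\<Omega>^1), so one definition with the
  values \<open>sx\<close> on x as a parameter yields both.\<close>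

fun antipode_gen :: "('x \<Rightarrow> ('k::field, 'a, 'w, 'x) expr) \<Rightarrow> ('a, 'w, 'x) generator \<Rightarrow> ('k, 'a, 'w, 'x) expr"
  where
    "antipode_gen sx (GA a) = iAop a"
  | "antipode_gen sx (GAop a) = iA a"
  | "antipode_gen sx (GXW x w) = iWX w x"
  | "antipode_gen sx (GWX w x) = iXW x w"
  | "antipode_gen sx (GX x) = sx x"

definition antipode_expr ::
    "('x \<Rightarrow> ('k::field, 'a, 'w, 'x) expr) \<Rightarrow> ('k, 'a, 'w, 'x) expr \<Rightarrow> ('k, 'a, 'w, 'x) expr"
  where "antipode_expr sx = lin_ext const (word_rev_prod (antipode_gen sx))"

lemma additive_antipode_expr: "additive (antipode_expr sx)"
  unfolding antipode_expr_def by (rule additive_lin_ext[OF additive_const])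

lemma antipode_expr_mult: "antipode_expr sx (f * g) = antipode_expr sx g * antipode_expr sx f"
  unfolding antipode_expr_def
  by (rule lin_ext_anti_mult[OF additive_const const_mult]) (rule const_commute[symmetric], simp)

lemma antipode_expr_scalar: "antipode_expr sx (scalar k) = scalar k"
  by (simp add: antipode_expr_def scalar_def lin_ext_single additive_const)

lemma antipode_expr_gen: "antipode_expr sx (gen g) = antipode_gen sx g"
  by (simp add: antipode_expr_def gen_def lin_ext_single additive_const)

lemma antipode_expr_one: "antipode_expr sx 1 = 1"
  using antipode_expr_scalar[of sx 1] by (simp add: scalar_def)

lemmas antipode_simps = additive.add[OF additive_antipode_expr] additive.diff[OF additive_antipode_expr]
  additive.minus[OF additive_antipode_expr] additive_psum[OF additive_antipode_expr]
  antipode_expr_mult antipode_expr_scalar antipode_expr_gen antipode_expr_one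

definition antipode_map ::
    "('k::field, 'a::{ring,monoid_mult}, 'w::ab_group_add, 'x::ab_group_add) calculus \<Rightarrow>
     ('x \<Rightarrow> ('k, 'a, 'w, 'x) expr) \<Rightarrow> ('k, 'a, 'w, 'x) expr set \<Rightarrow> ('k, 'a, 'w, 'x) expr set"
  where "antipode_map C sx b = HX_class C (antipode_expr sx (repr b))"

text \<open>The assumptions are the images of the rules for x in \<open>HX_rel\<close> under an
  anti-homomorphism with values \<open>sx\<close>: additivity, scalars, then \<open>A_X\<close>,
  \<open>X_A\<close> and \<open>X_Aop\<close>.\<close>

locale antipode_extension = pivotal_calculus C
  for C :: "('k::field, 'a::{ring,monoid_mult}, 'w::ab_group_add, 'x::ab_group_add) calculus" +
  fixes sx :: "'x \<Rightarrow> ('k, 'a, 'w, 'x) expr"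
  assumes additive_sx: "additive (\<lambda>x. HX_act C (sx x))"
    and sx_scl: "HX_act C (sx (lX C (scl C k 1) x)) = HX_act C (scalar k) * HX_act C (sx x)"
    and sx_lX: "HX_act C (sx x) * HX_act C (iAop a) = HX_act C (sx (lX C a x))"
    and sx_rX: "HX_act C (iAop a) * HX_act C (sx x)
      = HX_act C (sx (rX C x a)) + HX_act C (iAop (ev C x (dif C a)))"
    and sx_Aop: "HX_act C (iA a) * HX_act C (sx x)
      = HX_act C (sx x) * HX_act C (iA a) + HX_act C (iWX (dif C a) x)"
begin

lemma antipode_enveloping_rel:
  "enveloping_rel C u v \<Longrightarrow> HX_act C (antipode_expr sx u) = HX_act C (antipode_expr sx v)"
  by (induction rule: enveloping_rel.induct)
    (simp_all add: antipode_simps HX_act_simps M.adds enveloping_act(2,6)[unfolded HX_act_simps]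
      M.A_mult M.Aop_mult M.A_Aop unit_act HX_act_scalar_commute)

lemma antipode_tensor_algebra_rel:
  "tensor_algebra_rel C u v \<Longrightarrow> HX_act C (antipode_expr sx u) = HX_act C (antipode_expr sx v)"
proof (induction rule: tensor_algebra_rel.induct)
  case (enveloping u v)
  then show ?case by (rule antipode_enveloping_rel)
qed (simp_all add: antipode_simps HX_act_simps M.adds tensor_act[unfolded HX_act_simps]
    HX_act_scalar_commute M.bimodule_simps X.l_r_commute W.l_r_commute)

text \<open>Reversing products and exchanging (x, \<omega>) with (\<omega>, x) swaps the four
  relations in pairs: the two with \<open>coev\<close>, and the two with
  \<open>ucoev\<close>.\<close>

lemma antipode_H_rel:
  "H_rel C u v \<Longrightarrow> HX_act C (antipode_expr sx u) = HX_act C (antipode_expr sx v)"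
proof (induction rule: H_rel.induct)
  case (tensor_algebra u v)
  then show ?case by (rule antipode_tensor_algebra_rel)
qed (unfold psum_def[symmetric], simp_all add: antipode_simps HX_act_simps M.WX_XW_coev M.XW_WX_ucoev
    M.XW_WX_ucoev' M.WX_XW_coev')

lemma antipode_HX_rel:
  "HX_rel C u v \<Longrightarrow> HX_act C (antipode_expr sx u) = HX_act C (antipode_expr sx v)"
proof (induction rule: HX_rel.induct)
  case (H u v)
  then show ?case by (rule antipode_H_rel)
qed (simp_all add: antipode_simps HX_act_simps additive.add[OF additive_sx] sx_scl sx_lX sx_rX sx_Aop
    HX_act_scalar_commute)

lemma antipode_HX_ideal:
  assumes "f \<in> HX_ideal C"
  shows "antipode_expr sx f \<in> HX_ideal C"
proof -
  have "f \<in> {f. antipode_expr sx f \<in> HX_ideal C}"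
    using assms
    by (rule relation_ideal_minimal)
      (auto simp: antipode_expr_mult additive.zero[OF additive_antipode_expr]
        additive.add[OF additive_antipode_expr] additive.minus[OF additive_antipode_expr]
        additive.diff[OF additive_antipode_expr] antipode_HX_rel HX_act_eq_iff[symmetric]
        intro: HX_ideal_closed)
  then show ?thesis by simp
qed

sublocale anti_lift C "antipode_map C sx" "antipode_expr sx"
proof unfold_locales
  show "antipode_map C sx (HX_class C f) = HX_class C (antipode_expr sx f)" for f
    using antipode_HX_ideal[OF repr_HX_class[of C f]]
    by (simp add: antipode_map_def HX_class_eq_iff additive.diff[OF additive_antipode_expr])
  show "antipode_expr sx (scalar k * f) = scalar k * antipode_expr sx f" for k f
    by (simp only: antipode_expr_mult antipode_expr_scalar)
      (simp only: scalar_def const_commute[of k "antipode_expr sx f"])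
qed (simp_all add: additive.add[OF additive_antipode_expr] antipode_HX_ideal antipode_expr_mult HX_act_mult)

lemma extends_H_antipode: "extends_H_antipode C (antipode_map C sx)"
  by (simp add: extends_H_antipode_def lift antipode_expr_gen)

lemma anti_algebra_hom: "anti_algebra_hom (HX C) (antipode_map C sx)"
proof -
  have "antipode_map C sx (k \<odot>\<^bsub>HX C\<^esub> HX_class C f) = k \<odot>\<^bsub>HX C\<^esub> antipode_map C sx (HX_class C f)" for k f
    by (simp only: HX_simps lift s_scalar)
  moreover have "antipode_map C sx \<in> ring_hom (HX C) (opposite_ring (HX C))"
    by (auto intro!: ring_hom_memI simp: opposite_ring_def lift antipode_simps)
  ultimately show ?thesis
    by (auto simp: anti_algebra_hom_def simp del: HX_simps(5))
qed

end

section \<open>The antipode of a compatible map\<close>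

locale compatible_calculus = pivotal_calculus C
  for C :: "('k::field, 'a::{ring,monoid_mult}, 'w::ab_group_add, 'x::ab_group_add) calculus" +
  fixes \<Upsilon> :: "'x \<Rightarrow> 'a"
  assumes compatible: "compatible_map C \<Upsilon>"
begin

definition S_X :: "'x \<Rightarrow> ('k, 'a, 'w, 'x) expr"
  where "S_X x = - psum (coev C) (\<lambda>wi xi. iWX wi x * iX xi) - iAop (\<Upsilon> x)"

definition T_X :: "'x \<Rightarrow> ('k, 'a, 'w, 'x) expr"
  where "T_X x = - psum (ucoev C) (\<lambda>yj rj. (iX yj + iA (\<Upsilon> yj)) * iWX rj x)"

lemma act_S_X: "HX_act C (S_X x) = M.SX \<Upsilon> x"
  by (simp add: S_X_def M.SX_def[OF compatible] HX_act_simps)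

lemma act_T_X: "HX_act C (T_X x) = M.TX \<Upsilon> x"
  by (simp add: T_X_def M.TX_def[OF compatible] HX_act_simps)

lemma Ups_scl: "\<Upsilon> (lX C (scl C k 1) x) = scl C k (\<Upsilon> x)"
proof -
  interpret Vector_Spaces.linear "\<lambda>k. lX C (scl C k 1)" "scl C" \<Upsilon>
    using compatible by (simp add: compatible_map_def)
  show ?thesis by (rule scale)
qed

lemma WX_scl: "HX_act C (iWX w (lX C (scl C k 1) x)) = HX_act C (scalar k) * HX_act C (iWX w x)"
  by (simp add: tensor_act(9) HX_act_mult)

sublocale S: antipode_extension C S_X
proof unfold_locales
  fix k x
  show "HX_act C (S_X (lX C (scl C k 1) x)) = HX_act C (scalar k) * HX_act C (S_X x)"
    by (simp add: S_X_def HX_act_simps WX_scl Ups_scl enveloping_act(6) psum_mult_left right_diff_distrib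
        mult.assoc)
qed (simp_all only: act_S_X additive.add[OF M.additive_SX[OF compatible]] M.SX_lX[OF compatible]
    M.SX_rX[OF compatible] M.SX_Aop[OF compatible])

sublocale T: antipode_extension C T_X
proof unfold_locales
  fix k x
  have "p * (HX_act C (scalar k) * q) = HX_act C (scalar k) * (p * q)"
    if "p = HX_act C f" for p q f
    by (simp add: that HX_act_scalar_commute flip: mult.assoc)
  from this[OF refl]
  show "HX_act C (T_X (lX C (scl C k 1) x)) = HX_act C (scalar k) * HX_act C (T_X x)"
    by (simp add: T_X_def WX_scl psum_mult_left HX_act_mult additive_psum[OF additive_HX_act]
        additive.minus[OF additive_HX_act])
qed (simp_all only: act_T_X additive.add[OF M.additive_TX[OF compatible]] M.TX_lX[OF compatible]
    M.TX_rX[OF compatible] M.TX_Aop[OF compatible])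

abbreviation "S \<equiv> antipode_map C S_X"
abbreviation "T \<equiv> antipode_map C T_X"

text \<open>The composite preserves products, so only generators matter, and on those of
  H(\<Omega>^1) it is visibly the identity.\<close>

lemma TS_act: "HX_act C (antipode_expr T_X (antipode_expr S_X f)) = HX_act C f"
proof (induction f rule: free_algebra_induct)
  case (gen g)
  show ?case
  proof (cases g)
    case (GX x)
    have "HX_act C (antipode_expr T_X (S_X x)) = - psum (coev C) (\<lambda>wi xi. M.TX \<Upsilon> xi * HX_act C (iXW x wi))
      - HX_act C (iA (\<Upsilon> x))"
      by (simp add: S_X_def antipode_simps HX_act_simps act_T_X)
    then show ?thesis
      by (simp add: GX antipode_simps M.TX_SX[OF compatible])
  qed (simp_all add: antipode_simps)
qed (simp_all add: antipode_simps HX_act_simps)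

lemma ST_act: "HX_act C (antipode_expr S_X (antipode_expr T_X f)) = HX_act C f"
proof (induction f rule: free_algebra_induct)
  case (gen g)
  show ?case
  proof (cases g)
    case (GX x)
    have "HX_act C (antipode_expr S_X (T_X x))
      = - psum (ucoev C) (\<lambda>yj rj. HX_act C (iXW x rj) * (M.SX \<Upsilon> yj + HX_act C (iAop (\<Upsilon> yj))))"
      by (simp add: T_X_def antipode_simps HX_act_simps act_S_X)
    then show ?thesis
      by (simp add: GX antipode_simps M.SX_TX[OF compatible])
  qed (simp_all add: antipode_simps)
qed (simp_all add: antipode_simps HX_act_simps)

lemma mutually_inverse: "mutually_inverse (HX C) S T"
  by (auto simp: mutually_inverse_def S.lift T.lift HX_class_eq_act TS_act ST_act)

lemma left_axiom: "S.left_map (cop C f) - tens 1 (antipode_expr S_X f) \<in> tensor_kernel C"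
proof (rule S.left_map_cop[OF antipode_expr_mult antipode_expr_scalar])
  fix g
  have "tens_nf C (S.left_map (cop C (gen g))) = tens_nf C (tens 1 (antipode_expr S_X (gen g)))"
  proof (cases g)
    case (GA a)
    then show ?thesis by (simp add: cop_simps S.left_map_tens antipode_simps)
  next
    case (GAop a)
    then show ?thesis
      using M.t_Aop[of a "HX_act C 1"]
      by (simp add: cop_simps S.left_map_tens antipode_simps tens_nf_tens HX_act_one)
  next
    case (GXW x w)
    then show ?thesis
      using M.left_antipode_XW[of w x]
      by (simp add: expand_simps additive_psum[OF S.additive_left_map] S.left_map_tens antipode_simps)
  next
    case (GWX w x)
    then show ?thesis
      using M.left_antipode_WX[of x w]
      by (simp add: expand_simps additive_psum[OF S.additive_left_map] S.left_map_tens antipode_simps)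
  next
    case (GX x)
    have "cop C (S_X x) = - psum (coev C) (\<lambda>wi xi. cop C (iWX wi x) * cop C (iX xi)) - tens 1 (iAop (\<Upsilon> x))"
      by (simp add: S_X_def additive.diff[OF additive_cop] additive.minus[OF additive_cop]
          additive_psum[OF additive_cop] cop_mult cop_generators(2))
    also have "psum (coev C) (\<lambda>wi xi. cop C (iWX wi x) * cop C (iX xi))
      = psum (coev C) (\<lambda>wi xi. cop C (iWX wi x) * tens (iX xi) 1)
      + psum (coev C) (\<lambda>wi xi. psum (ucoev C) (\<lambda>yj rj. psum (coev C) (\<lambda>wk xk.
          tens (iWX wi yj * iXW xi wk) (iWX rj x * iX xk))))"
      by (simp only: cop_generators(4,5) distrib_left psum_add psum_mult_right)
        (simp only: psum_mult_left tens_mult)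
    \<comment> \<open>The terms \<open>cop C (iWX wi x) * tens (iX xi) 1\<close> cancel: they come
      with a minus sign from S(x), and with a plus sign from the sum in the coproduct of x.\<close>
    finally have "S.left_map (cop C (iX x))
      = - psum (coev C) (\<lambda>wi xi. psum (ucoev C) (\<lambda>yj rj. psum (coev C) (\<lambda>wk xk.
          tens (iWX wi yj * iXW xi wk) (iWX rj x * iX xk)))) - tens 1 (iAop (\<Upsilon> x))"
      by (simp add: cop_generators(5) additive.add[OF S.additive_left_map]
          additive_psum[OF S.additive_left_map] S.left_map_tens antipode_simps)
    then have "tens_nf C (S.left_map (cop C (iX x)))
      = - psum (coev C) (\<lambda>wi xi. psum (ucoev C) (\<lambda>yj rj. psum (coev C) (\<lambda>wk xk.
          tens_act C (HX_act C (iWX wi yj) * HX_act C (iXW xi wk)) (HX_act C (iWX rj x) * HX_act C (iX xk)))))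
        - tens_act C (HX_act C 1) (HX_act C (iAop (\<Upsilon> x)))"
      by (simp add: tens_nf_simps HX_act_mult)
    \<comment> \<open>The second use of \<open>M.cop_WX_XW\<close>, now with x as the free
      factor.\<close>
    also have "\<dots> = tens_act C (HX_act C 1) (M.SX \<Upsilon> x)"
      by (simp only: M.cop_WX_XW M.t_SX[OF compatible])
    finally show ?thesis
      by (simp add: GX antipode_simps tens_nf_tens act_S_X)
  qed
  then show "S.left_map (cop C (gen g)) - tens 1 (antipode_expr S_X (gen g)) \<in> tensor_kernel C"
    by (simp only: tens_nf_eq_iff)
qed

lemma right_axiom: "T.right_map (cop C f) - tens (antipode_expr T_X f) 1 \<in> tensor_kernel C"
proof (rule T.right_map_cop[OF antipode_expr_mult antipode_expr_scalar])
  fix g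
  have "tens_nf C (T.right_map (cop C (gen g))) = tens_nf C (tens (antipode_expr T_X (gen g)) 1)"
  proof (cases g)
    case (GA a)
    then show ?thesis
      using M.t_A[of "HX_act C 1" a]
      by (simp add: cop_simps T.right_map_tens antipode_simps tens_nf_tens HX_act_one)
  next
    case (GAop a)
    then show ?thesis by (simp add: cop_simps T.right_map_tens antipode_simps)
  next
    case (GXW x w)
    then show ?thesis
      using M.right_antipode_XW[of w x]
      by (simp add: expand_simps additive_psum[OF T.additive_right_map] T.right_map_tens antipode_simps)
  next
    case (GWX w x)
    then show ?thesis
      using M.right_antipode_WX[of x w]
      by (simp add: expand_simps additive_psum[OF T.additive_right_map] T.right_map_tens antipode_simps)
  next
    case (GX x)
    have T_X: "cop C (T_X z) = - psum (ucoev C) (\<lambda>yj rj. psum (ucoev C) (\<lambda>yk rk.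
        tens (iX yj * iWX rj yk) (iWX rk z)
        + psum (coev C) (\<lambda>wl xl. tens (iXW yj wl * iWX rj yk) (iX xl * iWX rk z))
        + tens (iA (\<Upsilon> yj) * iWX rj yk) (iWX rk z)))" for z
    proof -
      have "cop C (T_X z) = - psum (ucoev C) (\<lambda>yj rj. (cop C (iX yj) + cop C (iA (\<Upsilon> yj))) * cop C (iWX rj z))"
        by (simp add: T_X_def additive.add[OF additive_cop] additive.minus[OF additive_cop]
          additive_psum[OF additive_cop] cop_mult)
      then show ?thesis
        by (simp only: cop_generators(1,4,5) psum_mult_left)
          (simp add: distrib_right psum_mult_right tens_mult)
    qed
    \<comment> \<open>The isolated \<open>tens 1 (iX x)\<close> is the image of
      \<open>tens (iX x) 1\<close>; it cancels the term of the same form in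
      \<open>M.right_antipode_X\<close>.\<close>
    have "T.right_map (cop C (iX x)) = tens 1 (iX x)
      - psum (coev C) (\<lambda>wi xi. psum (ucoev C) (\<lambda>yj rj. psum (ucoev C) (\<lambda>yk rk.
        tens (iX yj * iWX rj yk) (iWX rk xi * iXW x wi)
        + psum (coev C) (\<lambda>wl xl. tens (iXW yj wl * iWX rj yk) (iX xl * (iWX rk xi * iXW x wi)))
        + tens (iA (\<Upsilon> yj) * iWX rj yk) (iWX rk xi * iXW x wi))))"
      by (simp add: cop_generators(5) additive.add[OF T.additive_right_map]
          additive_psum[OF T.additive_right_map] T.right_map_tens antipode_simps T_X psum_mult_right
          distrib_right tens_mult mult.assoc psum_minus)
    then have "tens_nf C (T.right_map (cop C (iX x))) = tens_act C (HX_act C 1) (HX_act C (iX x))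
      - (tens_act C (HX_act C 1) (HX_act C (iX x)) - tens_act C (M.TX \<Upsilon> x) (HX_act C 1))"
      unfolding M.right_antipode_X[OF compatible, symmetric]
      by (simp add: tens_nf_simps HX_act_mult)
    then show ?thesis
      by (simp add: GX antipode_simps tens_nf_tens act_T_X)
  qed
  then show "T.right_map (cop C (gen g)) - tens (antipode_expr T_X (gen g)) 1 \<in> tensor_kernel C"
    by (simp only: tens_nf_eq_iff)
qed

lemma invertible_antipode: "invertible_antipode (HX C) S T"
proof -
  have "HX_act C (antipode_expr S_X (iAop a)) = HX_act C (iA a)"
    "HX_act C (antipode_expr T_X (iA a)) = HX_act C (iAop a)" for a
    by (simp_all add: antipode_simps)
  note axioms = S.left_axiom_iff[OF this(1)] T.right_axiom_iff[OF this(2)]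
  show ?thesis
    unfolding invertible_antipode_def
  proof (intro conjI ballI allI)
    show "S (tgt (HX C) a) = src (HX C) a" for a
      by (simp add: S.lift antipode_expr_gen)
  next
    fix b
    assume "b \<in> carrier (HX C)"
    then obtain f where b: "b = HX_class C f" by auto
    show "diamond_class (HX C)
        (frag_extend (\<lambda>(b1, b2).
          frag_extend (\<lambda>(c1, c2). frag_of (c1 \<otimes>\<^bsub>HX C\<^esub> b2, c2)) (sweedler (HX C) (S b1)))
          (sweedler (HX C) b))
      = diamond_class (HX C) (frag_of (\<one>\<^bsub>HX C\<^esub>, S b))"
      unfolding b axioms by (rule left_axiom)
    show "diamond_class (HX C)
        (frag_extend (\<lambda>(b1, b2).
          frag_extend (\<lambda>(c1, c2). frag_of (c1, c2 \<otimes>\<^bsub>HX C\<^esub> b1)) (sweedler (HX C) (T b2)))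
          (sweedler (HX C) b))
      = diamond_class (HX C) (frag_of (T b, \<one>\<^bsub>HX C\<^esub>))"
      unfolding b axioms by (rule right_axiom)
  qed (rule S.anti_algebra_hom mutually_inverse)+
qed

end


section \<open>The compatible map of an antipode\<close>

context pivotal_calculus
begin

lemma antipode_imp_compatible_map:
  assumes antipode: "invertible_antipode (HX C) S T" and ext: "extends_H_antipode C S"
  shows "\<exists>\<Upsilon>. compatible_map C \<Upsilon>"
proof -
  \<comment> \<open>Taking the normal form of the chosen representative makes \<open>s\<close>
    additive and linear as a map of expressions; \<open>repr\<close> alone would give this only
    modulo the ideal.\<close>
  define s where "s f = HX_nf C (repr (S (HX_class C f)))" for f
  from antipode have ring_hom: "S \<in> ring_hom (HX C) (opposite_ring (HX C))"
    and smult: "\<And>k b. b \<in> carrier (HX C) \<Longrightarrow> S (k \<odot>\<^bsub>HX C\<^esub> b) = k \<odot>\<^bsub>HX C\<^esub> S b"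
    by (simp_all only: invertible_antipode_def anti_algebra_hom_def)
  have hom: "S (HX_class C (f * g)) = S (HX_class C g) \<otimes>\<^bsub>HX C\<^esub> S (HX_class C f)"
    "S (HX_class C (f + g)) = S (HX_class C f) \<oplus>\<^bsub>HX C\<^esub> S (HX_class C g)"
    "S (HX_class C (scalar k * f)) = k \<odot>\<^bsub>HX C\<^esub> S (HX_class C f)"
    "S (HX_class C f) \<in> carrier (HX C)" for f g k
    using ring_hom_mult[OF ring_hom, of "HX_class C f" "HX_class C g"]
      ring_hom_add[OF ring_hom, of "HX_class C f" "HX_class C g"]
      ring_hom_closed[OF ring_hom, of "HX_class C f"] smult[of "HX_class C f" k]
    by (simp_all add: opposite_ring_def)
  have lift: "S (HX_class C f) = HX_class C (s f)" for f
  proof -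
    have "HX_class C (s f) = HX_class C (repr (S (HX_class C f)))"
      unfolding s_def HX_class_eq_iff by (rule HX_nf(4))
    then show ?thesis
      using HX_class_repr[of "S (HX_class C f)"] hom(4)[of f] by simp
  qed
  have s_eqI: "s f = HX_nf C g" if "S (HX_class C f) = HX_class C g" for f g
    unfolding s_def that HX_nf_eq_iff by (rule repr_HX_class)
  have nf_s: "HX_nf C (s f) = s f" for f
    using s_eqI[OF lift] by simp
  have act_eq: "HX_act C (s f) = HX_act C g" if "S (HX_class C f) = HX_class C g" for f g
    using that by (simp add: lift HX_class_eq_act)
  have mult: "HX_act C (s (f * g)) = HX_act C (s g) * HX_act C (s f)" for f g
    unfolding HX_act_mult[symmetric] using hom(1)[of f g] by (intro act_eq) (simp add: lift)
  interpret anti_lift C S s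
  proof unfold_locales
    show "s (f + g) = s f + s g" for f g
      using s_eqI[of "f + g" "s f + s g"] hom(2)[of f g] by (simp add: lift additive.add[OF HX_nf(1)] nf_s)
    show "s (scalar k * f) = scalar k * s f" for k f
      using s_eqI[of "scalar k * f" "scalar k * s f"] hom(3)[of k f] by (simp add: lift HX_nf(2) scalar_def nf_s)
    show "s f \<in> HX_ideal C" if "f \<in> HX_ideal C" for f
    proof -
      have "S (HX_class C 0) \<oplus>\<^bsub>HX C\<^esub> S (HX_class C 0) = S (HX_class C 0)"
        using hom(2)[of 0 0] by simp
      then have "s 0 \<in> HX_ideal C"
        by (simp add: lift HX_class_eq_iff)
      moreover have "HX_class C f = HX_class C 0"
        using that by (simp add: HX_class_eq_iff)
      ultimately show ?thesis by (simp add: s_def)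
    qed
  qed (rule lift mult)+
  have gens: "HX_act C (s (iA a)) = HX_act C (iAop a)" "HX_act C (s (iAop a)) = HX_act C (iA a)"
    "HX_act C (s (iXW x w)) = HX_act C (iWX w x)" for a x w
    using ext by (auto intro!: act_eq simp: extends_H_antipode_def)
  have "left_map (cop C (iX x)) - tens 1 (s (iX x)) \<in> tensor_kernel C" for x
    using antipode left_axiom_iff[OF gens(2), of "iX x"] by (simp add: invertible_antipode_def)
  then have counit_left: "right_counit (left_map (cop C (iX x))) = right_counit (tens 1 (s (iX x)))" for x
    using right_counit_tensor_kernel[of "left_map (cop C (iX x)) - tens 1 (s (iX x))"]
    by (simp add: additive.diff[OF additive_right_counit])
  define \<Upsilon> where "\<Upsilon> x = - counit C (s (iX x))" for x
  have act_s: "HX_act C (s (iX x)) = - psum (coev C) (\<lambda>wi xi. HX_act C (iWX wi x) * HX_act C (iX xi))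
      - HX_act C (iAop (\<Upsilon> x))" for x
  proof -
    \<comment> \<open>\<open>right_counit\<close> collapses the coproduct of \<open>s (iX x)\<close>
      to \<open>s (iX x)\<close>, and \<open>cop C (s (iXW x wi)) * tens (iX xi) 1\<close> to the
      plain product.\<close>
    have "HX_nf C (s (iX x) + psum (coev C) (\<lambda>wi xi. s (iXW x wi) * iX xi))
      = right_counit (left_map (cop C (iX x)))"
      by (simp add: cop_generators(5) additive.add[OF additive_left_map] additive_psum[OF additive_left_map]
          left_map_tens additive.add[OF additive_right_counit] additive_psum[OF additive_right_counit]
          right_counit_cop right_counit_cop_mult right_counit_tens_one HX_nf_mult_nf
          additive.add[OF HX_nf(1)] additive_psum[OF HX_nf(1)])
    also have "\<dots> = HX_nf C (iAop (counit C (s (iX x))))"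
      by (simp add: counit_left right_counit_tens)
    finally have "HX_act C (s (iX x) + psum (coev C) (\<lambda>wi xi. s (iXW x wi) * iX xi))
      = HX_act C (iAop (counit C (s (iX x))))"
      by (simp only: HX_nf_eq_iff HX_act_eq_iff)
    then show ?thesis
      by (simp add: HX_act_simps gens \<Upsilon>_def additive.minus[OF M.additive_Aop] eq_diff_eq)
  qed
  have counit_s_cong: "counit C (s f) = counit C (s g)" if "HX_rel C f g" for f g
    using relation_ideal_rel[of "HX_rel C" f g, OF that] by (intro counit_cong s_cong)
  have act_s_cong: "HX_act C (s f) = HX_act C (s g)" if "HX_rel C f g" for f g
    using relation_ideal_rel[of "HX_rel C" f g, OF that] s_cong by (simp only: HX_act_eq_iff)
  have iAop_inject: "a = b" if "HX_act C (iAop a) = HX_act C (iAop b)" for a b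
    using that counit_cong[of "iAop a" "iAop b"] by (simp add: HX_act_eq_iff counit_iAop)
  have "\<Upsilon> (x + y) = \<Upsilon> x + \<Upsilon> y" for x y
    by (simp add: \<Upsilon>_def counit_s_cong[OF HX_rel.X_add] additive.add[OF additive_s]
        additive.add[OF additive_counit])
  moreover have "\<Upsilon> (lX C (scl C k 1) x) = scl C k (\<Upsilon> x)" for k x
    by (simp add: \<Upsilon>_def counit_s_cong[OF HX_rel.X_scl] s_scalar counit_scalar
        additive.minus[OF additive_scl])
  moreover have "vector_space (\<lambda>k. lX C (scl C k 1))"
    by standard (simp_all add: X.l_add_right X.l_add_left X.l_one alg.scale_left_distrib
        flip: X.l_assoc scl_eq_mult)
  ultimately have linear: "Vector_Spaces.linear (\<lambda>k. lX C (scl C k 1)) (scl C) \<Upsilon>"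
    unfolding Vector_Spaces.linear_iff using alg.vector_space_axioms by blast
  have rX: "\<Upsilon> (rX C x a) = \<Upsilon> x * a + ev C x (dif C a)" for x a
  proof (rule iAop_inject)
    \<comment> \<open>After inserting \<open>act_s\<close>, the same sum over the dual basis stands
      on both sides, since \<open>iAop a\<close> turns \<open>iWX wi x\<close> into
      \<open>iWX wi (rX C x a)\<close>; only elements of the opposite copy remain.\<close>
    have "HX_act C (iAop a) * HX_act C (s (iX x)) = HX_act C (s (iX (rX C x a))) + HX_act C (iAop (ev C x (dif C a)))"
      using act_s_cong[OF HX_rel.X_A[of C x a]] by (simp add: s_mult gens additive.add[OF additive_s] HX_act_simps)
    then show "HX_act C (iAop (\<Upsilon> (rX C x a))) = HX_act C (iAop (\<Upsilon> x * a + ev C x (dif C a)))"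
      by (simp add: act_s right_diff_distrib psum_mult_left M.bimodule_simps M.adds)
        (simp add: algebra_simps)
  qed
  have lX: "\<Upsilon> (lX C a x) = a * \<Upsilon> x + uev C (dif C a) x" for x a
  proof (rule iAop_inject)
    \<comment> \<open>This time \<open>iAop a\<close> must pass \<open>iX xi\<close>; the
      corrections \<open>iXW xi (dif C a)\<close> contract and produce the \<open>uev\<close>
      term.\<close>
    have "HX_act C (s (iX x)) * HX_act C (iAop a) = HX_act C (s (iX (lX C a x)))"
      using act_s_cong[OF HX_rel.A_X[of C a x]] by (simp add: s_mult gens)
    then show "HX_act C (iAop (\<Upsilon> (lX C a x))) = HX_act C (iAop (a * \<Upsilon> x + uev C (dif C a) x))"
      by (simp add: act_s left_diff_distrib psum_mult_right M.bimodule_simps M.adds M.X_Aop distrib_left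
          psum_add M.WX_XW_coev) (simp add: algebra_simps)
  qed
  show ?thesis
    using linear rX lX by (auto simp: compatible_map_def)
qed

end

theorem theorem4p13:
  fixes C :: "('k::field, 'a::{ring,monoid_mult}, 'w::ab_group_add, 'x::ab_group_add) calculus"
  assumes "pivotal_calculus C"
  shows "((\<exists>S T. invertible_antipode (HX C) S T \<and> extends_H_antipode C S) \<longleftrightarrow>
      (\<exists>\<Upsilon>. compatible_map C \<Upsilon>)) \<and>
    (\<forall>\<Upsilon>. compatible_map C \<Upsilon> \<longrightarrow>
      (\<exists>S T. anti_algebra_hom (HX C) S \<and> anti_algebra_hom (HX C) T \<and>
        extends_H_antipode C S \<and> extends_H_antipode C T \<and>
        (\<forall>x. S (HX_class C (iX x)) =
          HX_class C (- (\<Sum>(wi, xi)\<leftarrow>coev C. iWX wi x * iX xi) - iAop (\<Upsilon> x))) \<and>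
        (\<forall>x. T (HX_class C (iX x)) =
          HX_class C (- (\<Sum>(yj, rj)\<leftarrow>ucoev C. (iX yj + iA (\<Upsilon> yj)) * iWX rj x))) \<and>
        mutually_inverse (HX C) S T \<and>
        invertible_antipode (HX C) S T))"
proof -
  interpret pivotal_calculus C by (rule assms)
  have explicit: "\<exists>S T. anti_algebra_hom (HX C) S \<and> anti_algebra_hom (HX C) T \<and>
        extends_H_antipode C S \<and> extends_H_antipode C T \<and>
        (\<forall>x. S (HX_class C (iX x)) =
          HX_class C (- (\<Sum>(wi, xi)\<leftarrow>coev C. iWX wi x * iX xi) - iAop (\<Upsilon> x))) \<and>
        (\<forall>x. T (HX_class C (iX x)) =
          HX_class C (- (\<Sum>(yj, rj)\<leftarrow>ucoev C. (iX yj + iA (\<Upsilon> yj)) * iWX rj x))) \<and>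
        mutually_inverse (HX C) S T \<and> invertible_antipode (HX C) S T"
    if "compatible_map C \<Upsilon>" for \<Upsilon>
  proof -
    interpret compatible_calculus C \<Upsilon>
      by unfold_locales (rule that)
    show ?thesis
      using S.anti_algebra_hom T.anti_algebra_hom S.extends_H_antipode T.extends_H_antipode
        mutually_inverse invertible_antipode
      by (intro exI[of _ S] exI[of _ T])
        (simp add: S.lift T.lift antipode_expr_gen S_X_def T_X_def psum_def)
  qed
  then show ?thesis
    using antipode_imp_compatible_map by blast
qed

end
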